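(* Let $A=(a_{ij})$ be a $d\times n$ integer matrix whose columns span $\mathbf{Z}^d$. Let $w\in\mathbf{Z}^n$ be a generic weight vector for the affine toric ideal $I_A$ such that $\deg \mathrm{in}_w(I_A)=\deg I_A$. Let $J$ be the left ideal of $R_n=\mathbf{C}(s,x)\langle\partial_1,\ldots,\partial_n\rangle$ generated by $\mathrm{in}_w(I_A)$ and by the operators $E_i-s_i=\sum_{j=1}^n a_{ij}x_j\partial_j-s_i$, $i=1,\ldots,d$. Let $u_1,\ldots,u_r$ be a monomial basis of $R_n/(R_nJ)$ as a vector space over $\mathbf{C}(s,x)$. Then the set $\{u_1,\ldots,u_r\}$ is a basis of the $\mathbf{C}(s,x)$-vector space $R_n/(R_nH_A(s))$.
   Context: $s=(s_1,\ldots,s_d)$ are indeterminates, $x=(x_1,\ldots,x_n)$, $\partial_i=\partial/\partial x_i$. $R_n=\mathbf{C}(s,x)\langle\partial_1,\ldots,\partial_n\rangle$ is the ring of differential operators in $x$ whose coefficients are rational functions in $s$ and $x$ (the $s_i$ commute with everything). $I_A\subset\mathbf{C}[\partial_1,\ldots,\partial_n]$ is the affine toric ideal, generated by all $\prod_i\partial_i^{u_i}-\prod_j\partial_j^{v_j}$ with $u,v\in\mathbf{N}_0^n$ and $Au=Av$. $I_A$ is not assumed homogeneous. $H_A(s)$ is the left ideal of $\mathbf{C}(s)\langle x_1,\ldots,x_n,\partial_1,\ldots,\partial_n\rangle$ generated by $I_A$ and by $E_i-s_i=\sum_{j=1}^n a_{ij}x_j\partial_j-s_i$ for $i=1,\ldots,d$.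 $R_nH_A(s)$ is the left ideal it generates in $R_n$. $\mathrm{in}_w(I_A)$ is the initial ideal of $I_A$ with respect to the weight $w$ (generated by the sums of the terms of maximal $w$-weight of the elements of $I_A$). "$w$ generic" means that $\mathrm{in}_w(I_A)$ is a monomial ideal. $\deg$ denotes the degree of an ideal of the polynomial ring $\mathbf{C}[\partial]$ ($d!$ times the leading coefficient of the degree-$d$ affine Hilbert polynomial; $\deg I_A$ is the normalized volume of $A$, i.e. of the convex hull of the origin and the columns of $A$). A monomial basis is a set of monomials in the $\partial_j$ whose classes form a basis of the quotient. *)

theory Defs
  imports
    "HOL-Analysis.Analysis"
    "HOL-Library.Poly_Mapping"
    "HOL-Computational_Algebra.Computational_Algebra"
begin

section \<open>The field of rational functions in \<open>s\<close> and \<open>x\<close>\<close>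

datatype ('d, 'n) indet = S_var 'd | X_var 'n

text \<open>
  The linear order on the indeterminates has no mathematical significance; it is only there because
  the library proves that a polynomial ring is an integral domain for linearly ordered
  indeterminates. It is obtained from an injection into the natural numbers, so that no order on
  the index types is assumed.
\<close>

fun indet_code :: "('d::countable, 'n::countable) indet \<Rightarrow> nat" where
  "indet_code (S_var i) = 2 * to_nat i"
| "indet_code (X_var j) = 2 * to_nat j + 1"

lemma indet_code_inject: "indet_code u = indet_code v \<longleftrightarrow> u = v"
  by (cases u; cases v; simp; presburger?)

instantiation indet :: (countable, countable) linorder
begin

definition less_eq_indet :: "('a, 'b) indet \<Rightarrow> ('a, 'b) indet \<Rightarrow> bool" where
  "less_eq_indet u v \<longleftrightarrow> indet_code u \<le> indet_code v"

definition less_indet :: "('a, 'b) indet \<Rightarrow> ('a, 'b) indet \<Rightarrow> bool" where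
  "less_indet u v \<longleftrightarrow> indet_code u < indet_code v"

instance
  by standard (auto simp: less_eq_indet_def less_indet_def indet_code_inject)

end

type_synonym ('d, 'n) sxpoly = "(('d, 'n) indet \<Rightarrow>\<^sub>0 nat) \<Rightarrow>\<^sub>0 complex"
type_synonym ('d, 'n) ratfun = "('d, 'n) sxpoly fract"

abbreviation const_poly :: "'c \<Rightarrow> ('v \<Rightarrow>\<^sub>0 nat) \<Rightarrow>\<^sub>0 'c::zero" where
  "const_poly c \<equiv> Poly_Mapping.single 0 c"

definition var_poly :: "'v \<Rightarrow> ('v \<Rightarrow>\<^sub>0 nat) \<Rightarrow>\<^sub>0 'c::zero_neq_one" where
  "var_poly v = Poly_Mapping.single (Poly_Mapping.single v 1) 1"

definition ratfun_const :: "complex \<Rightarrow> ('d::finite, 'n::finite) ratfun" where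
  "ratfun_const c = to_fract (const_poly c)"

definition s_ratfun :: "'d::finite \<Rightarrow> ('d, 'n::finite) ratfun" where
  "s_ratfun i = to_fract (var_poly (S_var i))"

definition x_ratfun :: "'n::finite \<Rightarrow> ('d::finite, 'n) ratfun" where
  "x_ratfun j = to_fract (var_poly (X_var j))"

definition s_only :: "('d, 'n) sxpoly \<Rightarrow> bool" where
  "s_only p \<longleftrightarrow> (\<forall>m\<in>Poly_Mapping.keys p. \<forall>j. Poly_Mapping.lookup m (X_var j) = 0)"

definition s_ratfuns :: "('d::finite, 'n::finite) ratfun set" where
  "s_ratfuns = {to_fract p / to_fract q | p q. s_only p \<and> s_only q \<and> q \<noteq> 0}"


section \<open>Partial derivatives\<close>

definition poly_deriv :: "'v \<Rightarrow> (('v \<Rightarrow>\<^sub>0 nat) \<Rightarrow>\<^sub>0 'c::comm_ring_1) \<Rightarrow> (('v \<Rightarrow>\<^sub>0 nat) \<Rightarrow>\<^sub>0 'c)" where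
  "poly_deriv v p = (\<Sum>m\<in>Poly_Mapping.keys p.
     Poly_Mapping.single (m - Poly_Mapping.single v 1)
       (of_nat (Poly_Mapping.lookup m v) * Poly_Mapping.lookup p m))"

lemma poly_deriv_add: "poly_deriv v (p + q) = poly_deriv v p + poly_deriv v q"
  unfolding poly_deriv_def
  by (rule setsum_keys_plus_distrib) (simp_all add: distrib_left single_add)

lemma poly_deriv_0 [simp]: "poly_deriv v 0 = 0"
  by (simp add: poly_deriv_def)

lemma poly_deriv_1 [simp]: "poly_deriv v 1 = 0"
  by (simp add: poly_deriv_def)

lemma poly_deriv_single:
  "poly_deriv v (Poly_Mapping.single m c) =
     Poly_Mapping.single (m - Poly_Mapping.single v 1) (of_nat (Poly_Mapping.lookup m v) * c)"
  by (simp add: poly_deriv_def)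

lemma poly_mapping_single_induct [case_names zero single add]:
  assumes "P 0" "\<And>m c. P (Poly_Mapping.single m c)" "\<And>p q. P p \<Longrightarrow> P q \<Longrightarrow> P (p + q)"
  shows "P (p :: 'm \<Rightarrow>\<^sub>0 'c::comm_monoid_add)"
proof -
  have eq: "p = (\<Sum>m\<in>Poly_Mapping.keys p. Poly_Mapping.single m (Poly_Mapping.lookup p m))"
    by (rule poly_mapping_eqI)
       (auto simp: lookup_sum lookup_single when_def sum.delta' in_keys_iff)
  have "P (\<Sum>m\<in>M. Poly_Mapping.single m (Poly_Mapping.lookup p m))" if "finite M" for M
    using that by induction (auto intro: assms)
  then show ?thesis by (subst eq) simp
qed

lemma single_minus_shift:
  fixes a b :: "'v \<Rightarrow>\<^sub>0 nat"
  shows "Poly_Mapping.single ((a - Poly_Mapping.single v 1) + b) (of_nat (Poly_Mapping.lookup a v) * (c::'c::comm_ring_1))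
       = Poly_Mapping.single (a + b - Poly_Mapping.single v 1) (of_nat (Poly_Mapping.lookup a v) * c)"
proof (cases "Poly_Mapping.lookup a v = 0")
  case False
  then have "(a - Poly_Mapping.single v 1) + b = a + b - Poly_Mapping.single v 1"
    by (intro poly_mapping_eqI) (auto simp: lookup_add lookup_minus lookup_single when_def)
  then show ?thesis by simp
qed simp

lemma poly_deriv_mult: "poly_deriv v (p * q) = poly_deriv v p * q + p * poly_deriv v q"
proof (induction p rule: poly_mapping_single_induct)
  case (single a c)
  show ?case
  proof (induction q rule: poly_mapping_single_induct)
    case (single b e)
    have 1: "Poly_Mapping.single ((a - Poly_Mapping.single v 1) + b) (of_nat (Poly_Mapping.lookup a v) * (c * e))
        = Poly_Mapping.single (a + b - Poly_Mapping.single v 1) (of_nat (Poly_Mapping.lookup a v) * (c * e))"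
      by (rule single_minus_shift)
    have 2: "Poly_Mapping.single (a + (b - Poly_Mapping.single v 1)) (of_nat (Poly_Mapping.lookup b v) * (c * e))
        = Poly_Mapping.single (a + b - Poly_Mapping.single v 1) (of_nat (Poly_Mapping.lookup b v) * (c * e))"
      using single_minus_shift[of b v a "c * e"] by (simp add: add.commute)
    have "poly_deriv v (Poly_Mapping.single a c * Poly_Mapping.single b e) =
        Poly_Mapping.single (a + b - Poly_Mapping.single v 1) (of_nat (Poly_Mapping.lookup a v) * (c * e)) +
        Poly_Mapping.single (a + b - Poly_Mapping.single v 1) (of_nat (Poly_Mapping.lookup b v) * (c * e))"
      unfolding mult_single poly_deriv_single by (simp only: lookup_add of_nat_add distrib_right single_add)
    also have "\<dots> = poly_deriv v (Poly_Mapping.single a c) * Poly_Mapping.single b e +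
        Poly_Mapping.single a c * poly_deriv v (Poly_Mapping.single b e)"
      unfolding mult_single poly_deriv_single 1[symmetric] 2[symmetric] by (simp only: mult_ac)
    finally show ?case .
  qed (simp_all add: poly_deriv_add distrib_left)
qed (simp_all add: poly_deriv_add distrib_right)

lemma poly_deriv_diff: "poly_deriv v (p - q) = poly_deriv v p - poly_deriv v q"
  using poly_deriv_add[of v "p - q" q] by (simp add: algebra_simps)

lemma poly_deriv_commute: "poly_deriv u (poly_deriv v p) = poly_deriv v (poly_deriv u p)"
proof (induction p rule: poly_mapping_single_induct)
  case (single m c)
  show ?case
    by (cases "u = v")
       (simp_all add: poly_deriv_single lookup_minus lookup_single when_def diff_diff_add add.commute mult_ac)
qed (simp_all add: poly_deriv_add)

text \<open>The quotient rule, which does not depend on the chosen representation as a fraction.\<close>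

definition ratfun_deriv ::
    "('d::finite, 'n::finite) indet \<Rightarrow> ('d, 'n) ratfun \<Rightarrow> ('d, 'n) ratfun" where
  "ratfun_deriv v f = (THE g. \<forall>a b. b \<noteq> 0 \<and> f = Fract a b \<longrightarrow>
     g = Fract (poly_deriv v a * b - a * poly_deriv v b) (b * b))"

lemma ratfun_deriv_Fract:
  assumes "b \<noteq> 0"
  shows "ratfun_deriv v (Fract a b) = Fract (poly_deriv v a * b - a * poly_deriv v b) (b * b)"
proof -
  let ?D = "poly_deriv v"
  have "Fract (?D a * b - a * ?D b) (b * b) = Fract (?D c * d - c * ?D d) (d * d)"
    if "d \<noteq> 0" and "Fract a b = Fract c d" for c d
  proof -
    have e: "a * d = c * b" using that assms by (simp add: eq_fract)
    then have "?D (a * d) = ?D (c * b)" by simp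
    then have De: "?D a * d + a * ?D d = ?D c * b + c * ?D b" by (simp add: poly_deriv_mult)
    have "(?D a * b - a * ?D b) * (d * d) - (?D c * d - c * ?D d) * (b * b)
        = b * d * ((?D a * d + a * ?D d) - (?D c * b + c * ?D b))
          - (b * ?D d + d * ?D b) * (a * d - c * b)"
      by (simp add: algebra_simps)
    also have "\<dots> = 0" using e De by simp
    finally show ?thesis using assms that by (simp add: eq_fract)
  qed
  then show ?thesis
    unfolding ratfun_deriv_def using assms by (intro the_equality) blast+
qed

lemma ratfun_deriv_add: "ratfun_deriv v (f + g) = ratfun_deriv v f + ratfun_deriv v g"
  by (cases f; cases g) (simp add: ratfun_deriv_Fract eq_fract poly_deriv_add poly_deriv_mult algebra_simps)

lemma ratfun_deriv_mult: "ratfun_deriv v (f * g) = ratfun_deriv v f * g + f * ratfun_deriv v g"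
  by (cases f; cases g) (simp add: ratfun_deriv_Fract eq_fract poly_deriv_mult algebra_simps)

lemma ratfun_deriv_commute: "ratfun_deriv u (ratfun_deriv v f) = ratfun_deriv v (ratfun_deriv u f)"
  by (cases f)
     (simp add: ratfun_deriv_Fract eq_fract poly_deriv_mult poly_deriv_diff poly_deriv_commute[of u v]
       algebra_simps)


section \<open>The ring of differential operators \<open>C(s,x)\<langle>\<partial>\<rangle>\<close>\<close>

text \<open>
  Differential operators are realised as operators on \<open>C(s,x)\<close>: the ring generated, under pointwise
  addition and composition, by the multiplications by rational functions and the derivations with
  respect to the \<open>x\<^sub>j\<close>.  As the characteristic is zero this is the ring given by generators and
  relations: the powers of the \<open>\<partial>\<^sub>j\<close> are linearly independent over \<open>C(s,x)\<close> as operators.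
\<close>

inductive_set diffop_set ::
    "(('d::finite, 'n::finite) ratfun \<Rightarrow> ('d, 'n) ratfun) set" where
  mult: "(\<lambda>g. f * g) \<in> diffop_set"
| deriv: "ratfun_deriv (X_var j) \<in> diffop_set"
| add: "P \<in> diffop_set \<Longrightarrow> Q \<in> diffop_set \<Longrightarrow> (\<lambda>g. P g + Q g) \<in> diffop_set"
| comp: "P \<in> diffop_set \<Longrightarrow> Q \<in> diffop_set \<Longrightarrow> (\<lambda>g. P (Q g)) \<in> diffop_set"

lemma diffop_set_additive: "P \<in> diffop_set \<Longrightarrow> P (f + g) = P f + P g"
  by (induction arbitrary: f g rule: diffop_set.induct)
     (simp_all add: distrib_left ratfun_deriv_add)

lemma diffop_set_cong: "P \<in> diffop_set \<Longrightarrow> (\<And>g. Q g = P g) \<Longrightarrow> Q \<in> diffop_set"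
  by (subgoal_tac "Q = P") auto

typedef (overloaded) ('d::finite, 'n::finite) diffop =
  "diffop_set :: (('d, 'n) ratfun \<Rightarrow> ('d, 'n) ratfun) set"
  by (blast intro: diffop_set.mult)

lifting_forget fract.lifting
setup_lifting type_definition_diffop

instantiation diffop :: (finite, finite) ring_1
begin

lift_definition zero_diffop :: "('a, 'b) diffop" is "\<lambda>g :: ('a, 'b) ratfun. 0 :: ('a, 'b) ratfun"
  by (rule diffop_set_cong[OF diffop_set.mult[of 0]]) simp

lift_definition one_diffop :: "('a, 'b) diffop" is "\<lambda>g :: ('a, 'b) ratfun. g"
  by (rule diffop_set_cong[OF diffop_set.mult[of 1]]) simp

lift_definition plus_diffop :: "('a, 'b) diffop \<Rightarrow> ('a, 'b) diffop \<Rightarrow> ('a, 'b) diffop"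
  is "\<lambda>(P :: ('a, 'b) ratfun \<Rightarrow> ('a, 'b) ratfun) (Q :: ('a, 'b) ratfun \<Rightarrow> ('a, 'b) ratfun) g. P g + Q g" by (rule diffop_set.add)

lift_definition uminus_diffop :: "('a, 'b) diffop \<Rightarrow> ('a, 'b) diffop"
  is "\<lambda>(P :: ('a, 'b) ratfun \<Rightarrow> ('a, 'b) ratfun) g. - P g"
  by (rule diffop_set_cong[OF diffop_set.comp[OF diffop_set.mult[of "-1"]]]) simp_all

lift_definition minus_diffop :: "('a, 'b) diffop \<Rightarrow> ('a, 'b) diffop \<Rightarrow> ('a, 'b) diffop"
  is "\<lambda>(P :: ('a, 'b) ratfun \<Rightarrow> ('a, 'b) ratfun) (Q :: ('a, 'b) ratfun \<Rightarrow> ('a, 'b) ratfun) g. P g - Q g"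
  by (rule diffop_set_cong[OF diffop_set.add[OF _ diffop_set.comp[OF diffop_set.mult[of "-1"]]]]) simp_all

lift_definition times_diffop :: "('a, 'b) diffop \<Rightarrow> ('a, 'b) diffop \<Rightarrow> ('a, 'b) diffop"
  is "\<lambda>(P :: ('a, 'b) ratfun \<Rightarrow> ('a, 'b) ratfun) (Q :: ('a, 'b) ratfun \<Rightarrow> ('a, 'b) ratfun) g. P (Q g)" by (rule diffop_set.comp)

instance
proof
  fix P Q R :: "('a, 'b) diffop"
  show "P * Q * R = P * (Q * R)" "1 * P = P" "P * 1 = P" "P + Q + R = P + (Q + R)"
    "P + Q = Q + P" "0 + P = P" "- P + P = 0" "P - Q = P + - Q" "(P + Q) * R = P * R + Q * R"
    by (transfer, simp add: algebra_simps)+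
  show "P * (Q + R) = P * Q + P * R"
    by transfer (simp add: diffop_set_additive)
  show "(0 :: ('a, 'b) diffop) \<noteq> 1"
    by transfer (metis zero_neq_one)
qed

end

lift_definition d_coef :: "('d::finite, 'n::finite) ratfun \<Rightarrow> ('d, 'n) diffop"
  is "\<lambda>f g :: ('d, 'n) ratfun. f * g" by (rule diffop_set.mult)

lift_definition d_partial :: "'n::finite \<Rightarrow> ('d::finite, 'n) diffop"
  is "\<lambda>j. ratfun_deriv (X_var j) :: ('d, 'n) ratfun \<Rightarrow> ('d, 'n) ratfun" by (rule diffop_set.deriv)

lemma d_partial_commute: "d_partial i * d_partial j = d_partial j * d_partial i"
  by transfer (simp add: ratfun_deriv_commute)

lemma d_partial_coef:
  "d_partial j * d_coef f = d_coef f * d_partial j + d_coef (ratfun_deriv (X_var j) f)"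
  by transfer (simp add: ratfun_deriv_mult add.commute)

lemma ratfun_deriv_s [simp]: "ratfun_deriv (X_var j) (s_ratfun i) = 0"
  by (simp add: s_ratfun_def to_fract_def ratfun_deriv_Fract var_poly_def poly_deriv_single
    lookup_single Zero_fract_def eq_fract)

lemma ratfun_deriv_x [simp]: "ratfun_deriv (X_var j) (x_ratfun k) = (if j = k then 1 else 0)"
  by (simp add: x_ratfun_def to_fract_def ratfun_deriv_Fract var_poly_def poly_deriv_single
    lookup_single Zero_fract_def One_fract_def eq_fract)

definition d_scale :: "('d::finite, 'n::finite) ratfun \<Rightarrow> ('d, 'n) diffop \<Rightarrow> ('d, 'n) diffop" where
  "d_scale f P = d_coef f * P"

text \<open>The fold is over pairwise commuting factors.\<close>

definition d_monom :: "('n::finite \<Rightarrow>\<^sub>0 nat) \<Rightarrow> ('d::finite, 'n) diffop" where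
  "d_monom u = Finite_Set.fold (\<lambda>j P. d_partial j ^ Poly_Mapping.lookup u j * P) 1 UNIV"

lemma d_monom_0 [simp]: "(d_monom (0 :: 'n::finite \<Rightarrow>\<^sub>0 nat) :: ('d::finite, 'n) diffop) = 1"
proof -
  have "Finite_Set.fold (\<lambda>j P. P) (1 :: ('d, 'n) diffop) J = 1" if "finite J" for J :: "'n set"
  proof -
    interpret comp_fun_commute "\<lambda>(j::'n) (P :: ('d, 'n) diffop). P" by standard auto
    show ?thesis using that by induction auto
  qed
  then show ?thesis by (simp add: d_monom_def)
qed

lemma d_monom_single_add:
  "(d_monom (Poly_Mapping.single i 1 + u) :: ('d::finite, 'n::finite) diffop) = d_partial i * d_monom u"
proof -
  have comm: "d_partial i ^ k * d_partial j ^ l = d_partial j ^ l * (d_partial i ^ k :: ('d, 'n) diffop)"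
    for i j k l
    by (rule power_commuting_commutes[OF power_commuting_commutes[OF d_partial_commute, symmetric], symmetric])
  have comm1: "d_partial i * d_partial j ^ l = d_partial j ^ l * (d_partial i :: ('d, 'n) diffop)" for i j l
    using comm[of i 1 j l] by simp
  have cfc: "comp_fun_commute (\<lambda>j (P :: ('d, 'n) diffop). d_partial j ^ Poly_Mapping.lookup v j * P)"
    for v :: "'n \<Rightarrow>\<^sub>0 nat"
    by standard (simp add: fun_eq_iff comm flip: mult.assoc)
  define F where "F v J = Finite_Set.fold (\<lambda>j P. d_partial j ^ Poly_Mapping.lookup v j * P)
    (1 :: ('d, 'n) diffop) J" for v :: "'n \<Rightarrow>\<^sub>0 nat" and J
  have F_insert: "F v (insert j J) = d_partial j ^ Poly_Mapping.lookup v j * F v J"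
    if "finite J" "j \<notin> J" for v j J
    unfolding F_def 
    using comp_fun_commute_on.fold_insert[OF cfc[of v, unfolded comp_fun_commute_def'] _ that] by simp
  have "F (Poly_Mapping.single i 1 + u) J = (if i \<in> J then d_partial i * F u J else F u J)"
    if "finite J" for J
    using that
  proof induction
    case empty
    show ?case by (simp add: F_def)
  next
    case (insert j J)
    then show ?case
      by (auto simp: F_insert lookup_add lookup_single when_def mult.assoc comm1 simp flip: mult.assoc)
  qed
  then show ?thesis by (simp add: d_monom_def F_def)
qed

type_synonym 'n dpoly = "('n \<Rightarrow>\<^sub>0 nat) \<Rightarrow>\<^sub>0 complex"

definition d_embed :: "'n::finite dpoly \<Rightarrow> ('d::finite, 'n) diffop" where
  "d_embed p = (\<Sum>u\<in>Poly_Mapping.keys p.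
     d_coef (ratfun_const (Poly_Mapping.lookup p u)) * d_monom u)"


section \<open>Ideals and quotients\<close>

definition left_ideal_of :: "'r::ring_1 set \<Rightarrow> 'r set \<Rightarrow> bool" where
  "left_ideal_of D I \<longleftrightarrow>
     I \<subseteq> D \<and> 0 \<in> I \<and> (\<forall>p\<in>I. \<forall>q\<in>I. p + q \<in> I) \<and> (\<forall>r\<in>D. \<forall>p\<in>I. r * p \<in> I)"

definition left_ideal_gen :: "'r::ring_1 set \<Rightarrow> 'r set \<Rightarrow> 'r set" where
  "left_ideal_gen D G = left_ideal_of D hull G"

abbreviation poly_ideal :: "'n dpoly set \<Rightarrow> 'n dpoly set" where
  "poly_ideal G \<equiv> left_ideal_gen UNIV G"

inductive_set subring_gen :: "'r::ring_1 set \<Rightarrow> 'r set" for G where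
  gen: "p \<in> G \<Longrightarrow> p \<in> subring_gen G"
| one: "1 \<in> subring_gen G"
| diff: "p \<in> subring_gen G \<Longrightarrow> q \<in> subring_gen G \<Longrightarrow> p - q \<in> subring_gen G"
| mult: "p \<in> subring_gen G \<Longrightarrow> q \<in> subring_gen G \<Longrightarrow> p * q \<in> subring_gen G"

text \<open>
  The classes in \<open>V / W\<close> of the elements of \<open>B\<close> form a basis; the coefficients are indexed by \<open>B\<close>
  itself, so these classes are in particular pairwise distinct.
\<close>

definition quot_basis ::
    "('k::field \<Rightarrow> 'v::ab_group_add \<Rightarrow> 'v) \<Rightarrow> 'v set \<Rightarrow> 'v set \<Rightarrow> 'v set \<Rightarrow> bool" where
  "quot_basis smul V W B \<longleftrightarrow>
     B \<subseteq> V \<and>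
     (\<forall>F c. finite F \<and> F \<subseteq> B \<and> (\<Sum>b\<in>F. smul (c b) b) \<in> W \<longrightarrow> (\<forall>b\<in>F. c b = 0)) \<and>
     (\<forall>v\<in>V. \<exists>F c. finite F \<and> F \<subseteq> B \<and> v - (\<Sum>b\<in>F. smul (c b) b) \<in> W)"

definition quot_dim ::
    "('k::field \<Rightarrow> 'v::ab_group_add \<Rightarrow> 'v) \<Rightarrow> 'v set \<Rightarrow> 'v set \<Rightarrow> nat" where
  "quot_dim smul V W = card (SOME B. quot_basis smul V W B)"


section \<open>The degree of a polynomial ideal\<close>

definition dpoly_upto :: "nat \<Rightarrow> 'n::finite dpoly set" where
  "dpoly_upto t = {p. \<forall>u\<in>Poly_Mapping.keys p. (\<Sum>j\<in>UNIV. Poly_Mapping.lookup u j) \<le> t}"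

definition affine_hilbert_function :: "'n::finite dpoly set \<Rightarrow> nat \<Rightarrow> nat" where
  "affine_hilbert_function I t =
     quot_dim (\<lambda>c p. const_poly c * p) (dpoly_upto t) (I \<inter> dpoly_upto t)"

definition affine_hilbert_poly :: "'n::finite dpoly set \<Rightarrow> rat poly" where
  "affine_hilbert_poly I =
     (THE h. \<forall>\<^sub>F t in sequentially. poly h (of_nat t) = of_nat (affine_hilbert_function I t))"

text \<open>
  The coefficient in degree \<open>d\<close> is the leading one when the affine Hilbert polynomial has degree \<open>d\<close>,
  and \<open>0\<close> when the degree is smaller. The toric ideal of a matrix of rank \<open>d\<close> has a Hilbert polynomial
  of degree \<open>d\<close>; an initial ideal of it has one of degree \<open>d\<close> as well, unless it is the unit ideal
  (which can happen for a weight with negative entries).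
\<close>

definition ideal_degree :: "nat \<Rightarrow> 'n::finite dpoly set \<Rightarrow> rat" where
  "ideal_degree d I = fact d * poly.coeff (affine_hilbert_poly I) d"


section \<open>Toric ideals, initial ideals and hypergeometric ideals\<close>

definition int_exponent :: "('n::finite \<Rightarrow>\<^sub>0 nat) \<Rightarrow> int ^ 'n" where
  "int_exponent u = (\<chi> j. int (Poly_Mapping.lookup u j))"

definition toric_ideal :: "int ^ 'n::finite ^ 'd::finite \<Rightarrow> 'n dpoly set" where
  "toric_ideal A = poly_ideal
     {Poly_Mapping.single u 1 - Poly_Mapping.single v 1 | u v.
        A *v int_exponent u = A *v int_exponent v}"

definition weight :: "int ^ 'n::finite \<Rightarrow> ('n \<Rightarrow>\<^sub>0 nat) \<Rightarrow> int" where
  "weight w u = (\<Sum>j\<in>UNIV. w $ j * int (Poly_Mapping.lookup u j))"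

definition initial_form :: "int ^ 'n::finite \<Rightarrow> 'n dpoly \<Rightarrow> 'n dpoly" where
  "initial_form w p =
     (\<Sum>u | u \<in> Poly_Mapping.keys p \<and> (\<forall>v\<in>Poly_Mapping.keys p. weight w v \<le> weight w u).
        Poly_Mapping.single u (Poly_Mapping.lookup p u))"

definition initial_ideal :: "int ^ 'n::finite \<Rightarrow> 'n dpoly set \<Rightarrow> 'n dpoly set" where
  "initial_ideal w I = poly_ideal (initial_form w ` I)"

definition monomial_ideal :: "'n dpoly set \<Rightarrow> bool" where
  "monomial_ideal I \<longleftrightarrow> (\<exists>M. I = poly_ideal ((\<lambda>u. Poly_Mapping.single u 1) ` M))"

definition euler_op :: "int ^ 'n::finite ^ 'd::finite \<Rightarrow> 'd \<Rightarrow> ('d, 'n) diffop" where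
  "euler_op A i = (\<Sum>j\<in>UNIV. of_int (A $ i $ j) * d_coef (x_ratfun j) * d_partial j)"

definition euler_ops :: "int ^ 'n::finite ^ 'd::finite \<Rightarrow> ('d, 'n) diffop set" where
  "euler_ops A = range (\<lambda>i. euler_op A i - d_coef (s_ratfun i))"

definition weyl_algebra :: "('d::finite, 'n::finite) diffop set" where
  "weyl_algebra = subring_gen (d_coef ` s_ratfuns \<union> range (\<lambda>j. d_coef (x_ratfun j)) \<union> range d_partial)"

definition hypergeom_ideal :: "int ^ 'n::finite ^ 'd::finite \<Rightarrow> ('d, 'n) diffop set" where
  "hypergeom_ideal A = left_ideal_gen weyl_algebra (d_embed ` toric_ideal A \<union> euler_ops A)"

definition initial_system :: "int ^ 'n::finite ^ 'd::finite \<Rightarrow> int ^ 'n \<Rightarrow> ('d, 'n) diffop set" where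
  "initial_system A w =
     left_ideal_gen UNIV (d_embed ` initial_ideal w (toric_ideal A) \<union> euler_ops A)"

end

theory Submission
  imports Defs
begin

text \<open>
  Normally ordered operators with coefficients in \<open>C[s,x]\<close> are represented by their symbols in the
  commutative ring \<open>C[s,x][\<partial>]\<close>, on which right multiplication by \<open>E\<^sub>i\<close> becomes an operator
  \<open>euler_shift A i\<close> not involving \<open>s\<close>. Modulo the left ideal generated by the \<open>E\<^sub>i - s\<^sub>i\<close> one may therefore
  replace \<open>s\<^sub>i\<close> by \<open>euler_shift A i\<close>, and an \<open>s\<close>-free symbol in that ideal is \<open>0\<close> (specialise
  \<open>s = Av\<close> and apply the operator to \<open>x\<^sup>v\<close>). Thus the system attached to a \<open>\<int>\<^sup>d\<close>-graded ideal \<open>I\<close> is the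
  module \<open>C[x] \<otimes> C[\<partial>]/I\<close> over \<open>C[x][s]\<close>, tensored with \<open>C(s,x)\<close>.

  Taking the part of highest \<open>(-w, w)\<close>-weight of a relation modulo \<open>I\<^sub>A\<close> gives a relation modulo
  \<open>in\<^sub>w(I\<^sub>A)\<close>, so the given monomials stay independent. As each \<open>s\<^sub>i\<close> raises the degree in \<open>\<partial>\<close> by one,
  \<open>r\<close> independent monomials span at least \<open>r m\<^sup>d/d! + O(m\<^sup>d\<^sup>-\<^sup>1)\<close> dimensions in degree \<open>\<le> m\<close>, whence
  \<open>r \<le> deg I\<^sub>A\<close> for every independent set. For \<open>M = in\<^sub>w(I\<^sub>A)\<close> the columns of \<open>A\<close> belonging to a face
  are linearly independent, which makes \<open>C[x] \<otimes> C[\<partial>]/M\<close> finitely generated over \<open>C[x][s]\<close> up to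
  denominators in \<open>x\<close>, and counting dimensions again bounds \<open>deg M\<close> by the cardinality of the given
  basis. The equality of the degrees therefore makes the given set a maximal independent one.
\<close>


text \<open>All dimensions are ranks over \<open>C[x]\<close>, so nonzero factors in
  \<open>C[x]\<close> may be cancelled freely, in particular the \<open>x\<^sup>v\<close> in front
  of \<open>\<partial>\<^sup>v\<close>. Factors involving \<open>s\<close> may not, and this is the
  obstacle in the spanning half: the given basis generates only after division by some
  \<open>q\<close> in \<open>C[s,x]\<close>. If \<open>g\<close> is the leading exponent of
  \<open>q\<close> in \<open>s\<close>, the division leaves over the \<open>s\<^sup>a\<close> that
  \<open>s\<^sup>g\<close> does not divide; in degree \<le> m there are only
  \<open>O(m\<^sup>d\<^sup>-\<^sup>1)\<close> of them, too few to influence the coefficient of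
  \<open>m\<^sup>d\<close>. As \<open>I\<^sub>A\<close> need not be homogeneous, all counts use the
  filtration by degree \<le> m. They are compared with the number of monomials in \<open>s\<close>
  of degree \<le> m, a polynomial in \<open>m\<close> with leading coefficient \<open>1/d!\<close>.
  A face is a set of variables supporting no monomial of \<open>M\<close>. A relation among its
  columns would give two distinct monomials in these variables with the same degree
  \<open>Au\<close>; their difference lies in \<open>I\<^sub>A\<close>, and its initial form puts
  one of them into \<open>M\<close>.\<close>

abbreviation lookup :: "('a \<Rightarrow>\<^sub>0 'b::zero) \<Rightarrow> 'a \<Rightarrow> 'b" where
  "lookup \<equiv> Poly_Mapping.lookup"

abbreviation single :: "'a \<Rightarrow> 'b \<Rightarrow> ('a \<Rightarrow>\<^sub>0 'b::zero)" where
  "single \<equiv> Poly_Mapping.single"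

abbreviation keys :: "('a \<Rightarrow>\<^sub>0 'b::zero) \<Rightarrow> 'a set" where
  "keys \<equiv> Poly_Mapping.keys"


section \<open>Linear systems and quotient bases\<close>

text \<open>Fraction-free Gaussian elimination, so that the solution stays in the subring
  \<open>D\<close>. It serves with \<open>D\<close> a whole field and with \<open>D\<close> the
  \<open>s\<close>-free polynomials inside \<open>C[s,x]\<close>.\<close>

lemma homogeneous_system_nontrivial:
  fixes a :: "'i \<Rightarrow> 'j \<Rightarrow> 'a::idom"
  assumes D: "0 \<in> D" "1 \<in> D" "\<And>x y. x \<in> D \<Longrightarrow> y \<in> D \<Longrightarrow> x - y \<in> D"
      "\<And>x y. x \<in> D \<Longrightarrow> y \<in> D \<Longrightarrow> x * y \<in> D"
    and "finite J" "finite I" "card J < card I"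
    and "\<And>i j. i \<in> I \<Longrightarrow> j \<in> J \<Longrightarrow> a i j \<in> D"
  shows "\<exists>c. (\<forall>i. c i \<in> D) \<and> (\<exists>i\<in>I. c i \<noteq> 0) \<and> (\<forall>j\<in>J. (\<Sum>i\<in>I. c i * a i j) = 0)"
  using assms(5-)
proof (induction J arbitrary: I a rule: finite_induct)
  case empty
  then obtain i where "i \<in> I" by fastforce
  then show ?case using D by (intro exI[of _ "\<lambda>_. 1"]) auto
next
  case (insert j0 J)
  have Dsum: "(\<Sum>i\<in>F. f i) \<in> D" if "\<And>i. i \<in> F \<Longrightarrow> f i \<in> D" for F :: "'i set" and f
    using that
  proof (induction F rule: infinite_finite_induct)
    case (insert x F)
    then have "sum f F \<in> D" by auto
    then have "f x - (0 - sum f F) \<in> D" using insert.prems by (intro D(1,3)) auto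
    then show ?case using insert.hyps by simp
  qed (use D in auto)
  show ?case
  proof (cases "\<forall>i\<in>I. a i j0 = 0")
    case True
    have "\<exists>c. (\<forall>i. c i \<in> D) \<and> (\<exists>i\<in>I. c i \<noteq> 0) \<and> (\<forall>j\<in>J. (\<Sum>i\<in>I. c i * a i j) = 0)"
      using insert.prems insert.hyps by (intro insert.IH) auto
    then obtain c where "\<forall>i. c i \<in> D" "\<exists>i\<in>I. c i \<noteq> 0" "\<forall>j\<in>J. (\<Sum>i\<in>I. c i * a i j) = 0"
      by blast
    then show ?thesis using True by (intro exI[of _ c]) auto
  next
    case False
    then obtain i0 where i0: "i0 \<in> I" "a i0 j0 \<noteq> 0" by auto
    define p where "p = a i0 j0"
    have pD: "p \<in> D" and aD: "\<And>i j. i \<in> I \<Longrightarrow> j \<in> insert j0 J \<Longrightarrow> a i j \<in> D"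
      using insert.prems i0 by (auto simp: p_def)
    \<comment> \<open>The unknown \<open>i0\<close> is solved from equation \<open>j0\<close> after
      multiplication by the pivot \<open>p\<close>; the other unknowns become
      \<open>p * c i\<close>, and \<open>b\<close> is what remains of the other equations.\<close>
    define b where "b i j = p * a i j - a i j0 * a i0 j" for i j
    have "card J < card (I - {i0})" "finite (I - {i0})"
      using insert.prems insert.hyps i0 by (auto simp: card_Diff_singleton)
    moreover have "b i j \<in> D" if "i \<in> I - {i0}" "j \<in> J" for i j
      using aD i0 pD D that by (auto simp: b_def)
    ultimately have "\<exists>c. (\<forall>i. c i \<in> D) \<and> (\<exists>i\<in>I - {i0}. c i \<noteq> 0)
        \<and> (\<forall>j\<in>J. (\<Sum>i\<in>I - {i0}. c i * b i j) = 0)"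
      by (intro insert.IH) auto
    then obtain c where c: "\<And>i. c i \<in> D" "\<exists>i\<in>I - {i0}. c i \<noteq> 0"
        "\<And>j. j \<in> J \<Longrightarrow> (\<Sum>i\<in>I - {i0}. c i * b i j) = 0" by blast
    define e where "e = - (\<Sum>i\<in>I - {i0}. c i * a i j0)"
    define c' where "c' i = (if i = i0 then e else p * c i)" for i
    have "0 - (\<Sum>i\<in>I - {i0}. c i * a i j0) \<in> D"
      using c aD by (intro D(3) D(1) Dsum D(4)) auto
    then have eD: "e \<in> D" by (simp add: e_def)
    have split: "(\<Sum>i\<in>I. c' i * a i j) = e * a i0 j + (\<Sum>i\<in>I - {i0}. p * c i * a i j)" for j
      using insert.prems i0
      by (subst sum.remove[of I i0]) (auto simp: c'_def intro!: sum.cong)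
    have "(\<Sum>i\<in>I. c' i * a i j) = (\<Sum>i\<in>I - {i0}. c i * b i j)" for j
      unfolding split b_def e_def
      by (simp add: algebra_simps sum_subtractf sum_distrib_left sum_distrib_right)
    moreover have "(\<Sum>i\<in>I - {i0}. c i * b i j0) = 0"
      by (simp add: b_def p_def algebra_simps)
    ultimately have "\<forall>j\<in>insert j0 J. (\<Sum>i\<in>I. c' i * a i j) = 0"
      using c(3) by auto
    moreover have "\<exists>i\<in>I. c' i \<noteq> 0"
      using c(2) i0 by (auto simp: c'_def p_def)
    moreover have "\<forall>i. c' i \<in> D" using c(1) eD pD D by (auto simp: c'_def)
    ultimately show ?thesis by blast
  qed
qed

text \<open>Steinitz modulo \<open>W\<close>: with fewer spanning than independent elements, the
  matrix expressing the latter by the former has a nontrivial left kernel, which is a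
  relation.\<close>

lemma card_independent_le_spanning:
  fixes smul :: "'k::field \<Rightarrow> 'v::ab_group_add \<Rightarrow> 'v"
  assumes "module smul" and "module.subspace smul W" and "finite F" and "finite S"
    and span: "\<And>f. f \<in> F \<Longrightarrow> \<exists>c. f - (\<Sum>b\<in>S. smul (c b) b) \<in> W"
    and indep: "\<And>c. (\<Sum>f\<in>F. smul (c f) f) \<in> W \<Longrightarrow> \<forall>f\<in>F. c f = 0"
  shows "card F \<le> card S"
proof (rule ccontr)
  interpret module smul by fact
  note W = \<open>subspace W\<close>
  assume "\<not> card F \<le> card S"
  then have "card S < card F" by simp
  from span have "\<forall>f\<in>F. \<exists>c. f - (\<Sum>b\<in>S. smul (c b) b) \<in> W" by blast
  then obtain m where m: "\<And>f. f \<in> F \<Longrightarrow> f - (\<Sum>b\<in>S. smul (m f b) b) \<in> W"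
    by (auto dest!: bchoice)
  have "\<exists>c. (\<forall>f. c f \<in> UNIV) \<and> (\<exists>f\<in>F. c f \<noteq> 0) \<and> (\<forall>b\<in>S. (\<Sum>f\<in>F. c f * m f b) = 0)"
    using \<open>card S < card F\<close> assms(3,4) by (intro homogeneous_system_nontrivial) auto
  then obtain c where c: "\<exists>f\<in>F. c f \<noteq> 0" "\<And>b. b \<in> S \<Longrightarrow> (\<Sum>f\<in>F. c f * m f b) = 0"
    by blast
  have "(\<Sum>f\<in>F. smul (c f) (f - (\<Sum>b\<in>S. smul (m f b) b))) \<in> W"
    using m W by (intro subspace_sum subspace_scale) auto
  also have "(\<Sum>f\<in>F. smul (c f) (f - (\<Sum>b\<in>S. smul (m f b) b)))
      = (\<Sum>f\<in>F. smul (c f) f) - (\<Sum>f\<in>F. \<Sum>b\<in>S. smul (c f * m f b) b)"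
    by (simp add: scale_right_diff_distrib sum_subtractf scale_sum_right)
  also have "(\<Sum>f\<in>F. \<Sum>b\<in>S. smul (c f * m f b) b) = (\<Sum>b\<in>S. smul (\<Sum>f\<in>F. c f * m f b) b)"
    by (subst sum.swap) (simp add: scale_sum_left)
  also have "\<dots> = 0" using c by simp
  finally show False using indep c(1) by auto
qed

lemma quot_basis_spans:
  assumes "quot_basis smul V W B" "v \<in> V"
  shows "\<exists>F c. finite F \<and> F \<subseteq> B \<and> v - (\<Sum>b\<in>F. smul (c b) b) \<in> W"
  using assms by (simp add: quot_basis_def)

lemma quot_basis_independent:
  assumes "quot_basis smul V W B" "finite F" "F \<subseteq> B" "(\<Sum>b\<in>F. smul (c b) b) \<in> W" "b \<in> F"
  shows "c b = 0"
  using assms by (simp add: quot_basis_def)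

text \<open>\<open>quot_dim\<close> evaluates \<open>card\<close> at a basis picked by choice, so
  all bases must have the same cardinality; infinite ones have to be excluded, since their
  \<open>card\<close> would be 0.\<close>

lemma quot_basis_card_unique:
  fixes smul :: "'k::field \<Rightarrow> 'v::ab_group_add \<Rightarrow> 'v"
  assumes mod: "module smul" and W: "module.subspace smul W"
    and B: "quot_basis smul V W B" "finite B" and B': "quot_basis smul V W B'"
  shows "finite B' \<and> card B' = card B"
proof -
  have le: "card F \<le> card S"
    if F: "quot_basis smul V W F0" "finite F" "F \<subseteq> F0" and S: "quot_basis smul V W S" "finite S" for F F0 S
  proof (rule card_independent_le_spanning[OF mod W \<open>finite F\<close> \<open>finite S\<close>])
    fix f assume "f \<in> F"
    then have "f \<in> V" using F by (auto simp: quot_basis_def)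
    then obtain G c where G: "finite G" "G \<subseteq> S" "f - (\<Sum>b\<in>G. smul (c b) b) \<in> W"
      using quot_basis_spans[OF S(1)] by blast
    have "(\<Sum>b\<in>S. smul (if b \<in> G then c b else 0) b) = (\<Sum>b\<in>G. smul (c b) b)"
      using G S module.scale_zero_left[OF mod]
      by (intro sum.mono_neutral_cong_right) auto
    then have "f - (\<Sum>b\<in>S. smul (if b \<in> G then c b else 0) b) \<in> W" using G by simp
    then show "\<exists>c. f - (\<Sum>b\<in>S. smul (c b) b) \<in> W"
      by (rule exI[of "\<lambda>c. f - (\<Sum>b\<in>S. smul (c b) b) \<in> W"])
  next
    fix c assume "(\<Sum>f\<in>F. smul (c f) f) \<in> W"
    then show "\<forall>f\<in>F. c f = 0" using quot_basis_independent[OF F(1-3)] by blast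
  qed
  have fin: "finite B'"
  proof (rule ccontr)
    assume "infinite B'"
    then obtain F where "F \<subseteq> B'" "finite F" "card F = Suc (card B)"
      using infinite_arbitrarily_large by blast
    then have "card F \<le> card B" by (intro le[OF B' _ _ B])
    then show False using \<open>card F = Suc (card B)\<close> by simp
  qed
  have "card B' \<le> card B" by (rule le[OF B' fin subset_refl B])
  moreover have "card B \<le> card B'" by (rule le[OF B(1,2) subset_refl B' fin])
  ultimately show ?thesis using fin by simp
qed

lemma quot_dim_eq_card:
  assumes "module smul" and "module.subspace smul W" and "quot_basis smul V W B" "finite B"
  shows "quot_dim smul V W = card B"
proof -
  have "quot_basis smul V W (SOME B. quot_basis smul V W B)"
    using assms(3) by (rule someI)
  then show ?thesis
    unfolding quot_dim_def by (rule quot_basis_card_unique[OF assms, THEN conjunct2])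
qed


section \<open>Exponents\<close>

definition tdeg :: "('v::finite \<Rightarrow>\<^sub>0 nat) \<Rightarrow> nat" where
  "tdeg u = (\<Sum>v\<in>UNIV. lookup u v)"

lemma tdeg_add: "tdeg (u + v) = tdeg u + tdeg v"
  by (simp add: tdeg_def lookup_add sum.distrib)

lemma tdeg_0 [simp]: "tdeg 0 = 0"
  by (simp add: tdeg_def)

lemma tdeg_single [simp]: "tdeg (single v k) = k"
  by (simp add: tdeg_def lookup_single when_def)

lemma lookup_le_tdeg: "lookup u v \<le> tdeg u"
  unfolding tdeg_def by (rule member_le_sum) auto

lemma finite_tdeg_le: "finite {u :: 'v::finite \<Rightarrow>\<^sub>0 nat. tdeg u \<le> t}"
proof (rule finite_imageD)
  show "inj_on lookup {u :: 'v \<Rightarrow>\<^sub>0 nat. tdeg u \<le> t}"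
    by (auto intro: inj_onI poly_mapping_eqI)
  have "lookup ` {u :: 'v \<Rightarrow>\<^sub>0 nat. tdeg u \<le> t} \<subseteq> (UNIV \<rightarrow>\<^sub>E {..t})"
    by (auto simp: PiE_def extensional_def intro: order_trans[OF lookup_le_tdeg])
  then show "finite (lookup ` {u :: 'v \<Rightarrow>\<^sub>0 nat. tdeg u \<le> t})"
    by (rule finite_subset) (simp add: finite_PiE)
qed

text \<open>Splitting off the exponent \<open>i\<close> of one variable leaves degree \<le>
  \<open>t - i\<close> for the others, and the binomials add up by the hockey-stick
  identity.\<close>

lemma card_bounded_exponents:
  fixes V :: "'v::finite set"
  assumes "finite V"
  shows "card {u. keys u \<subseteq> V \<and> tdeg u \<le> t} = (t + card V) choose t"
  using assms
proof (induction V arbitrary: t rule: finite_induct)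
  case empty
  have "{u :: 'v \<Rightarrow>\<^sub>0 nat. keys u \<subseteq> {} \<and> tdeg u \<le> t} = {0}"
    by (auto simp: in_keys_iff intro!: poly_mapping_eqI) 
  then show ?case by simp
next
  case (insert v V)
  define E where "E V t = {u. keys u \<subseteq> V \<and> tdeg u \<le> t}" for V :: "'v set" and t
  have "bij_betw (\<lambda>(i, u). single v i + u) (SIGMA i:{..t}. E V (t - i)) (E (insert v V) t)"
  proof (rule bij_betw_byWitness[where f' = "\<lambda>u. (lookup u v,
      u - single v (lookup u v))"])
    show "\<forall>a\<in>SIGMA i:{..t}. E V (t - i). (\<lambda>u. (lookup u v,
      u - single v (lookup u v))) ((\<lambda>(i, u). single v i + u) a) = a"
    proof -
      have "lookup y v = 0" if "keys y \<subseteq> V" for y :: "'v \<Rightarrow>\<^sub>0 nat"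
        using that insert.hyps by (auto simp: in_keys_iff)
      then show ?thesis by (auto simp: E_def lookup_add)
    qed
    have sub: "single v (lookup u v) + (u - single v (lookup u v)) = u" for u :: "'v \<Rightarrow>\<^sub>0 nat"
      by (rule poly_mapping_eqI) (auto simp: lookup_add lookup_minus lookup_single when_def)
    then show "\<forall>a'\<in>E (insert v V) t. (\<lambda>(i, u). single v i + u) (lookup a' v,
      a' - single v (lookup a' v)) = a'" by auto
    show "(\<lambda>(i, u). single v i + u) ` (SIGMA i:{..t}. E V (t - i)) \<subseteq> E (insert v V) t"
    proof -
      have "keys (single v i + y) \<subseteq> insert v V"
        if "keys y \<subseteq> V" for y i
        using that keys_add[of "single v i" y] by (auto split: if_splits)
      then show ?thesis by (auto simp: E_def tdeg_add)
    qed
    show "(\<lambda>u. (lookup u v, u - single v (lookup u v))) `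
      E (insert v V) t \<subseteq> (SIGMA i:{..t}. E V (t - i))"
    proof clarify
      fix u assume u: "u \<in> E (insert v V) t"
      let ?y = "u - single v (lookup u v)"
      have "keys ?y \<subseteq> V"
        using u unfolding E_def by (auto simp: in_keys_iff lookup_minus lookup_single when_def subset_iff split: if_splits)
      moreover have "tdeg u = lookup u v + tdeg ?y"
        using tdeg_add[of "single v (lookup u v)" ?y] by (simp add: sub)
      ultimately show "lookup u v \<in> {..t} \<and> ?y \<in> E V (t - lookup u v)"
        using u by (auto simp: E_def)
    qed
  qed
  then have "card (E (insert v V) t) = card (SIGMA i:{..t}. E V (t - i))"
    by (rule bij_betw_same_card[symmetric])
  also have "\<dots> = (\<Sum>i\<le>t. card (E V (t - i)))"
    by (rule card_SigmaI) (auto simp: E_def intro: finite_subset[OF _ finite_tdeg_le])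
  also have "\<dots> = (\<Sum>i\<le>t. card (E V i))"
    by (rule sum.nat_diff_reindex[of _ "Suc t", simplified lessThan_Suc_atMost, simplified])
  also have "\<dots> = (\<Sum>i\<le>t. (card V + i) choose i)"
    using insert.IH by (simp add: E_def add.commute)
  also have "\<dots> = Suc (card V + t) choose t" by (rule sum_choose_lower)
  finally show ?case using insert.hyps by (simp add: E_def add.commute)
qed

lemma card_tdeg_le: "card {u :: 'v::finite \<Rightarrow>\<^sub>0 nat. tdeg u \<le> t} = (t + CARD('v)) choose t"
  using card_bounded_exponents[of "UNIV :: 'v set" t] by simp

text \<open>Exponent vectors ordered by total degree, ties broken lexicographically: the total degree is
  stored as an additional leading entry, so that the order of the library applies.\<close>

definition graded_key :: "('v::finite \<Rightarrow>\<^sub>0 nat) \<Rightarrow> (nat \<Rightarrow>\<^sub>0 nat)" where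
  "graded_key u = single 0 (tdeg u)
     + (\<Sum>v\<in>UNIV. single (Suc (to_nat v)) (lookup u v))"

lemma graded_key_add: "graded_key (u + v) = graded_key u + graded_key v"
  by (simp add: graded_key_def tdeg_add lookup_add single_add sum.distrib ac_simps)

lemma lookup_graded_key:
  "lookup (graded_key u) 0 = tdeg u"
  "lookup (graded_key u) (Suc (to_nat v)) = lookup u v"
  by (simp_all add: graded_key_def lookup_add lookup_sum lookup_single when_def)

lemma inj_graded_key: "inj graded_key"
  by (metis injI lookup_graded_key(2) poly_mapping_eqI)

lemma graded_key_eq_iff [simp]: "graded_key u = graded_key v \<longleftrightarrow> u = v"
  using inj_graded_key by (auto dest: injD)

lemma tdeg_le_of_graded_key_le:
  fixes u v :: "'v::finite \<Rightarrow>\<^sub>0 nat"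
  assumes "graded_key u \<le> graded_key v"
  shows "tdeg u \<le> tdeg v"
proof (cases "u = v")
  case False
  then have "graded_key u < graded_key v" using assms by (simp add: order_less_le)
  then have "less_fun (lookup (graded_key u)) (lookup (graded_key v))"
    by (simp add: less_poly_mapping.rep_eq)
  then obtain k where "lookup (graded_key u) k < lookup (graded_key v) k"
      "\<forall>k'<k. lookup (graded_key u) k' = lookup (graded_key v) k'"
    unfolding less_fun_def by blast
  then have "lookup (graded_key u) 0 \<le> lookup (graded_key v) 0"
    by (cases "k = 0") auto
  then show ?thesis by (simp add: lookup_graded_key)
qed simp

text \<open>The degree comes first in the key, so the exponents below a given one have bounded
  degree and are finite in number.\<close>

lemma graded_key_induct [case_names less]:
  fixes u :: "'v::finite \<Rightarrow>\<^sub>0 nat"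
  assumes "\<And>u. (\<And>v :: 'v \<Rightarrow>\<^sub>0 nat. graded_key v < graded_key u \<Longrightarrow> P v) \<Longrightarrow> P u"
  shows "P u"
proof -
  have fin: "finite {v :: 'v \<Rightarrow>\<^sub>0 nat. graded_key v < graded_key u}" for u :: "'v \<Rightarrow>\<^sub>0 nat"
  proof (rule finite_subset[OF _ finite_tdeg_le])
    show "{v :: 'v \<Rightarrow>\<^sub>0 nat. graded_key v < graded_key u} \<subseteq> {v :: 'v \<Rightarrow>\<^sub>0 nat. tdeg v \<le> tdeg u}"
      by (auto intro: tdeg_le_of_graded_key_le[OF less_imp_le])
  qed
  show ?thesis
  proof (induction "card {v :: 'v \<Rightarrow>\<^sub>0 nat. graded_key v < graded_key u}" arbitrary: u rule: less_induct)
    case less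
    show ?case
    proof (rule assms)
      fix v :: "'v \<Rightarrow>\<^sub>0 nat" assume v: "graded_key v < graded_key u"
      then have "{x :: 'v \<Rightarrow>\<^sub>0 nat. graded_key x < graded_key v} \<subseteq> {x :: 'v \<Rightarrow>\<^sub>0 nat. graded_key x < graded_key u}"
        by (auto intro: order.strict_trans)
      moreover have "v \<in> {x :: 'v \<Rightarrow>\<^sub>0 nat. graded_key x < graded_key u}" "v \<notin> {x :: 'v \<Rightarrow>\<^sub>0 nat. graded_key x < graded_key v}"
        using v by auto
      ultimately have "{x :: 'v \<Rightarrow>\<^sub>0 nat. graded_key x < graded_key v} \<subset> {x :: 'v \<Rightarrow>\<^sub>0 nat. graded_key x < graded_key u}"
        by blast
      then show "P v" using psubset_card_mono[OF fin] by (intro less) 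
    qed
  qed
qed

section \<open>Counting exponents outside an up-set\<close>

lemma exponent_le_iff:
  fixes g u :: "'v \<Rightarrow>\<^sub>0 nat"
  shows "(\<forall>v. lookup g v \<le> lookup u v) \<longleftrightarrow> (\<exists>w. u = g + w)"
proof
  assume "\<forall>v. lookup g v \<le> lookup u v"
  then have "u = g + (u - g)"
    by (intro poly_mapping_eqI) (simp add: lookup_add lookup_minus)
  then show "\<exists>w. u = g + w" ..
qed (auto simp: lookup_add)

section \<open>Dickson's lemma\<close>

lemma mono_subsequence_nat:
  fixes f :: "nat \<Rightarrow> nat"
  shows "\<exists>\<phi> :: nat \<Rightarrow> nat. strict_mono \<phi> \<and> mono (\<lambda>i. f (\<phi> i))"
proof -
  obtain g :: "nat \<Rightarrow> nat" where g: "strict_mono g" "monoseq (\<lambda>n. f (g n))"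
    using seq_monosub[of f] by blast
  show ?thesis
  proof (cases "\<forall>m. \<forall>n\<ge>m. f (g m) \<le> f (g n)")
    case True
    then show ?thesis using g by (intro exI[of _ g]) (auto simp: mono_def)
  next
    case False
    then have dec: "f (g n) \<le> f (g m)" if "m \<le> n" for m n
      using g(2) that by (auto simp: monoseq_def)
    \<comment> \<open>From its minimum on, a decreasing sequence of natural numbers is constant,
      hence nondecreasing as well.\<close>
    define N where "N = (ARG_MIN (\<lambda>n. f (g n)) n. True)"
    have "f (g N) \<le> f (g n)" for n
      unfolding N_def by (rule arg_min_nat_le) simp
    then have "f (g (N + i)) = f (g N)" for i
      using dec[of N "N + i"] by (auto intro: antisym)
    moreover have "strict_mono (\<lambda>i. g (N + i))"
      using g(1) by (auto simp: strict_mono_def)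
    ultimately show ?thesis
      by (intro exI[of _ "\<lambda>i. g (N + i)"]) (auto simp: mono_def)
  qed
qed

lemma mono_subsequence_exponents:
  fixes u :: "nat \<Rightarrow> 'v \<Rightarrow>\<^sub>0 nat"
  assumes "finite V"
  shows "\<exists>\<phi> :: nat \<Rightarrow> nat. strict_mono \<phi> \<and> (\<forall>v\<in>V. mono (\<lambda>i. lookup (u (\<phi> i)) v))"
  using assms
proof (induction V rule: finite_induct)
  case empty
  show ?case by (intro exI[of _ "\<lambda>i. i"]) (auto simp: strict_mono_def)
next
  case (insert v V)
  then obtain \<phi> :: "nat \<Rightarrow> nat" where \<phi>: "strict_mono \<phi>" "\<forall>v\<in>V. mono (\<lambda>i. lookup (u (\<phi> i)) v)" by blast
  obtain \<psi> :: "nat \<Rightarrow> nat" where \<psi>: "strict_mono \<psi>" "mono (\<lambda>i. lookup (u (\<phi> (\<psi> i))) v)"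
    using mono_subsequence_nat[of "\<lambda>i. lookup (u (\<phi> i)) v"] by blast
  have "mono (\<lambda>i. lookup (u (\<phi> (\<psi> i))) x)" if "x \<in> V" for x
    using \<phi>(2) that \<psi>(1) strict_mono_mono[OF \<psi>(1)] by (simp add: mono_def)
  then show ?case using \<phi>(1) \<psi>
    by (intro exI[of _ "\<lambda>i. \<phi> (\<psi> i)"]) (auto simp: strict_mono_def)
qed

text \<open>\<open>G\<close> consists of the minimal elements. If it were infinite, a sequence in it
  would have a componentwise nondecreasing subsequence, whose first two members are distinct and
  comparable.\<close>

lemma dickson:
  fixes S :: "('v::finite \<Rightarrow>\<^sub>0 nat) set"
  shows "\<exists>G. finite G \<and> G \<subseteq> S \<and> (\<forall>u\<in>S. \<exists>g\<in>G. \<exists>w. u = g + w)"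
proof -
  define G where "G = {g \<in> S. \<forall>h\<in>S. \<forall>w. g = h + w \<longrightarrow> w = 0}"
  have "finite G"
  proof (rule ccontr)
    assume "infinite G"
    then obtain u :: "nat \<Rightarrow> 'v \<Rightarrow>\<^sub>0 nat" where u: "inj u" "range u \<subseteq> G"
      using infinite_countable_subset by blast
    obtain \<phi> :: "nat \<Rightarrow> nat" where \<phi>: "strict_mono \<phi>" "\<forall>v\<in>UNIV. mono (\<lambda>i. lookup (u (\<phi> i)) v)"
      using mono_subsequence_exponents[of UNIV u] by auto
    have "\<forall>v. lookup (u (\<phi> 0)) v \<le> lookup (u (\<phi> 1)) v"
      using \<phi>(2) by (auto simp: mono_def)
    then obtain w where w: "u (\<phi> 1) = u (\<phi> 0) + w" using exponent_le_iff by blast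
    moreover have "u (\<phi> 1) \<in> G" "u (\<phi> 0) \<in> G" using u by auto
    ultimately have "w = 0" by (auto simp: G_def)
    then have "\<phi> 1 = \<phi> 0" using w u(1) by (simp add: inj_eq)
    then show False using \<phi>(1) by (metis less_irrefl strict_mono_less zero_less_one)
  qed
  moreover have "\<exists>g\<in>G. \<exists>w. u = g + w" if "u \<in> S" for u
    using that
  proof (induction "tdeg u" arbitrary: u rule: less_induct)
    case less
    show ?case
    proof (cases "u \<in> G")
      case True
      then show ?thesis by (intro bexI[of _ u] exI[of _ 0]) auto
    next
      case False
      then obtain h w where h: "h \<in> S" "u = h + w" "w \<noteq> 0" using less.prems by (auto simp: G_def)
      from h(3) have "tdeg w \<noteq> 0"
        using lookup_le_tdeg[of w] by (metis le_zero_eq lookup_zero poly_mapping_eqI)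
      then have "tdeg h < tdeg u" using h by (simp add: tdeg_add)
      then obtain g w' where "g \<in> G" "h = g + w'" using less.hyps h(1) by blast
      then show ?thesis using h(2) by (intro bexI[of _ g] exI[of _ "w' + w"]) (auto simp: add.assoc)
    qed
  qed
  ultimately show ?thesis by (intro exI[of _ G]) (auto simp: G_def)
qed

section \<open>Hilbert polynomials of monomial ideals\<close>

definition binomial_poly :: "nat \<Rightarrow> 'a::field_char_0 poly" where
  "binomial_poly n = smult (1 / fact n) (\<Prod>i<n. [:of_nat (n - i), 1:])"

lemma poly_binomial_poly:
  "poly (binomial_poly n :: 'a::field_char_0 poly) (of_nat t) = of_nat ((t + n) choose n)"
proof -
  have "of_nat ((t + n) choose n) = (of_nat (t + n) :: 'a) gchoose n"
    by (rule binomial_gbinomial)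
  also have "\<dots> = (\<Prod>i<n. of_nat (t + n) - of_nat i) / fact n"
    by (simp add: gbinomial_prod_rev atLeast0LessThan)
  also have "(\<Prod>i<n. of_nat (t + n) - of_nat i) = (\<Prod>i<n. of_nat (n - i) + of_nat t :: 'a)"
    by (intro prod.cong) (auto simp: of_nat_diff)
  finally show ?thesis by (simp add: binomial_poly_def poly_prod)
qed

lemma degree_binomial_poly: "Polynomial.degree (binomial_poly n :: 'a::field_char_0 poly) = n"
proof -
  have "Polynomial.degree (\<Prod>i<n. [:of_nat (n - i), 1 :: 'a:]) = n"
    by (subst degree_prod_eq_sum_degree) auto
  then show ?thesis by (simp add: binomial_poly_def)
qed

lemma coeff_binomial_poly: "poly.coeff (binomial_poly n :: 'a::field_char_0 poly) n = 1 / fact n"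
proof -
  have "lead_coeff (\<Prod>i<n. [:of_nat (n - i), 1 :: 'a:]) = 1"
    by (subst lead_coeff_prod) simp
  moreover have "Polynomial.degree (\<Prod>i<n. [:of_nat (n - i), 1 :: 'a:]) = n"
    by (subst degree_prod_eq_sum_degree) auto
  ultimately show ?thesis by (simp add: binomial_poly_def)
qed

text \<open>Remove one generator \<open>a\<close>. The exponents outside the up-set of the remaining
  generators \<open>G1\<close> are those outside the up-set of \<open>G\<close>, together with the
  multiples of \<open>a\<close> outside that of \<open>G1\<close>. Dividing the latter by
  \<open>a\<close> gives the complement of another up-set with fewer generators than
  \<open>G\<close>, counted up to degree \<open>t - tdeg a\<close>.\<close>

lemma upset_count_polynomial:
  fixes G :: "('v::finite \<Rightarrow>\<^sub>0 nat) set"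
  assumes "finite G"
  shows "\<exists>h::rat poly. \<forall>\<^sub>F t in sequentially.
    poly h (of_nat t) = of_nat (card {u. \<not> (\<exists>g\<in>G. \<exists>w. u = g + w) \<and> tdeg u \<le> t})"
  using assms
proof (induction "card G" arbitrary: G rule: less_induct)
  case less
  define C where "C G t = card {u. \<not> (\<exists>g\<in>G. \<exists>w. u = g + w) \<and> tdeg u \<le> t}"
    for G :: "('v \<Rightarrow>\<^sub>0 nat) set" and t
  show ?case
  proof (cases "G = {}")
    case True
    have "(t + CARD('v)) choose t = (t + CARD('v)) choose CARD('v)" for t
      using binomial_symmetric[of t "t + CARD('v)"] by simp
    then show ?thesis
      unfolding True by (intro exI[of _ "binomial_poly CARD('v)"]) (simp add: card_tdeg_le poly_binomial_poly)
  next
    case False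
    then obtain a where a: "a \<in> G" by blast
    define G1 where "G1 = G - {a}"
    \<comment> \<open>Truncated differences generate the colon ideal: \<open>a + v\<close> is a
      multiple of \<open>g\<close> exactly if \<open>v\<close> is a multiple of
      \<open>g - a\<close>.\<close>
    define G2 where "G2 = (\<lambda>g. g - a) ` G1"
    have fin: "finite G1" "finite G2" using less.prems by (auto simp: G1_def G2_def)
    have c1: "card G1 < card G" using a less.prems by (simp add: G1_def card_gt_0_iff False)
    have "card G2 \<le> card G1" using fin by (simp add: G2_def card_image_le)
    then have c2: "card G2 < card G" using c1 by simp
    obtain h1 :: "rat poly" where h1: "\<forall>\<^sub>F t in sequentially. poly h1 (of_nat t) = of_nat (C G1 t)"
      using less.hyps[OF c1 fin(1)] unfolding C_def by blast
    obtain h2 :: "rat poly" where h2: "\<forall>\<^sub>F t in sequentially. poly h2 (of_nat t) = of_nat (C G2 t)"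
      using less.hyps[OF c2 fin(2)] unfolding C_def by blast
    have shift: "(\<exists>g\<in>G1. \<exists>w. a + v = g + w) \<longleftrightarrow> (\<exists>g\<in>G2. \<exists>w. v = g + w)" for v
      unfolding G2_def bex_simps exponent_le_iff[symmetric]
      by (simp add: lookup_add lookup_minus le_diff_conv add.commute)
    have C_eq: "C G1 t = C G t + C G2 (t - tdeg a)" if "tdeg a \<le> t" for t
    proof -
      let ?A = "{u. \<not> (\<exists>g\<in>G. \<exists>w. u = g + w) \<and> tdeg u \<le> t}"
      let ?B = "{u. \<not> (\<exists>g\<in>G2. \<exists>w. u = g + w) \<and> tdeg u \<le> t - tdeg a}"
      have "{u. \<not> (\<exists>g\<in>G1. \<exists>w. u = g + w) \<and> tdeg u \<le> t} = ?A \<union> (+) a ` ?B"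
      proof (intro set_eqI iffI)
        fix u assume u: "u \<in> {u. \<not> (\<exists>g\<in>G1. \<exists>w. u = g + w) \<and> tdeg u \<le> t}"
        show "u \<in> ?A \<union> (+) a ` ?B"
        proof (cases "\<exists>w. u = a + w")
          case True
          then obtain w where w: "u = a + w" by blast
          then have "w \<in> ?B" using u shift[of w] by (auto simp: tdeg_add)
          then show ?thesis using w by blast
        next
          case False
          then show ?thesis using u by (auto simp: G1_def)
        qed
      next
        fix u assume "u \<in> ?A \<union> (+) a ` ?B"
        then show "u \<in> {u. \<not> (\<exists>g\<in>G1. \<exists>w. u = g + w) \<and> tdeg u \<le> t}"
        proof
          assume "u \<in> ?A"
          then show ?thesis by (auto simp: G1_def)
        next
          assume "u \<in> (+) a ` ?B"
          then obtain w where "u = a + w" "w \<in> ?B" by blast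
          then show ?thesis using shift[of w] that by (auto simp: tdeg_add)
        qed
      qed
      moreover have "?A \<inter> (+) a ` ?B = {}" using a by auto
      moreover have "finite ?A" "finite ?B"
        by (auto intro: finite_subset[OF _ finite_tdeg_le])
      ultimately show ?thesis
        unfolding C_def by (simp add: card_Un_disjoint card_image)
    qed
    have "filterlim (\<lambda>t. t - tdeg a) sequentially sequentially"
      by (rule filterlim_minus_const_nat_at_top)
    then have h2': "\<forall>\<^sub>F t in sequentially. poly h2 (of_nat (t - tdeg a)) = of_nat (C G2 (t - tdeg a))"
      using h2 by (rule eventually_compose_filterlim[rotated])
    have "\<forall>\<^sub>F t in sequentially. poly (h1 - pcompose h2 [:- of_nat (tdeg a), 1:]) (of_nat t) = of_nat (C G t)"
      using h1 h2' eventually_ge_at_top[of "tdeg a"]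
    proof eventually_elim
      case (elim t)
      then show ?case using C_eq[of t] by (simp add: poly_pcompose of_nat_diff algebra_simps)
    qed
    then show ?thesis unfolding C_def by blast
  qed
qed


section \<open>Hilbert functions\<close>

lemma left_ideal_of_gen_UNIV: "left_ideal_of UNIV (left_ideal_gen UNIV G)"
  unfolding left_ideal_gen_def hull_def left_ideal_of_def by auto

lemma left_ideal_gen_superset: "G \<subseteq> left_ideal_gen D G"
  unfolding left_ideal_gen_def by (rule hull_subset)

lemma left_ideal_gen_minimal: "G \<subseteq> Y \<Longrightarrow> left_ideal_of D Y \<Longrightarrow> left_ideal_gen D G \<subseteq> Y"
  unfolding left_ideal_gen_def by (rule hull_minimal)

lemma left_ideal_of_UNIV_simps:
  assumes "left_ideal_of UNIV I"
  shows "0 \<in> I" "p \<in> I \<Longrightarrow> q \<in> I \<Longrightarrow> p + q \<in> I" "p \<in> I \<Longrightarrow> r * p \<in> I"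
    "(\<And>i. i \<in> F \<Longrightarrow> f i \<in> I) \<Longrightarrow> sum f F \<in> I"
proof -
  show 0: "0 \<in> I" and add: "\<And>p q. p \<in> I \<Longrightarrow> q \<in> I \<Longrightarrow> p + q \<in> I" and mult: "\<And>r p. p \<in> I \<Longrightarrow> r * p \<in> I"
    using assms by (auto simp: left_ideal_of_def)
  show "sum f F \<in> I" if "\<And>i. i \<in> F \<Longrightarrow> f i \<in> I"
    using that by (induction F rule: infinite_finite_induct) (auto intro: 0 add)
qed

lemmas left_ideal_zero = left_ideal_of_UNIV_simps(1)
  and left_ideal_add = left_ideal_of_UNIV_simps(2)
  and left_ideal_mult = left_ideal_of_UNIV_simps(3)
  and left_ideal_sum = left_ideal_of_UNIV_simps(4)

lemma poly_mapping_sum_singles: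
  "(p :: 'm \<Rightarrow>\<^sub>0 'c::comm_monoid_add)
    = (\<Sum>m\<in>keys p. single m (lookup p m))"
  by (rule poly_mapping_eqI) (auto simp: lookup_sum lookup_single when_def sum.delta' in_keys_iff)

lemma lookup_single_mult:
  fixes p :: "'m::cancel_comm_monoid_add \<Rightarrow>\<^sub>0 'c::comm_semiring_1"
  shows "lookup (single w c * p) (w + u) = c * lookup p u"
  by (induction p rule: poly_mapping_single_induct)
     (auto simp: mult_single lookup_single when_def distrib_left lookup_add)

lemma lookup_single_mult_0:
  fixes p :: "'m::cancel_comm_monoid_add \<Rightarrow>\<^sub>0 'c::comm_semiring_1"
  assumes "\<not> (\<exists>u. v = w + u)"
  shows "lookup (single w c * p) v = 0"
  using assms by (induction p rule: poly_mapping_single_induct)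
     (auto simp: mult_single lookup_single when_def distrib_left lookup_add)

lemma lookup_const_mult:
  fixes p :: "('v \<Rightarrow>\<^sub>0 nat) \<Rightarrow>\<^sub>0 'c::comm_semiring_1"
  shows "lookup (const_poly c * p) u = c * lookup p u"
  using lookup_single_mult[of 0 c p u] by simp

text \<open>Leading exponents for the graded order of \<open>graded_key\<close>, a device for
  computing Hilbert functions; the initial ideal with respect to the weight \<open>w\<close> is a
  different object.\<close>

definition leading_exps :: "'n::finite dpoly set \<Rightarrow> ('n \<Rightarrow>\<^sub>0 nat) set" where
  "leading_exps I = {u. \<exists>p\<in>I. u \<in> keys p \<and>
     (\<forall>v\<in>keys p. graded_key v \<le> graded_key u)}"

definition standard_exps :: "'n::finite dpoly set \<Rightarrow> nat \<Rightarrow> ('n \<Rightarrow>\<^sub>0 nat) set" where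
  "standard_exps I t = {u. u \<notin> leading_exps I \<and> tdeg u \<le> t}"

lemma finite_standard_exps: "finite (standard_exps I t)"
  unfolding standard_exps_def by (auto intro: finite_subset[OF _ finite_tdeg_le])

lemma leading_exps_add:
  assumes "left_ideal_of UNIV I" "u \<in> leading_exps I"
  shows "u + w \<in> leading_exps I"
proof -
  obtain p where p: "p \<in> I" "u \<in> keys p" "\<forall>v\<in>keys p. graded_key v \<le> graded_key u"
    using assms(2) by (auto simp: leading_exps_def)
  let ?q = "single w 1 * p"
  have "?q \<in> I" using left_ideal_mult[OF assms(1) p(1)] .
  moreover have "u + w \<in> keys ?q"
    using p(2) lookup_single_mult[of w 1 p u] by (simp add: in_keys_iff add.commute)
  moreover have "graded_key v \<le> graded_key (u + w)" if "v \<in> keys ?q" for v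
  proof -
    have "\<exists>v'. v = w + v'"
      using that lookup_single_mult_0[of v w 1 p] unfolding in_keys_iff by blast
    then obtain v' where v': "v = w + v'" ..
    then have "v' \<in> keys p" using that by (simp add: in_keys_iff lookup_single_mult)
    then show ?thesis using p(3) v' by (simp add: graded_key_add add.commute)
  qed
  ultimately show ?thesis unfolding leading_exps_def by blast
qed

text \<open>Division with remainder. As the order refines the total degree, no reduction step raises
  the degree; hence the remainder respects the truncation in the affine Hilbert function.\<close>

lemma reduce_to_standard:
  fixes u :: "'n::finite \<Rightarrow>\<^sub>0 nat"
  assumes I: "left_ideal_of UNIV I"
  shows "\<exists>r. keys r \<subseteq> standard_exps I (tdeg u) \<and> single u 1 - r \<in> I"
proof (induction u rule: graded_key_induct)
  case (less u)
  show ?case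
  proof (cases "u \<in> leading_exps I")
    case False
    then show ?thesis
      by (intro exI[of _ "single u 1"])
         (auto simp: standard_exps_def left_ideal_zero[OF I])
  next
    case True
    then obtain p where p: "p \<in> I" "u \<in> keys p"
        "\<And>v. v \<in> keys p \<Longrightarrow> graded_key v \<le> graded_key u"
      by (auto simp: leading_exps_def)
    define c where "c = lookup p u"
    have c: "c \<noteq> 0" using p(2) by (simp add: c_def in_keys_iff)
    define q where "q = single u 1 - const_poly (1 / c) * p"
    have q: "graded_key v < graded_key u" if "v \<in> keys q" for v
    proof -
      have "v \<noteq> u"
        using that c by (auto simp: q_def in_keys_iff lookup_minus lookup_const_mult c_def)
      then have "v \<in> keys p"
        using that by (auto simp: q_def in_keys_iff lookup_minus lookup_const_mult lookup_single)
      then show ?thesis using p(3) \<open>v \<noteq> u\<close> by (simp add: order_less_le)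
    qed
    have "\<forall>v\<in>keys q. \<exists>r. keys r \<subseteq> standard_exps I (tdeg v)
        \<and> single v 1 - r \<in> I"
      using less q by blast
    then obtain r where r: "\<And>v. v \<in> keys q \<Longrightarrow> keys (r v) \<subseteq> standard_exps I (tdeg v)"
        "\<And>v. v \<in> keys q \<Longrightarrow> single v 1 - r v \<in> I"
      by (auto dest!: bchoice)
    define s where "s = (\<Sum>v\<in>keys q. const_poly (lookup q v) * r v)"
    have "keys s \<subseteq> standard_exps I (tdeg u)"
    proof
      fix x assume "x \<in> keys s"
      then obtain v where v: "v \<in> keys q" "x \<in> keys (r v)"
        by (auto simp: s_def in_keys_iff lookup_sum lookup_const_mult elim: sum.not_neutral_contains_not_neutral)
      then show "x \<in> standard_exps I (tdeg u)"
        using r(1)[OF v(1)] tdeg_le_of_graded_key_le[OF less_imp_le[OF q[OF v(1)]]]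
        by (auto simp: standard_exps_def)
    qed
    moreover have "single u 1 - s \<in> I"
    proof -
      have "q - s = (\<Sum>v\<in>keys q. const_poly (lookup q v) * (single v 1 - r v))"
        by (subst poly_mapping_sum_singles[of q])
           (simp add: s_def right_diff_distrib sum_subtractf mult_single)
      then have "q - s \<in> I" 
        using r(2) by (auto intro!: left_ideal_sum[OF I] left_ideal_mult[OF I] simp del: mult_single)
      then have "const_poly (1 / c) * p + (q - s) \<in> I"
        using p(1) by (intro left_ideal_add[OF I] left_ideal_mult[OF I])
      then show ?thesis by (simp add: q_def)
    qed
    ultimately show ?thesis by blast
  qed
qed

lemma standard_independent:
  fixes p :: "'n::finite dpoly"
  assumes "p \<in> I" "keys p \<inter> leading_exps I = {}"
  shows "p = 0"
proof (rule ccontr)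
  assume "p \<noteq> 0"
  then have "graded_key ` keys p \<noteq> {}" "finite (graded_key ` keys p)"
    by (auto simp: in_keys_iff intro: poly_mapping_eqI)
  then obtain u where u: "u \<in> keys p" "graded_key u = Max (graded_key ` keys p)"
    using Max_in by (metis (no_types, lifting) imageE)
  then have "\<forall>v\<in>keys p. graded_key v \<le> graded_key u" by simp
  then show False using assms u(1) by (auto simp: leading_exps_def)
qed

lemma module_const_mult: "module (\<lambda>(c::'c::field) (p :: ('v \<Rightarrow>\<^sub>0 nat) \<Rightarrow>\<^sub>0 'c). const_poly c * p)"
  by standard (simp_all add: distrib_left distrib_right single_add mult_single flip: mult.assoc)

lemma affine_hilbert_function_eq:
  fixes I :: "'n::finite dpoly set"
  assumes I: "left_ideal_of UNIV I"
  shows "affine_hilbert_function I t = card (standard_exps I t)"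
proof -
  define mono where "mono u = (single u 1 :: 'n dpoly)" for u
  have inj: "inj_on mono X" for X
    by (rule inj_onI) (auto simp: mono_def dest!: arg_cong[of _ _ keys])
  have upto: "p \<in> dpoly_upto t \<longleftrightarrow> (\<forall>u\<in>keys p. tdeg u \<le> t)" for p :: "'n dpoly" and t
    by (simp add: dpoly_upto_def tdeg_def)
  have mulmono: "const_poly c * mono u = single u c" for c u
    by (simp add: mono_def mult_single)
  have "module.subspace (\<lambda>c p. const_poly c * p) (I \<inter> dpoly_upto t)"
    unfolding module.subspace_def[OF module_const_mult]
  proof (intro conjI ballI allI)
    show "0 \<in> I \<inter> dpoly_upto t" by (simp add: left_ideal_zero[OF I] upto)
    fix p q assume pq: "p \<in> I \<inter> dpoly_upto t" "q \<in> I \<inter> dpoly_upto t"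
    then have "p + q \<in> dpoly_upto t" using keys_add[of p q] by (auto simp: upto)
    then show "p + q \<in> I \<inter> dpoly_upto t" using pq left_ideal_add[OF I] by blast
  next
    fix c p assume p: "p \<in> I \<inter> dpoly_upto t"
    then have "const_poly c * p \<in> dpoly_upto t" by (auto simp: upto in_keys_iff lookup_const_mult)
    then show "const_poly c * p \<in> I \<inter> dpoly_upto t" using p left_ideal_mult[OF I] by blast
  qed
  moreover have "quot_basis (\<lambda>c p. const_poly c * p) (dpoly_upto t) (I \<inter> dpoly_upto t) (mono ` standard_exps I t)"
    unfolding quot_basis_def
  proof (intro conjI allI impI ballI)
    show "mono ` standard_exps I t \<subseteq> dpoly_upto t"
      by (auto simp: upto mono_def standard_exps_def)
  next
    fix F c b
    assume *: "finite F \<and> F \<subseteq> mono ` standard_exps I t \<and> (\<Sum>b\<in>F. const_poly (c b) * b) \<in> I \<inter> dpoly_upto t"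
      and b: "b \<in> F"
    then obtain F' where F': "F' \<subseteq> standard_exps I t" "F = mono ` F'" using subset_imageE by metis
    have finF': "finite F'" using F'(1) finite_standard_exps finite_subset by blast
    define p where "p = (\<Sum>u\<in>F'. single u (c (mono u)))"
    have "(\<Sum>b\<in>F. const_poly (c b) * b) = p"
      by (simp add: F'(2) sum.reindex[OF inj] mulmono p_def)
    then have "p \<in> I" using * by simp
    have look: "lookup p u = (if u \<in> F' then c (mono u) else 0)" for u
      using finF' by (simp add: p_def lookup_sum lookup_single when_def sum.delta')
    have "keys p \<inter> leading_exps I = {}"
      using F'(1) by (auto simp: in_keys_iff look standard_exps_def split: if_splits)
    then have "p = 0" using standard_independent \<open>p \<in> I\<close> by blast
    obtain u where "u \<in> F'" "b = mono u" using b F'(2) by blast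
    then show "c b = 0" using look[of u] \<open>p = 0\<close> by simp
  next
    fix v :: "'n dpoly" assume v: "v \<in> dpoly_upto t"
    have "\<forall>u. \<exists>r. keys r \<subseteq> standard_exps I (tdeg u) \<and> single u 1 - r \<in> I"
      using reduce_to_standard[OF I] by blast
    then obtain r where r: "\<And>u. keys (r u) \<subseteq> standard_exps I (tdeg u)"
        "\<And>u. single u 1 - r u \<in> I"
      by (auto dest!: choice)
    define s where "s = (\<Sum>u\<in>keys v. const_poly (lookup v u) * r u)"
    have keys_s: "keys s \<subseteq> standard_exps I t"
    proof
      fix x assume "x \<in> keys s"
      then obtain u where u: "u \<in> keys v" "x \<in> keys (r u)"
        by (auto simp: s_def in_keys_iff lookup_sum lookup_const_mult elim: sum.not_neutral_contains_not_neutral)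
      then show "x \<in> standard_exps I t"
        using r(1)[of u] v by (force simp: standard_exps_def upto)
    qed
    have "v - s = (\<Sum>u\<in>keys v. const_poly (lookup v u) * (single u 1 - r u))"
      by (subst poly_mapping_sum_singles[of v])
         (simp add: s_def right_diff_distrib sum_subtractf mult_single)
    then have "v - s \<in> I" 
        using r(2) by (auto intro!: left_ideal_sum[OF I] left_ideal_mult[OF I] simp del: mult_single)
    moreover have "v - s \<in> dpoly_upto t"
      using v keys_s unfolding upto by (auto simp: in_keys_iff lookup_minus standard_exps_def subset_iff)
    moreover have "(\<Sum>b\<in>mono ` keys s. const_poly (lookup s (the_inv mono b)) * b) = s"
      by (subst (3) poly_mapping_sum_singles[of s])
         (simp add: sum.reindex[OF inj] mulmono the_inv_f_f inj)
    ultimately show "\<exists>F c. finite F \<and> F \<subseteq> mono ` standard_exps I t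
        \<and> v - (\<Sum>b\<in>F. const_poly (c b) * b) \<in> I \<inter> dpoly_upto t"
      using keys_s
      by (intro exI[of _ "mono ` keys s"] exI[of _ "\<lambda>b. lookup s (the_inv mono b)"]) auto
  qed
  ultimately show ?thesis
    unfolding affine_hilbert_function_def
    by (subst quot_dim_eq_card[OF module_const_mult]) (auto simp: card_image[OF inj] finite_standard_exps)
qed

lemma poly_eq_of_eventually_eq:
  fixes p q :: "'a::field_char_0 poly"
  assumes "\<forall>\<^sub>F t in sequentially. poly p (of_nat t) = poly q (of_nat t)"
  shows "p = q"
proof (rule ccontr)
  assume "p \<noteq> q"
  then have "finite {x. poly (p - q) x = 0}" by (intro poly_roots_finite) simp
  moreover obtain N where "\<And>t. t \<ge> N \<Longrightarrow> poly p (of_nat t) = poly q (of_nat t)"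
    using assms by (auto simp: eventually_sequentially)
  then have "of_nat ` {N..} \<subseteq> {x. poly (p - q) x = 0}" by auto
  ultimately have "finite (of_nat ` {N..} :: 'a set)" by (rule finite_subset[rotated])
  then have "finite {N..}" by (rule finite_imageD) (simp add: inj_on_def)
  then show False by (simp add: infinite_Ici)
qed

text \<open>By Dickson's lemma the leading exponents form a finitely generated up-set, so the
  counting lemma gives existence. Uniqueness, which the definite description requires, holds because
  two polynomials agreeing at almost all natural numbers are equal.\<close>

lemma affine_hilbert_poly:
  fixes I :: "'n::finite dpoly set"
  assumes I: "left_ideal_of UNIV I"
  shows "\<forall>\<^sub>F t in sequentially.
    poly (affine_hilbert_poly I) (of_nat t) = of_nat (card (standard_exps I t))"
proof -
  obtain G where G: "finite G" "G \<subseteq> leading_exps I" "\<forall>u\<in>leading_exps I. \<exists>g\<in>G. \<exists>w. u = g + w"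
    using dickson[of "leading_exps I"] by (elim exE conjE)
  then have "u \<in> leading_exps I \<longleftrightarrow> (\<exists>g\<in>G. \<exists>w. u = g + w)" for u
    using leading_exps_add[OF I] by blast
  then have "standard_exps I t = {u. \<not> (\<exists>g\<in>G. \<exists>w. u = g + w) \<and> tdeg u \<le> t}" for t
    unfolding standard_exps_def by blast
  then have "\<exists>h::rat poly. \<forall>\<^sub>F t in sequentially. poly h (of_nat t) = of_nat (card (standard_exps I t))"
    using upset_count_polynomial[OF G(1)] by presburger
  then obtain h :: "rat poly" where h: "\<forall>\<^sub>F t in sequentially.
      poly h (of_nat t) = of_nat (card (standard_exps I t))" ..
  have "\<forall>\<^sub>F t in sequentially. poly (affine_hilbert_poly I) (of_nat t) = of_nat (affine_hilbert_function I t)"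
    unfolding affine_hilbert_poly_def
  proof (rule theI)
    show "\<forall>\<^sub>F t in sequentially. poly h (of_nat t) = of_nat (affine_hilbert_function I t)"
      using h by (simp add: affine_hilbert_function_eq[OF I])
    fix h' :: "rat poly" assume "\<forall>\<^sub>F t in sequentially. poly h' (of_nat t) = of_nat (affine_hilbert_function I t)"
    with h have "\<forall>\<^sub>F t in sequentially. poly h' (of_nat t) = poly h (of_nat t)"
      by eventually_elim (simp add: affine_hilbert_function_eq[OF I])
    then show "h' = h" by (rule poly_eq_of_eventually_eq)
  qed
  then show ?thesis by (simp add: affine_hilbert_function_eq[OF I])
qed

section \<open>The commutative model of the ring of differential operators\<close>

definition xexp :: "('n::finite \<Rightarrow>\<^sub>0 nat) \<Rightarrow> (('d, 'n) indet \<Rightarrow>\<^sub>0 nat)" where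
  "xexp u = (\<Sum>j\<in>UNIV. single (X_var j) (lookup u j))"

definition sexp :: "('d::finite \<Rightarrow>\<^sub>0 nat) \<Rightarrow> (('d, 'n) indet \<Rightarrow>\<^sub>0 nat)" where
  "sexp a = (\<Sum>i\<in>UNIV. single (S_var i) (lookup a i))"

definition s_part :: "(('d::finite, 'n) indet \<Rightarrow>\<^sub>0 nat) \<Rightarrow> ('d \<Rightarrow>\<^sub>0 nat)" where
  "s_part m = (\<Sum>i\<in>UNIV. single i (lookup m (S_var i)))"

definition x_part :: "(('d, 'n::finite) indet \<Rightarrow>\<^sub>0 nat) \<Rightarrow> ('n \<Rightarrow>\<^sub>0 nat)" where
  "x_part m = (\<Sum>j\<in>UNIV. single j (lookup m (X_var j)))"

lemma lookup_xexp [simp]: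
  "lookup (xexp u) (X_var j) = lookup u j"
  "lookup (xexp u) (S_var i) = 0"
  by (simp_all add: xexp_def lookup_sum lookup_single when_def)

lemma lookup_sexp [simp]:
  "lookup (sexp a) (S_var i) = lookup a i"
  "lookup (sexp a) (X_var j) = 0"
  by (simp_all add: sexp_def lookup_sum lookup_single when_def)

lemma lookup_s_part [simp]: "lookup (s_part m) i = lookup m (S_var i)"
  by (simp add: s_part_def lookup_sum lookup_single when_def)

lemma lookup_x_part [simp]: "lookup (x_part m) j = lookup m (X_var j)"
  by (simp add: x_part_def lookup_sum lookup_single when_def)

lemma indet_exp_eqI:
  assumes "\<And>i. lookup m (S_var i) = lookup m' (S_var i)"
    and "\<And>j. lookup m (X_var j) = lookup m' (X_var j)"
  shows "m = m'"
  using assms by (intro poly_mapping_eqI) (metis indet.exhaust)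

lemma xexp_add: "xexp (u + v) = xexp u + xexp v"
  by (rule indet_exp_eqI) (simp_all add: lookup_add)

lemma xexp_0 [simp]: "xexp 0 = 0"
  by (rule indet_exp_eqI) simp_all

lemma xexp_single: "xexp (single j k) = single (X_var j) k"
  by (rule indet_exp_eqI) (simp_all add: lookup_single when_def)

lemma sexp_add: "sexp (a + b) = sexp a + sexp b"
  by (rule indet_exp_eqI) (simp_all add: lookup_add)

lemma sexp_0 [simp]: "sexp 0 = 0"
  by (rule indet_exp_eqI) simp_all

lemma sexp_single: "sexp (single i k) = single (S_var i) k"
  by (rule indet_exp_eqI) (simp_all add: lookup_single when_def)

lemma indet_exp_split: "m = sexp (s_part m) + xexp (x_part m)"
  by (rule indet_exp_eqI) (simp_all add: lookup_add)

lemma s_part_add: "s_part (m + m') = s_part m + s_part m'"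
  by (rule poly_mapping_eqI) (simp add: lookup_add)

lemma s_part_sexp [simp]: "s_part (sexp a) = a"
  by (rule poly_mapping_eqI) simp

lemma s_part_xexp [simp]: "s_part (xexp u) = 0"
  by (rule poly_mapping_eqI) simp


text \<open>The coefficients are left arbitrary because the notion is applied both to
  \<open>C[s,x]\<close>, where it singles out \<open>C[x]\<close>, and to symbols, where it singles
  out \<open>C[x][\<partial>]\<close>.\<close>

definition sfree :: "((('d::finite, 'n) indet \<Rightarrow>\<^sub>0 nat) \<Rightarrow>\<^sub>0 'c::zero) \<Rightarrow> bool" where
  "sfree P \<longleftrightarrow> (\<forall>m\<in>keys P. s_part m = 0)"

lemma sfree_0 [simp]: "sfree 0"
  by (simp add: sfree_def)

lemma sfree_add: "sfree P \<Longrightarrow> sfree Q \<Longrightarrow> sfree (P + Q)"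
  unfolding sfree_def using keys_add by fast

lemma sfree_diff: "sfree P \<Longrightarrow> sfree Q \<Longrightarrow> sfree (P - Q)"
  for P Q :: "_ \<Rightarrow>\<^sub>0 'c::ab_group_add"
  unfolding sfree_def by (auto simp: in_keys_iff lookup_minus)

lemma sfree_mult: "sfree P \<Longrightarrow> sfree Q \<Longrightarrow> sfree (P * Q)"
  unfolding sfree_def using keys_mult[of P Q] by (fastforce simp: s_part_add)

lemma sfree_sum: "(\<And>i. i \<in> F \<Longrightarrow> sfree (f i)) \<Longrightarrow> sfree (sum f F)"
  by (induction F rule: infinite_finite_induct) (auto intro: sfree_add)

lemma sfree_single: "s_part m = 0 \<Longrightarrow> sfree (single m c)"
  by (simp add: sfree_def)

lemma sfree_1 [simp]: "sfree 1"
  by (simp add: sfree_def s_part_def)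

definition s_coeff :: "('d::finite \<Rightarrow>\<^sub>0 nat) \<Rightarrow> ('d, 'n::finite) sxpoly \<Rightarrow> ('d, 'n) sxpoly" where
  "s_coeff a c = (\<Sum>m\<in>{m\<in>keys c. s_part m = a}.
     single (xexp (x_part m)) (lookup c m))"

lemma sfree_s_coeff: "sfree (s_coeff a c)"
  unfolding s_coeff_def by (intro sfree_sum sfree_single) simp

lemma s_coeff_expansion:
  "c = (\<Sum>a\<in>s_part ` keys c. single (sexp a) 1 * s_coeff a c)"
proof -
  have "(\<Sum>a\<in>s_part ` keys c. single (sexp a) 1 * s_coeff a c)
      = (\<Sum>a\<in>s_part ` keys c. \<Sum>m\<in>{m\<in>keys c. s_part m = a}.
          single m (lookup c m))"
    unfolding s_coeff_def sum_distrib_left mult_single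
    by (intro sum.cong refl) (auto simp flip: indet_exp_split)
  also have "\<dots> = (\<Sum>m\<in>keys c. single m (lookup c m))"
    by (rule sum.image_gen[symmetric]) simp
  also have "\<dots> = c" by (rule poly_mapping_sum_singles[symmetric])
  finally show ?thesis by simp
qed

text \<open>If \<open>sexp a + m\<close> with \<open>m\<close> free of \<open>s\<close> equals
  \<open>sexp b + k\<close> for some \<open>b \<noteq> a\<close>, then \<open>k\<close> involves
  \<open>s\<close>, so the summand for \<open>b\<close> contributes nothing at this
  exponent.\<close>

lemma s_expansion_unique:
  fixes c :: "('d::finite \<Rightarrow>\<^sub>0 nat) \<Rightarrow> ('d, 'n::finite) sxpoly"
  assumes "finite F" and "\<And>a. a \<in> F \<Longrightarrow> sfree (c a)"
    and "(\<Sum>a\<in>F. single (sexp a) 1 * c a) = 0" and "a \<in> F"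
  shows "c a = 0"
proof (rule poly_mapping_eqI)
  fix m
  show "lookup (c a) m = lookup 0 m"
  proof (cases "s_part m = 0")
    case False
    then have "m \<notin> keys (c a)" using assms(2)[OF assms(4)] by (auto simp: sfree_def)
    then show ?thesis by (simp add: in_keys_iff)
  next
    case True
    have "lookup (single (sexp b) 1 * c b) (sexp a + m) = 0"
      if b: "b \<in> F" "b \<noteq> a" for b
    proof (cases "\<exists>k. sexp a + m = sexp b + k")
      case T: True
      then obtain k where k: "sexp a + m = sexp b + k" ..
      have "a = b + s_part k" using arg_cong[OF k, of s_part] True by (simp add: s_part_add)
      then have "s_part k \<noteq> 0" using b by auto
      then have "k \<notin> keys (c b)" using assms(2)[OF b(1)] by (auto simp: sfree_def)
      then have "lookup (c b) k = 0" by (simp add: in_keys_iff)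
      then show ?thesis unfolding k by (simp add: lookup_single_mult)
    next
      case False
      then show ?thesis by (rule lookup_single_mult_0)
    qed
    then have "(\<Sum>b\<in>F. lookup (single (sexp b) 1 * c b) (sexp a + m))
        = lookup (single (sexp a) 1 * c a) (sexp a + m)"
      using assms(1,4) by (subst sum.remove[of F a]) auto
    then have "lookup (c a) m = 0"
      using arg_cong[OF assms(3), of "\<lambda>p. lookup p (sexp a + m)"]
      by (simp add: lookup_sum lookup_single_mult)
    then show ?thesis by simp
  qed
qed

text \<open>Elements of \<open>C[s,x][\<partial>]\<close>, written with the coefficients in \<open>C[\<partial>]\<close> of the monomials in
  \<open>s\<close> and \<open>x\<close>. The product is the commutative one; normally ordered differential operators are
  represented by their symbols.\<close>

type_synonym ('d, 'n) symbol = "(('d, 'n) indet \<Rightarrow>\<^sub>0 nat) \<Rightarrow>\<^sub>0 'n dpoly"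

definition coef_symbol :: "('d, 'n) sxpoly \<Rightarrow> ('d, 'n) symbol" where
  "coef_symbol c = Poly_Mapping.map const_poly c"

lemma lookup_map: "f 0 = 0 \<Longrightarrow> lookup (Poly_Mapping.map f p) m = f (lookup p m)"
  by (simp add: Poly_Mapping.map.rep_eq when_def)

lemma map_single: "f 0 = 0 \<Longrightarrow> Poly_Mapping.map f (single m c) = single m (f c)"
  by (rule poly_mapping_eqI) (simp add: lookup_map lookup_single when_def)

lemma map_add:
  assumes "f 0 = 0" "\<And>a b. f (a + b) = f a + f b"
  shows "Poly_Mapping.map f (p + q) = Poly_Mapping.map f p + Poly_Mapping.map f q"
  using assms by (intro poly_mapping_eqI) (simp add: lookup_map lookup_add)

lemma map_0 [simp]: "f 0 = 0 \<Longrightarrow> Poly_Mapping.map f 0 = 0"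
  by (intro poly_mapping_eqI) (simp add: lookup_map)

lemma coef_symbol_add: "coef_symbol (c + c') = coef_symbol c + coef_symbol c'"
  by (simp add: coef_symbol_def map_add single_add)

lemma coef_symbol_single: "coef_symbol (single m c) = single m (const_poly c)"
  by (simp add: coef_symbol_def map_single)

lemma coef_symbol_0 [simp]: "coef_symbol 0 = 0"
  by (simp add: coef_symbol_def)

lemma coef_symbol_1 [simp]: "coef_symbol 1 = 1"
  using coef_symbol_single[of 0 1] by simp

lemma coef_symbol_mult: "coef_symbol (c * c') = coef_symbol c * coef_symbol c'"
proof (induction c rule: poly_mapping_single_induct)
  case (single m a)
  show ?case
    by (induction c' rule: poly_mapping_single_induct)
       (simp_all add: coef_symbol_add distrib_left mult_single coef_symbol_single)
qed (simp_all add: coef_symbol_add distrib_right)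

lemma coef_symbol_sum: "coef_symbol (sum f F) = (\<Sum>i\<in>F. coef_symbol (f i))"
  by (induction F rule: infinite_finite_induct) (simp_all add: coef_symbol_add)

lemma coef_symbol_uminus: "coef_symbol (- c) = - coef_symbol c"
  using coef_symbol_add[of c "- c"] by (simp add: eq_neg_iff_add_eq_0 add.commute)

lemma sfree_coef_symbol: "sfree c \<Longrightarrow> sfree (coef_symbol c)"
  by (auto simp: sfree_def coef_symbol_def in_keys_iff lookup_map)

lemma symbol_induct [case_names zero single add]:
  fixes P :: "('d, 'n) symbol"
  assumes "Q 0" "\<And>m u c. Q (single m (single u c))"
    "\<And>P P'. Q P \<Longrightarrow> Q P' \<Longrightarrow> Q (P + P')"
  shows "Q P"
proof (induction P rule: poly_mapping_single_induct)
  case (single m p)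
  show ?case
    by (induction p rule: poly_mapping_single_induct) (simp_all add: assms single_add)
qed (simp_all add: assms)

section \<open>The grading by the columns of the matrix and its derivations\<close>

definition exp_action :: "int ^ 'n::finite ^ 'd::finite \<Rightarrow> 'd \<Rightarrow> ('n \<Rightarrow>\<^sub>0 nat) \<Rightarrow> int" where
  "exp_action A i u = (A *v int_exponent u) $ i"

lemma exp_action_eq: "exp_action A i u = (\<Sum>j\<in>UNIV. A $ i $ j * int (lookup u j))"
  by (simp add: exp_action_def matrix_vector_mult_def int_exponent_def)

lemma exp_action_add: "exp_action A i (u + v) = exp_action A i u + exp_action A i v"
  by (simp add: exp_action_eq lookup_add distrib_left sum.distrib)

lemma exp_action_0 [simp]: "exp_action A i 0 = 0"
  by (simp add: exp_action_eq)

lemma exp_action_single [simp]: "exp_action A i (single j k) = A $ i $ j * int k"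
proof -
  have "exp_action A i (single j k) = (\<Sum>l\<in>UNIV. if l = j then A $ i $ j * int k else 0)"
    unfolding exp_action_eq by (intro sum.cong) (auto simp: lookup_single)
  then show ?thesis by simp
qed

text \<open>The derivation with the graded components as eigenspaces. It is the commutator with the
  Euler operator: \<open>\<partial>\<^sup>u E\<^sub>i - E\<^sub>i \<partial>\<^sup>u = (Au)\<^sub>i
  \<partial>\<^sup>u\<close>.\<close>

definition grading_deriv :: "int ^ 'n::finite ^ 'd::finite \<Rightarrow> 'd \<Rightarrow> 'n dpoly \<Rightarrow> 'n dpoly" where
  "grading_deriv A i p = (\<Sum>u\<in>keys p.
     single u (of_int (exp_action A i u) * lookup p u))"

lemma lookup_grading_deriv:
  "lookup (grading_deriv A i p) u = of_int (exp_action A i u) * lookup p u"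
  by (simp add: grading_deriv_def lookup_sum lookup_single when_def sum.delta' in_keys_iff)

lemma grading_deriv_add: "grading_deriv A i (p + q) = grading_deriv A i p + grading_deriv A i q"
  by (rule poly_mapping_eqI) (simp add: lookup_grading_deriv lookup_add distrib_left)

lemma grading_deriv_0 [simp]: "grading_deriv A i 0 = 0"
  by (simp add: grading_deriv_def)

lemma grading_deriv_single: "grading_deriv A i (single u c) = single u (of_int (exp_action A i u) * c)"
  by (simp add: grading_deriv_def)

lemma grading_deriv_mult:
  "grading_deriv A i (p * q) = grading_deriv A i p * q + p * grading_deriv A i q"
proof (induction p rule: poly_mapping_single_induct)
  case (single m a)
  show ?case
    by (induction q rule: poly_mapping_single_induct)
       (simp_all add: grading_deriv_add distrib_left mult_single grading_deriv_single
         exp_action_add algebra_simps flip: single_add)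
qed (simp_all add: grading_deriv_add distrib_right)

definition grading_deriv_symbol :: "int ^ 'n::finite ^ 'd::finite \<Rightarrow> 'd \<Rightarrow> ('d, 'n) symbol \<Rightarrow> ('d, 'n) symbol" where
  "grading_deriv_symbol A i P = Poly_Mapping.map (grading_deriv A i) P"

lemma grading_deriv_symbol_add:
  "grading_deriv_symbol A i (P + Q) = grading_deriv_symbol A i P + grading_deriv_symbol A i Q"
  by (simp add: grading_deriv_symbol_def map_add grading_deriv_add)

lemma grading_deriv_symbol_0 [simp]: "grading_deriv_symbol A i 0 = 0"
  by (simp add: grading_deriv_symbol_def)

lemma grading_deriv_symbol_single:
  "grading_deriv_symbol A i (single m p) = single m (grading_deriv A i p)"
  by (simp add: grading_deriv_symbol_def map_single)

lemma lookup_grading_deriv_symbol: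
  "lookup (grading_deriv_symbol A i P) m = grading_deriv A i (lookup P m)"
  by (simp add: grading_deriv_symbol_def lookup_map)

lemma grading_deriv_symbol_mult:
  "grading_deriv_symbol A i (P * Q) = grading_deriv_symbol A i P * Q + P * grading_deriv_symbol A i Q"
proof (induction P rule: poly_mapping_single_induct)
  case (single m a)
  show ?case
    by (induction Q rule: poly_mapping_single_induct)
       (simp_all add: grading_deriv_symbol_add distrib_left mult_single grading_deriv_symbol_single
         grading_deriv_mult single_add)
qed (simp_all add: grading_deriv_symbol_add distrib_right)

lemma grading_deriv_symbol_coef [simp]: "grading_deriv_symbol A i (coef_symbol c) = 0"
  by (induction c rule: poly_mapping_single_induct)
     (simp_all add: coef_symbol_add grading_deriv_symbol_add coef_symbol_single
       grading_deriv_symbol_single grading_deriv_single)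

definition x_symbol :: "'n::finite \<Rightarrow> ('d, 'n) symbol" where
  "x_symbol j = coef_symbol (var_poly (X_var j))"

definition s_symbol :: "'d::finite \<Rightarrow> ('d, 'n::finite) symbol" where
  "s_symbol i = coef_symbol (var_poly (S_var i))"

definition d_symbol :: "('n::finite \<Rightarrow>\<^sub>0 nat) \<Rightarrow> ('d, 'n) symbol" where
  "d_symbol u = single 0 (single u 1)"

definition dpoly_symbol :: "'n::finite dpoly \<Rightarrow> ('d, 'n) symbol" where
  "dpoly_symbol p = single 0 p"

lemma d_symbol_0 [simp]: "d_symbol 0 = 1"
  by (simp add: d_symbol_def)

definition euler_symbol :: "int ^ 'n::finite ^ 'd::finite \<Rightarrow> 'd \<Rightarrow> ('d, 'n) symbol" where
  "euler_symbol A i = (\<Sum>j\<in>UNIV. of_int (A $ i $ j) * x_symbol j * d_symbol (single j 1))"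

lemma of_int_symbol_mult:
  "of_int k * single m (single u c)
    = (single m (single u (of_int k * c)) :: ('d, 'n) symbol)"
proof -
  have "(of_int k :: ('d, 'n) symbol) = single 0 (const_poly (of_int k))"
    by (simp only: single_of_int)
  then show ?thesis by (simp only: mult_single) simp
qed

lemma grading_deriv_symbol_d:
  "grading_deriv_symbol A i (d_symbol u) = of_int (exp_action A i u) * d_symbol u"
  by (simp only: d_symbol_def grading_deriv_symbol_single grading_deriv_single of_int_symbol_mult)

text \<open>On symbols, right multiplication by the Euler operator \<open>E\<^sub>i\<close>.\<close>

definition euler_shift :: "int ^ 'n::finite ^ 'd::finite \<Rightarrow> 'd \<Rightarrow> ('d, 'n) symbol \<Rightarrow> ('d, 'n) symbol" where
  "euler_shift A i P = euler_symbol A i * P + grading_deriv_symbol A i P"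

lemma euler_shift_add: "euler_shift A i (P + Q) = euler_shift A i P + euler_shift A i Q"
  by (simp add: euler_shift_def distrib_left grading_deriv_symbol_add)

lemma euler_shift_0 [simp]: "euler_shift A i 0 = 0"
  by (simp add: euler_shift_def)

lemma euler_shift_sum: "euler_shift A i (sum f F) = (\<Sum>x\<in>F. euler_shift A i (f x))"
  by (induction F rule: infinite_finite_induct) (simp_all add: euler_shift_add)

lemma euler_shift_coef: "euler_shift A i (coef_symbol c * P) = coef_symbol c * euler_shift A i P"
  by (simp add: euler_shift_def grading_deriv_symbol_mult algebra_simps)

text \<open>On symbols, left multiplication by \<open>\<partial>\<^sub>j\<close>.\<close>

definition partial_shift :: "'n::finite \<Rightarrow> ('d::finite, 'n) symbol \<Rightarrow> ('d, 'n) symbol" where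
  "partial_shift j P = d_symbol (single j 1) * P + poly_deriv (X_var j) P"

lemma partial_shift_add: "partial_shift j (P + Q) = partial_shift j P + partial_shift j Q"
  by (simp add: partial_shift_def distrib_left poly_deriv_add)

lemma poly_deriv_grading_deriv_commute:
  "poly_deriv v (grading_deriv_symbol A i P) = grading_deriv_symbol A i (poly_deriv v P)"
proof (induction P rule: symbol_induct)
  case (single m u c)
  have "(of_nat k :: 'b dpoly) * single u c = single u (of_nat k * c)" for k c
    using mult_single[of 0 "of_nat k" u c] by simp
  then show ?case
    by (simp add: poly_deriv_single grading_deriv_symbol_single grading_deriv_single mult.left_commute)
qed (simp_all add: poly_deriv_add grading_deriv_symbol_add)

lemma poly_deriv_d_symbol [simp]: "poly_deriv v (d_symbol u) = 0"
  by (simp add: d_symbol_def poly_deriv_single)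

lemma poly_deriv_of_int [simp]: "poly_deriv v (of_int k :: ('v \<Rightarrow>\<^sub>0 nat) \<Rightarrow>\<^sub>0 'c::comm_ring_1) = 0"
  using poly_deriv_single[of v 0 "of_int k :: 'c"] by simp

lemma poly_deriv_sum: "poly_deriv v (sum f F) = (\<Sum>i\<in>F. poly_deriv v (f i))"
  by (induction F rule: infinite_finite_induct) (simp_all add: poly_deriv_add)

lemma poly_deriv_coef_symbol: "poly_deriv v (coef_symbol c) = coef_symbol (poly_deriv v c)"
proof (induction c rule: poly_mapping_single_induct)
  case (single m c)
  have "(of_nat k :: 'b dpoly) * const_poly c = const_poly (of_nat k * c)" for k
    using mult_single[of 0 "of_nat k :: complex" "0 :: 'b \<Rightarrow>\<^sub>0 nat" c] by simp
  then show ?case by (simp add: poly_deriv_single coef_symbol_single)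
qed (simp_all add: poly_deriv_add coef_symbol_add)

lemma poly_deriv_var_poly: "poly_deriv u (var_poly v :: ('v \<Rightarrow>\<^sub>0 nat) \<Rightarrow>\<^sub>0 'c::comm_ring_1) = (if u = v then 1 else 0)"
  by (simp add: var_poly_def poly_deriv_single lookup_single when_def)

lemma poly_deriv_euler_symbol:
  "poly_deriv (X_var j) (euler_symbol A i) = of_int (A $ i $ j) * d_symbol (single j 1)"
  by (simp add: euler_symbol_def poly_deriv_sum poly_deriv_mult x_symbol_def poly_deriv_coef_symbol
    poly_deriv_var_poly if_distrib if_distribR cong: if_cong)

text \<open>Associativity in terms of symbols: multiplication by \<open>\<partial>\<^sub>j\<close>
  on the left commutes with multiplication by \<open>E\<^sub>i\<close> on the right. Hence
  \<open>euler_relations\<close> is stable under left multiplication by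
  \<open>\<partial>\<^sub>j\<close>.\<close>

lemma partial_shift_euler_shift: "partial_shift j (euler_shift A i P) = euler_shift A i (partial_shift j P)"
  by (simp add: partial_shift_def euler_shift_def poly_deriv_add poly_deriv_mult poly_deriv_euler_symbol
    grading_deriv_symbol_add grading_deriv_symbol_mult grading_deriv_symbol_d
    poly_deriv_grading_deriv_commute algebra_simps)

lemma partial_shift_coef:
  "partial_shift j (coef_symbol c * P) = coef_symbol c * partial_shift j P + coef_symbol (poly_deriv (X_var j) c) * P"
  by (simp add: partial_shift_def poly_deriv_mult poly_deriv_coef_symbol algebra_simps)

text \<open>Symbols of the sums of the \<open>Q\<^sub>i (E\<^sub>i - s\<^sub>i)\<close> with
  polynomial coefficients; \<open>s\<^sub>i\<close> is central, so multiplying by it on the right is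
  the commutative product of symbols.\<close>

definition euler_relations :: "int ^ 'n::finite ^ 'd::finite \<Rightarrow> ('d, 'n) symbol set" where
  "euler_relations A = range (\<lambda>Q. \<Sum>i\<in>UNIV. euler_shift A i (Q i) - s_symbol i * Q i)"

lemma euler_relations_0: "0 \<in> euler_relations A"
  unfolding euler_relations_def by (rule image_eqI[of _ _ "\<lambda>_. 0"]) auto

lemma euler_relations_add:
  assumes "P \<in> euler_relations A" "P' \<in> euler_relations A"
  shows "P + P' \<in> euler_relations A"
proof -
  obtain Q Q' where "P = (\<Sum>i\<in>UNIV. euler_shift A i (Q i) - s_symbol i * Q i)"
      "P' = (\<Sum>i\<in>UNIV. euler_shift A i (Q' i) - s_symbol i * Q' i)"
    using assms by (auto simp: euler_relations_def)
  then show ?thesis unfolding euler_relations_def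
    by (intro image_eqI[of _ _ "\<lambda>i. Q i + Q' i"])
       (simp_all add: euler_shift_add algebra_simps flip: sum.distrib)
qed

lemma euler_relations_coef:
  assumes "P \<in> euler_relations A"
  shows "coef_symbol c * P \<in> euler_relations A"
proof -
  obtain Q where "P = (\<Sum>i\<in>UNIV. euler_shift A i (Q i) - s_symbol i * Q i)"
    using assms by (auto simp: euler_relations_def)
  then show ?thesis unfolding euler_relations_def
    by (intro image_eqI[of _ _ "\<lambda>i. coef_symbol c * Q i"])
       (simp_all add: euler_shift_coef sum_distrib_left right_diff_distrib mult.left_commute)
qed

lemma partial_shift_sum: "partial_shift j (sum f F) = (\<Sum>i\<in>F. partial_shift j (f i))"
  by (induction F rule: infinite_finite_induct)
     (simp_all add: partial_shift_add, simp_all add: partial_shift_def)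

lemma partial_shift_diff: "partial_shift j (P - Q) = partial_shift j P - partial_shift j Q"
  by (simp add: partial_shift_def poly_deriv_diff algebra_simps)

lemma euler_relations_partial:
  assumes "P \<in> euler_relations A"
  shows "partial_shift j P \<in> euler_relations A"
proof -
  obtain Q where Q: "P = (\<Sum>i\<in>UNIV. euler_shift A i (Q i) - s_symbol i * Q i)"
    using assms by (auto simp: euler_relations_def)
  have "partial_shift j (s_symbol i * Q i) = s_symbol i * partial_shift j (Q i)" for i
    by (simp add: s_symbol_def partial_shift_coef poly_deriv_var_poly)
  then show ?thesis unfolding euler_relations_def Q
    by (intro image_eqI[of _ _ "\<lambda>i. partial_shift j (Q i)"])
       (simp_all add: partial_shift_sum partial_shift_diff partial_shift_euler_shift)
qed

lemma euler_relations_generator: "euler_shift A i P - s_symbol i * P \<in> euler_relations A"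
  unfolding euler_relations_def
proof (rule image_eqI[of _ _ "\<lambda>k. if k = i then P else 0"])
  show "euler_shift A i P - s_symbol i * P
    = (\<Sum>k\<in>UNIV. euler_shift A k (if k = i then P else 0) - s_symbol k * (if k = i then P else 0))"
    by (subst sum.remove[of _ i]) auto
qed simp

subsection \<open>Action on monomials\<close>

text \<open>The coefficient of \<open>x\<^sup>v\<^sup>-\<^sup>u\<close> in
  \<open>\<partial>\<^sup>u x\<^sup>v\<close>. If \<open>u\<close> exceeds \<open>v\<close> at
  \<open>j\<close>, the factor with \<open>i = lookup v j\<close> makes the product 0, as it should
  be.\<close>

definition falling_fact :: "('n::finite \<Rightarrow>\<^sub>0 nat) \<Rightarrow> ('n \<Rightarrow>\<^sub>0 nat) \<Rightarrow> nat" where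
  "falling_fact v u = (\<Prod>j\<in>UNIV. \<Prod>i<lookup u j. lookup v j - i)"

lemma falling_fact_add_single:
  "falling_fact v (single j 1 + u)
    = falling_fact v u * (lookup v j - lookup u j)"
proof -
  have "falling_fact v w = (\<Prod>i<lookup w j. lookup v j - i)
      * (\<Prod>l\<in>UNIV - {j}. \<Prod>i<lookup w l. lookup v l - i)" for w
    unfolding falling_fact_def by (subst prod.remove[of _ j]) auto
  moreover have "(\<Prod>l\<in>UNIV - {j}. \<Prod>i<lookup (single j 1 + u) l. lookup v l - i)
      = (\<Prod>l\<in>UNIV - {j}. \<Prod>i<lookup u l. lookup v l - i)"
    by (intro prod.cong) (auto simp: lookup_add lookup_single)
  ultimately show ?thesis by (simp add: lookup_add)
qed

lemma falling_fact_eq_0_iff: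
  "falling_fact v u = 0 \<longleftrightarrow> (\<exists>j. lookup v j < lookup u j)"
  by (auto simp: falling_fact_def not_le intro: le_less_trans)

definition dpoly_action :: "('n::finite \<Rightarrow>\<^sub>0 nat) \<Rightarrow> 'n dpoly \<Rightarrow> ('d, 'n) sxpoly" where
  "dpoly_action v p = (\<Sum>u\<in>keys p.
     single (xexp (v - u)) (of_nat (falling_fact v u) * lookup p u))"

lemma dpoly_action_add: "dpoly_action v (p + q) = dpoly_action v p + dpoly_action v q"
  unfolding dpoly_action_def
  by (rule setsum_keys_plus_distrib) (simp_all add: distrib_left single_add)

lemma dpoly_action_0 [simp]: "dpoly_action v 0 = 0"
  by (simp add: dpoly_action_def)

lemma dpoly_action_single:
  "dpoly_action v (single u c) = single (xexp (v - u)) (of_nat (falling_fact v u) * c)"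
  by (simp add: dpoly_action_def)

text \<open>The value at \<open>x\<^sup>v\<close> of the operator with the given symbol.\<close>

definition monom_action :: "('n::finite \<Rightarrow>\<^sub>0 nat) \<Rightarrow> ('d, 'n) symbol \<Rightarrow> ('d, 'n) sxpoly" where
  "monom_action v P = (\<Sum>m\<in>keys P. single m 1 * dpoly_action v (lookup P m))"

lemma monom_action_add: "monom_action v (P + Q) = monom_action v P + monom_action v Q"
  unfolding monom_action_def
  by (rule setsum_keys_plus_distrib) (simp_all add: dpoly_action_add distrib_left)

lemma monom_action_0 [simp]: "monom_action v 0 = 0"
  by (simp add: monom_action_def)

lemma monom_action_diff: "monom_action v (P - Q) = monom_action v P - monom_action v Q"
  using monom_action_add[of v "P - Q" Q] by (simp add: algebra_simps)

lemma monom_action_sum: "monom_action v (sum f F) = (\<Sum>i\<in>F. monom_action v (f i))"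
  by (induction F rule: infinite_finite_induct) (simp_all add: monom_action_add)

lemma monom_action_single:
  "monom_action v (single m (single u c))
    = single (m + xexp (v - u)) (of_nat (falling_fact v u) * c)"
proof -
  have "single u c = 0 \<longleftrightarrow> c = 0" by (metis lookup_single_eq lookup_zero single_zero)
  then show ?thesis by (simp add: monom_action_def dpoly_action_single mult_single)
qed

lemma monom_action_coef: "monom_action v (coef_symbol c * P) = c * monom_action v P"
proof (induction P rule: symbol_induct)
  case (single m u b)
  show ?case
    by (induction c rule: poly_mapping_single_induct)
       (simp_all add: coef_symbol_add distrib_right monom_action_add coef_symbol_single mult_single
         monom_action_single ac_simps)
qed (simp_all add: distrib_left monom_action_add)

lemma sum_of_int_single:
  "(\<Sum>j\<in>F. single m (of_int (f j) * c)) = single m (of_int (\<Sum>j\<in>F. f j) * c)"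
  for c :: "'c::ring_1"
  by (induction F rule: infinite_finite_induct) (simp_all add: distrib_right single_add)

lemma euler_shift_single:
  "euler_shift A i (single m (single u c))
    = (\<Sum>j\<in>UNIV. single (single (X_var j) 1 + m)
         (single (single j 1 + u) (of_int (A $ i $ j) * c)))
      + single m (single u (of_int (exp_action A i u) * c))"
proof -
  have "of_int k * x_symbol j * d_symbol (single j 1) * single m (single u c)
      = (single (single (X_var j) 1 + m)
         (single (single j 1 + u) (of_int k * c)) :: ('a, 'b) symbol)" for k j
    by (simp only: of_int_symbol_mult[symmetric])
       (simp add: x_symbol_def var_poly_def coef_symbol_single d_symbol_def mult_single mult.assoc)
  then show ?thesis
    by (simp add: euler_shift_def euler_symbol_def sum_distrib_right grading_deriv_symbol_single grading_deriv_single)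
qed

text \<open>The operator with symbol \<open>euler_shift A i P\<close> applies
  \<open>E\<^sub>i\<close> first, and \<open>x\<^sup>v\<close> is an eigenvector of
  \<open>E\<^sub>i\<close> with eigenvalue \<open>(Av)\<^sub>i\<close>.\<close>

lemma monom_action_euler_shift:
  "monom_action v (euler_shift A i P) = const_poly (of_int (exp_action A i v)) * monom_action v P"
proof (induction P rule: symbol_induct)
  case (single m u c)
  let ?f = "of_nat (falling_fact v u) * c"
  have "single (single (X_var j) 1 + m + xexp (v - (single j 1 + u)))
        (of_nat (falling_fact v (single j 1 + u)) * (of_int k * c))
      = single (m + xexp (v - u))
        (of_int (k * (int (lookup v j) - int (lookup u j))) * ?f)" for j k
  \<comment> \<open>In this case the truncated exponents on the two sides may differ, but both
    coefficients vanish.\<close>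
  proof (cases "falling_fact v u = 0 \<or> lookup v j = lookup u j")
    case True
    then show ?thesis unfolding falling_fact_add_single by auto
  next
    case False
    then have le: "lookup u l \<le> lookup v l" for l
      by (auto simp: falling_fact_eq_0_iff not_less)
    have lt: "lookup u j < lookup v j"
      using False le[of j] by simp
    have "single j 1 + (v - (single j 1 + u)) = v - u"
      using le lt by (intro poly_mapping_eqI) (auto simp: lookup_add lookup_minus lookup_single when_def)
    then have "xexp (v - u) = single (X_var j) 1 + xexp (v - (single j 1 + u))"
      by (metis xexp_add xexp_single)
    then have "single (X_var j) 1 + m + xexp (v - (single j 1 + u)) = m + xexp (v - u)"
      by (metis add.assoc add.commute)
    then show ?thesis unfolding falling_fact_add_single
      using le[of j] by (simp add: of_nat_diff mult_ac)
  qed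
  then have "monom_action v (euler_shift A i (single m (single u c)))
    = (\<Sum>j\<in>UNIV. single (m + xexp (v - u))
        (of_int (A $ i $ j * (int (lookup v j) - int (lookup u j))) * ?f))
      + single (m + xexp (v - u)) (of_nat (falling_fact v u) * (of_int (exp_action A i u) * c))"
    unfolding euler_shift_single monom_action_add monom_action_sum monom_action_single
    by (simp only:)
  also have "\<dots> = single (m + xexp (v - u)) (of_int (exp_action A i v) * ?f)"
    unfolding sum_of_int_single exp_action_eq
    by (simp add: algebra_simps sum_subtractf flip: single_add)
  also have "\<dots> = const_poly (of_int (exp_action A i v)) * monom_action v (single m (single u c))"
    by (simp only: monom_action_single mult_single add_0)
  finally show ?case .
qed (simp_all add: euler_shift_add monom_action_add distrib_left)

text \<open>Test at \<open>x\<^sup>u\<close>, where \<open>\<partial>\<^sup>u\<close> has least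
  degree among the monomials in \<open>\<partial>\<close> occurring in \<open>P\<close>. All other
  ones annihilate \<open>x\<^sup>u\<close>, so what is left is \<open>u!\<close> times the
  coefficient of \<open>\<partial>\<^sup>u\<close>.\<close>

lemma monom_action_eq_0_imp_eq_0:
  fixes P :: "('d::finite, 'n::finite) symbol"
  assumes "\<And>v. monom_action v P = 0"
  shows "P = 0"
proof (rule ccontr)
  assume "P \<noteq> 0"
  define U where "U = {u. \<exists>m. lookup (lookup P m) u \<noteq> 0}"
  have "\<exists>m. lookup P m \<noteq> 0" using \<open>P \<noteq> 0\<close> by (metis lookup_zero poly_mapping_eqI)
  then obtain m where "lookup P m \<noteq> 0" ..
  then have "\<exists>u. u \<in> U" unfolding U_def by (metis (mono_tags, lifting) lookup_zero mem_Collect_eq poly_mapping_eqI)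
  then obtain u where u: "u \<in> U" "\<And>u'. u' \<in> U \<Longrightarrow> tdeg u \<le> tdeg u'"
    using ex_has_least_nat[of "\<lambda>u. u \<in> U" _ tdeg] by metis
  have act: "dpoly_action u (lookup P m)
      = const_poly (of_nat (falling_fact u u) * lookup (lookup P m) u)" for m
  proof -
    let ?p = "lookup P m"
    have "falling_fact u u' = 0" if "u' \<in> keys ?p" "u' \<noteq> u" for u'
    proof (rule ccontr)
      assume "falling_fact u u' \<noteq> 0"
      then have "\<exists>w. u = u' + w" by (subst exponent_le_iff[symmetric]) (auto simp: falling_fact_eq_0_iff not_less)
      then obtain w where w: "u = u' + w" ..
      have "u' \<in> U" using that by (auto simp: U_def in_keys_iff)
      then have "tdeg w = 0" using u(2)[of u'] w by (simp add: tdeg_add)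
      then have "lookup w j = 0" for j using lookup_le_tdeg[of w j] by simp
      then have "w = 0" by (intro poly_mapping_eqI) simp
      then show False using w that by simp
    qed
    then have "dpoly_action u ?p = (\<Sum>u'\<in>keys ?p. if u' = u then
        const_poly (of_nat (falling_fact u u) * lookup ?p u) else 0)"
      unfolding dpoly_action_def by (intro sum.cong) auto
    also have "\<dots> = const_poly (of_nat (falling_fact u u) * lookup ?p u)"
      by (auto simp: sum.delta in_keys_iff)
    finally show ?thesis .
  qed
  have "monom_action u P = (\<Sum>m\<in>keys P. single m
      (of_nat (falling_fact u u) * lookup (lookup P m) u))"
    by (simp add: monom_action_def act mult_single)
  then have "lookup (monom_action u P) m
      = of_nat (falling_fact u u) * lookup (lookup P m) u" for m
    by (auto simp: lookup_sum lookup_single when_def sum.delta' in_keys_iff)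
  then have "of_nat (falling_fact u u) * lookup (lookup P m) u = 0" for m
    using assms[of u] by (metis lookup_zero)
  moreover have "falling_fact u u \<noteq> 0" by (simp add: falling_fact_eq_0_iff)
  ultimately show False using u(1) by (simp add: U_def)
qed

section \<open>Specialisation of the parameters\<close>

definition s_subst :: "('d::finite \<Rightarrow> complex) \<Rightarrow> ('d, 'n::finite) sxpoly \<Rightarrow> ('d, 'n) sxpoly" where
  "s_subst t p = (\<Sum>m\<in>keys p. single (xexp (x_part m))
     (lookup p m * (\<Prod>i\<in>UNIV. t i ^ lookup m (S_var i))))"

lemma s_subst_add: "s_subst t (p + q) = s_subst t p + s_subst t q"
  unfolding s_subst_def
  by (rule setsum_keys_plus_distrib) (simp_all add: distrib_right single_add)

lemma s_subst_0 [simp]: "s_subst t 0 = 0"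
  by (simp add: s_subst_def)

lemma s_subst_diff: "s_subst t (p - q) = s_subst t p - s_subst t q"
  using s_subst_add[of t "p - q" q] by (simp add: algebra_simps)

lemma s_subst_sum: "s_subst t (sum f F) = (\<Sum>i\<in>F. s_subst t (f i))"
  by (induction F rule: infinite_finite_induct) (simp_all add: s_subst_add)

lemma s_subst_single:
  "s_subst t (single m c)
    = single (xexp (x_part m)) (c * (\<Prod>i\<in>UNIV. t i ^ lookup m (S_var i)))"
  by (simp add: s_subst_def)

lemma s_subst_const_mult: "s_subst t (const_poly c * p) = const_poly c * s_subst t p"
  by (induction p rule: poly_mapping_single_induct)
     (simp_all add: distrib_left s_subst_add mult_single s_subst_single mult.assoc)

lemma s_subst_var_mult: "s_subst t (var_poly (S_var i) * p) = const_poly (t i) * s_subst t p"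
proof (induction p rule: poly_mapping_single_induct)
  case (single m c)
  have "x_part (single (S_var i) 1 + m) = x_part m"
    by (rule poly_mapping_eqI) (simp add: lookup_add lookup_single)
  moreover have "(\<Prod>l\<in>UNIV. t l ^ lookup (single (S_var i) 1 + m) (S_var l))
      = t i * (\<Prod>l\<in>UNIV. t l ^ lookup m (S_var l))"
  proof -
    have "(\<Prod>l\<in>UNIV. t l ^ lookup (single (S_var i) 1 + m) (S_var l))
        = (\<Prod>l\<in>UNIV. (if l = i then t i else 1) * t l ^ lookup m (S_var l))"
      by (intro prod.cong) (auto simp: lookup_add lookup_single)
    then show ?thesis by (simp add: prod.distrib)
  qed
  ultimately show ?case by (simp add: var_poly_def mult_single s_subst_single mult.left_commute)
qed (simp_all add: distrib_left s_subst_add)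

lemma s_subst_sfree:
  assumes "sfree p"
  shows "s_subst t p = p"
proof -
  have "xexp (x_part m) = m" "lookup m (S_var i) = 0" if "m \<in> keys p" for m i
  proof -
    have s: "s_part m = 0" using assms that by (simp add: sfree_def)
    then show "xexp (x_part m) = m" using indet_exp_split[of m] by simp
    show "lookup m (S_var i) = 0" using arg_cong[OF s, of "\<lambda>a. lookup a i"] by simp
  qed
  then have "s_subst t p = (\<Sum>m\<in>keys p. single m (lookup p m))"
    unfolding s_subst_def by (intro sum.cong) auto
  then show ?thesis using poly_mapping_sum_singles[of p] by simp
qed

lemma sfree_monom_action:
  assumes "sfree P"
  shows "sfree (monom_action v P)"
  unfolding monom_action_def dpoly_action_def using assms
  by (intro sfree_sum sfree_mult sfree_single) (auto simp: sfree_def)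

text \<open>At \<open>s = Av\<close> the operators \<open>E\<^sub>i - s\<^sub>i\<close> annihilate \<open>x\<^sup>v\<close>.\<close>

lemma sfree_euler_relation_eq_0:
  assumes "P \<in> euler_relations A" "sfree P"
  shows "P = 0"
proof (rule monom_action_eq_0_imp_eq_0)
  fix v
  obtain Q where Q: "P = (\<Sum>i\<in>UNIV. euler_shift A i (Q i) - s_symbol i * Q i)"
    using assms by (auto simp: euler_relations_def)
  define t where "t i = complex_of_int (exp_action A i v)" for i
  have "monom_action v P = (\<Sum>i\<in>UNIV. const_poly (t i) * monom_action v (Q i) - var_poly (S_var i) * monom_action v (Q i))"
    unfolding Q monom_action_sum monom_action_diff monom_action_euler_shift s_symbol_def monom_action_coef t_def ..
  then have "s_subst t (monom_action v P) = 0"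
    by (simp add: s_subst_sum s_subst_diff s_subst_const_mult s_subst_var_mult)
  then show "monom_action v P = 0" using s_subst_sfree[OF sfree_monom_action[OF assms(2)]] by metis
qed


subsection \<open>The relations of the system attached to an ideal\<close>

text \<open>Multiplying a normally ordered operator on the right by an element of
  \<open>C[\<partial>]\<close> multiplies the symbols. So these are the symbols of the left ideal
  generated by \<open>I\<close> among the operators with coefficients in
  \<open>C[s,x]\<close>.\<close>

definition extend_ideal :: "'n dpoly set \<Rightarrow> ('d, 'n) symbol set" where
  "extend_ideal I = {P. \<forall>m. lookup P m \<in> I}"

lemma extend_ideal_ideal:
  fixes I :: "'n::finite dpoly set"
  assumes I: "left_ideal_of UNIV I"
  shows "left_ideal_of UNIV (extend_ideal I :: ('d::finite, 'n) symbol set)"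
proof -
  have 0: "0 \<in> (extend_ideal I :: ('d, 'n) symbol set)" by (simp add: extend_ideal_def left_ideal_zero[OF I])
  have add: "P + Q \<in> extend_ideal I" if "P \<in> extend_ideal I" "Q \<in> extend_ideal I" for P Q :: "('d, 'n) symbol"
    using that by (simp add: extend_ideal_def lookup_add left_ideal_add[OF I])
  have "R * P \<in> extend_ideal I" if P: "P \<in> extend_ideal I" for R P :: "('d, 'n) symbol"
  proof (induction R rule: poly_mapping_single_induct)
    case (single m c)
    have "lookup (single m c * P) m' \<in> I" for m'
    proof (cases "\<exists>k. m' = m + k")
      case True
      then obtain k where "m' = m + k" ..
      then show ?thesis using P by (simp add: lookup_single_mult extend_ideal_def left_ideal_mult[OF I])
    next
      case False
      then show ?thesis by (simp add: lookup_single_mult_0 left_ideal_zero[OF I])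
    qed
    then show ?case by (simp add: extend_ideal_def)
  qed (simp_all add: 0 add distrib_right)
  then show ?thesis using 0 add by (simp add: left_ideal_of_def)
qed

lemma lookup_poly_deriv:
  "lookup (poly_deriv v p) m
    = of_nat (Suc (lookup m v)) * lookup p (m + single v 1)"
proof (induction p rule: poly_mapping_single_induct)
  case (single a c)
  show ?case
  proof (cases "lookup a v = 0")
    case True
    then have "a \<noteq> m + single v 1" by (auto simp: lookup_add)
    then show ?thesis using True by (simp add: poly_deriv_single lookup_single)
  next
    case False
    then have "a - single v 1 = m \<longleftrightarrow> a = m + single v 1"
    proof -
      have "a = (a - single v 1) + single v 1"
        using False by (intro poly_mapping_eqI) (auto simp: lookup_add lookup_minus lookup_single when_def)
      then show ?thesis by (metis add_diff_cancel_right')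
    qed
    then show ?thesis by (auto simp: poly_deriv_single lookup_single when_def lookup_add)
  qed
qed (simp_all add: poly_deriv_add lookup_add distrib_left)

lemma extend_ideal_poly_deriv:
  assumes I: "left_ideal_of UNIV I" and "P \<in> extend_ideal I"
  shows "poly_deriv v P \<in> extend_ideal I"
  using assms(2) by (simp add: extend_ideal_def lookup_poly_deriv left_ideal_mult[OF I])

lemma extend_ideal_partial_shift:
  assumes I: "left_ideal_of UNIV I" and "P \<in> extend_ideal I"
  shows "partial_shift j P \<in> extend_ideal I"
  unfolding partial_shift_def
  using assms(2) extend_ideal_poly_deriv[OF I]
  by (intro left_ideal_add[OF extend_ideal_ideal[OF I]] left_ideal_mult[OF extend_ideal_ideal[OF I]])

text \<open>Stability under these derivations expresses homogeneity for the
  \<open>\<int>\<^sup>d\<close>-grading: the graded components are their joint eigenspaces.\<close>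

definition graded_ideal :: "int ^ 'n::finite ^ 'd::finite \<Rightarrow> 'n dpoly set \<Rightarrow> bool" where
  "graded_ideal A I \<longleftrightarrow> left_ideal_of UNIV I \<and> (\<forall>i. \<forall>p\<in>I. grading_deriv A i p \<in> I)"

text \<open>Gradedness is what makes right multiplication by \<open>E\<^sub>i\<close> preserve the
  left ideal generated by \<open>I\<close>, and hence act on the quotient.\<close>

lemma extend_ideal_euler_shift:
  assumes I: "graded_ideal A I" and "P \<in> extend_ideal I"
  shows "euler_shift A i P \<in> extend_ideal I"
proof -
  have I': "left_ideal_of UNIV I" using I by (simp add: graded_ideal_def)
  have "grading_deriv_symbol A i P \<in> extend_ideal I"
    using assms by (simp add: extend_ideal_def lookup_grading_deriv_symbol graded_ideal_def)
  then show ?thesis unfolding euler_shift_def using assms(2)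
    by (intro left_ideal_add[OF extend_ideal_ideal[OF I']] left_ideal_mult[OF extend_ideal_ideal[OF I']])
qed

text \<open>The left ideal of the system before denominators in \<open>C[s,x]\<close> are
  inverted.\<close>

definition system_relations :: "int ^ 'n::finite ^ 'd::finite \<Rightarrow> 'n dpoly set \<Rightarrow> ('d, 'n) symbol set" where
  "system_relations A I = {P + Q | P Q. P \<in> euler_relations A \<and> Q \<in> extend_ideal I}"

lemma system_relations_superset:
  assumes "left_ideal_of UNIV I"
  shows "euler_relations A \<subseteq> system_relations A I" "extend_ideal I \<subseteq> system_relations A I"
  using euler_relations_0 left_ideal_zero[OF extend_ideal_ideal[OF assms]]
  unfolding system_relations_def by force+

lemma system_relations_add:
  assumes I: "left_ideal_of UNIV I" and "P \<in> system_relations A I" "P' \<in> system_relations A I"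
  shows "P + P' \<in> system_relations A I"
proof -
  obtain Q R Q' R' where "P = Q + R" "P' = Q' + R'" "Q \<in> euler_relations A" "R \<in> extend_ideal I"
      "Q' \<in> euler_relations A" "R' \<in> extend_ideal I"
    using assms(2,3) unfolding system_relations_def by auto
  moreover from this have "P + P' = (Q + Q') + (R + R')" by (simp add: algebra_simps)
  ultimately show ?thesis unfolding system_relations_def
    using euler_relations_add left_ideal_add[OF extend_ideal_ideal[OF I]] by blast
qed

lemma system_relations_coef:
  assumes I: "left_ideal_of UNIV I" and "P \<in> system_relations A I"
  shows "coef_symbol c * P \<in> system_relations A I"
proof -
  obtain Q R where "P = Q + R" "Q \<in> euler_relations A" "R \<in> extend_ideal I"
    using assms(2) unfolding system_relations_def by auto
  moreover from this have "coef_symbol c * P = coef_symbol c * Q + coef_symbol c * R" by (simp add: algebra_simps)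
  ultimately show ?thesis unfolding system_relations_def
    using euler_relations_coef left_ideal_mult[OF extend_ideal_ideal[OF I]] by blast
qed

lemma system_relations_partial:
  assumes I: "left_ideal_of UNIV I" and "P \<in> system_relations A I"
  shows "partial_shift j P \<in> system_relations A I"
proof -
  obtain Q R where "P = Q + R" "Q \<in> euler_relations A" "R \<in> extend_ideal I"
    using assms(2) unfolding system_relations_def by auto
  moreover from this have "partial_shift j P = partial_shift j Q + partial_shift j R" by (simp add: partial_shift_add)
  ultimately show ?thesis unfolding system_relations_def
    using euler_relations_partial extend_ideal_partial_shift[OF I] by blast
qed

lemma system_relations_diff:
  assumes I: "left_ideal_of UNIV I" and "P \<in> system_relations A I" "P' \<in> system_relations A I"
  shows "P - P' \<in> system_relations A I"
  using system_relations_add[OF I assms(2) system_relations_coef[OF I assms(3), of "-1"]]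
  by (simp add: coef_symbol_uminus)

lemma system_relations_0:
  assumes I: "left_ideal_of UNIV I"
  shows "0 \<in> system_relations A I"
  using system_relations_superset(1)[OF I] euler_relations_0 by blast

lemma system_relations_sum:
  assumes I: "left_ideal_of UNIV I" and "\<And>i. i \<in> F \<Longrightarrow> f i \<in> system_relations A I"
  shows "sum f F \<in> system_relations A I"
  using assms(2) by (induction F rule: infinite_finite_induct)
    (auto intro: system_relations_0[OF I] system_relations_add[OF I])

lemma exponent_induct [case_names zero add]:
  fixes a :: "'v::finite \<Rightarrow>\<^sub>0 nat"
  assumes "P 0" "\<And>i a. P a \<Longrightarrow> P (single i 1 + a)"
  shows "P a"
proof (induction "tdeg a" arbitrary: a)
  case 0
  then have "lookup a j = 0" for j using lookup_le_tdeg[of a j] by simp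
  then have "a = 0" by (intro poly_mapping_eqI) simp
  then show ?case using assms(1) by simp
next
  case (Suc k)
  then have "\<exists>i. lookup a i \<noteq> 0" unfolding tdeg_def by (metis nat.distinct(1) sum.neutral)
  then obtain i where "lookup a i \<noteq> 0" ..
  then have a: "a = single i 1 + (a - single i 1)"
    by (intro poly_mapping_eqI) (auto simp: lookup_add lookup_minus lookup_single when_def)
  then have "tdeg a = 1 + tdeg (a - single i 1)" using tdeg_add tdeg_single by metis
  then have "P (a - single i 1)" using Suc by simp
  then show ?case using a assms(2) by metis
qed

definition s_monom :: "('d::finite \<Rightarrow>\<^sub>0 nat) \<Rightarrow> ('d, 'n::finite) symbol" where
  "s_monom a = coef_symbol (single (sexp a) 1)"

lemma s_monom_add: "s_monom (a + b) = s_monom a * s_monom b"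
  by (simp add: s_monom_def sexp_add mult_single flip: coef_symbol_mult)

lemma s_monom_0 [simp]: "s_monom 0 = 1"
  by (simp add: s_monom_def)

lemma s_monom_single: "s_monom (single i 1) = s_symbol i"
  by (simp add: s_monom_def s_symbol_def var_poly_def sexp_single)

text \<open>Modulo the Euler relations, \<open>s\<^sub>i\<close> acts as \<open>euler_shift A i\<close>, which does not involve \<open>s\<close>.\<close>

lemma s_monom_reduce:
  assumes "\<And>k i P. P \<in> W k \<Longrightarrow> euler_shift A i P \<in> W (Suc k)" and "P \<in> W k"
  shows "\<exists>P'\<in>W (k + tdeg a). s_monom a * P - P' \<in> euler_relations A"
proof (induction a rule: exponent_induct)
  case zero
  then show ?case using assms(2) euler_relations_0 by (intro bexI[of _ P]) auto
next
  case (add i a)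
  then obtain P' where P': "P' \<in> W (k + tdeg a)" "s_monom a * P - P' \<in> euler_relations A" by blast
  have "s_monom (single i 1 + a) * P - euler_shift A i P'
      = s_symbol i * (s_monom a * P - P') + coef_symbol (-1) * (euler_shift A i P' - s_symbol i * P')"
    unfolding s_monom_add s_monom_single coef_symbol_uminus by (simp add: algebra_simps)
  moreover have "s_symbol i * (s_monom a * P - P') \<in> euler_relations A"
    unfolding s_symbol_def by (rule euler_relations_coef[OF P'(2)])
  ultimately have "s_monom (single i 1 + a) * P - euler_shift A i P' \<in> euler_relations A"
    using euler_relations_add euler_relations_coef[OF euler_relations_generator] by metis
  moreover have "euler_shift A i P' \<in> W (k + tdeg (single i 1 + a))"
    using assms(1)[OF P'(1)] by (simp add: tdeg_add)
  ultimately show ?case by blast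
qed

section \<open>Differential operators and their symbols\<close>

lemma d_coef_add: "d_coef (f + g) = d_coef f + d_coef g"
  by transfer (simp add: fun_eq_iff distrib_right)

lemma d_coef_mult: "d_coef (f * g) = d_coef f * d_coef g"
  by transfer (simp add: fun_eq_iff mult.assoc)

lemma d_coef_0 [simp]: "d_coef 0 = 0"
  by transfer simp

lemma d_coef_1 [simp]: "d_coef 1 = 1"
  by transfer simp

lemma d_coef_uminus: "d_coef (- f) = - d_coef f"
  by transfer (simp add: fun_eq_iff)

lemma d_coef_of_int: "d_coef (of_int k) = of_int k"
proof -
  have nat: "d_coef (of_nat n) = of_nat n" for n
    by (induction n) (simp_all add: d_coef_add)
  show ?thesis by (cases k rule: int_cases2) (simp_all add: nat d_coef_uminus)
qed

lemma diffop_induct [case_names coef partial add mult]: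
  fixes R :: "('d::finite, 'n::finite) diffop"
  assumes coef: "\<And>f. Q (d_coef f)" and partial: "\<And>j. Q (d_partial j)"
    and add: "\<And>R S. Q R \<Longrightarrow> Q S \<Longrightarrow> Q (R + S)" and mult: "\<And>R S. Q R \<Longrightarrow> Q S \<Longrightarrow> Q (R * S)"
  shows "Q R"
proof -
  have "Q (Abs_diffop P)" if "P \<in> diffop_set" for P
    using that
  proof (induction rule: diffop_set.induct)
    case (mult f)
    have "Abs_diffop (\<lambda>g. f * g) = d_coef f" by (metis Rep_diffop_inverse d_coef.rep_eq)
    then show ?case using coef by metis
  next
    case (deriv j)
    have "Abs_diffop (ratfun_deriv (X_var j)) = d_partial j" by (metis Rep_diffop_inverse d_partial.rep_eq)
    then show ?case using partial by metis
  next
    case (add P R)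
    have "Abs_diffop (\<lambda>g. P g + R g) = Abs_diffop P + Abs_diffop R"
      using add.hyps by (simp add: plus_diffop.abs_eq eq_onp_def)
    then show ?case using assms(3) add.IH by simp
  next
    case (comp P R)
    have "Abs_diffop (\<lambda>g. P (R g)) = Abs_diffop P * Abs_diffop R"
      using comp.hyps by (simp add: times_diffop.abs_eq eq_onp_def)
    then show ?case using assms(4) comp.IH by simp
  qed
  then show ?thesis by (metis Rep_diffop Rep_diffop_inverse)
qed

lemma to_fract_of_int: "to_fract (of_int k) = of_int k"
proof -
  have nat: "to_fract (of_nat n :: 'a) = of_nat n" for n
    by (induction n) simp_all
  show ?thesis by (cases k rule: int_cases2) (simp_all add: nat)
qed

lemma ratfun_const_simps:
  "ratfun_const 0 = 0" "ratfun_const 1 = 1" "ratfun_const (a + b) = ratfun_const a + ratfun_const b"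
  by (simp_all add: ratfun_const_def single_add)

lemma d_embed_add: "d_embed (p + q) = d_embed p + d_embed q"
  unfolding d_embed_def
  by (rule setsum_keys_plus_distrib) (simp_all add: ratfun_const_simps d_coef_add distrib_right)

lemma d_embed_0 [simp]: "d_embed 0 = 0"
  by (simp add: d_embed_def)

lemma d_embed_single: "d_embed (single u c) = d_coef (ratfun_const c) * d_monom u"
  by (simp add: d_embed_def ratfun_const_simps)

definition op_of :: "('d::finite, 'n::finite) symbol \<Rightarrow> ('d, 'n) diffop" where
  "op_of P = (\<Sum>m\<in>keys P.
     d_coef (to_fract (single m 1)) * d_embed (lookup P m))"

lemma op_of_add: "op_of (P + Q) = op_of P + op_of Q"
  unfolding op_of_def
  by (rule setsum_keys_plus_distrib) (simp_all add: d_embed_add distrib_left)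

lemma op_of_0 [simp]: "op_of 0 = 0"
  by (simp add: op_of_def)

lemma op_of_diff: "op_of (P - Q) = op_of P - op_of Q"
  using op_of_add[of "P - Q" Q] by (simp add: algebra_simps)

lemma op_of_sum: "op_of (sum f F) = (\<Sum>i\<in>F. op_of (f i))"
  by (induction F rule: infinite_finite_induct) (simp_all add: op_of_add)

lemma op_of_single_dpoly: "op_of (single m p) = d_coef (to_fract (single m 1)) * d_embed p"
  by (cases "p = 0") (simp_all add: op_of_def)

lemma op_of_single:
  "op_of (single m (single u c)) = d_coef (to_fract (single m c)) * d_monom u"
proof -
  have "to_fract (single m c) = to_fract (single m 1) * ratfun_const c"
    by (simp add: ratfun_const_def mult_single flip: to_fract_mult)
  then show ?thesis by (simp add: op_of_single_dpoly d_embed_single d_coef_mult mult.assoc)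
qed

lemma op_of_coef: "op_of (coef_symbol c * P) = d_coef (to_fract c) * op_of P"
proof (induction P rule: symbol_induct)
  case (single m u b)
  show ?case
    by (induction c rule: poly_mapping_single_induct)
       (simp_all add: coef_symbol_add distrib_right op_of_add coef_symbol_single mult_single
         op_of_single d_coef_add flip: mult.assoc d_coef_mult to_fract_mult)
qed (simp_all add: distrib_left op_of_add)

lemma op_of_d_symbol: "op_of (d_symbol u) = d_monom u"
  by (simp add: d_symbol_def op_of_single)

lemma op_of_1 [simp]: "op_of 1 = 1"
  by (metis d_symbol_0 op_of_d_symbol d_monom_0)

lemma ratfun_deriv_to_fract: "ratfun_deriv v (to_fract p) = to_fract (poly_deriv v p)"
  by (simp add: to_fract_def ratfun_deriv_Fract)

lemma op_of_partial_shift: "op_of (partial_shift j P) = d_partial j * op_of P"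
proof (induction P rule: symbol_induct)
  case (single m u c)
  have "(of_nat k :: 'b dpoly) * single u c = single u (of_nat k * c)" for k c
    using mult_single[of 0 "of_nat k" u c] by simp
  then have "partial_shift j (single m (single u c))
      = single m (single (single j 1 + u) c)
        + single (m - single (X_var j) 1)
            (single u (of_nat (lookup m (X_var j)) * c))"
    by (simp only: partial_shift_def d_symbol_def poly_deriv_single mult_single) simp
  then have "op_of (partial_shift j (single m (single u c)))
      = d_coef (to_fract (single m c)) * (d_partial j * d_monom u)
        + d_coef (to_fract (poly_deriv (X_var j) (single m c))) * d_monom u"
    by (simp only: op_of_add op_of_single d_monom_single_add poly_deriv_single)
  also have "\<dots> = (d_partial j * d_coef (to_fract (single m c))) * d_monom u"
    by (simp only: d_partial_coef ratfun_deriv_to_fract distrib_right mult.assoc)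
  finally show ?case by (simp only: op_of_single mult.assoc)
qed (simp_all add: partial_shift_add op_of_add distrib_left, simp add: partial_shift_def)

lemma d_partial_euler_op:
  "d_partial j * euler_op A i = euler_op A i * d_partial j + of_int (A $ i $ j) * (d_partial j :: ('d::finite, 'n::finite) diffop)"
proof -
  have "d_partial j * (of_int k * d_coef (x_ratfun l) * d_partial l)
      = of_int k * d_coef (x_ratfun l) * d_partial l * d_partial j
        + (if l = j then of_int k * d_partial j else 0 :: ('d, 'n) diffop)" for k l
  proof -
    have "d_partial j * (of_int k * d_coef (x_ratfun l) * d_partial l)
        = of_int k * (d_partial j * d_coef (x_ratfun l)) * (d_partial l :: ('d, 'n) diffop)"
      by (simp only: mult_of_int_commute[of k "d_partial j", symmetric] flip: mult.assoc)
    also have "\<dots> = of_int k * d_coef (x_ratfun l) * (d_partial j * d_partial l)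
        + of_int k * d_coef (if j = l then 1 else 0) * d_partial l"
      by (simp add: d_partial_coef distrib_left distrib_right mult.assoc)
    finally show ?thesis by (simp add: d_partial_commute[of j l] mult.assoc)
  qed
  then show ?thesis
    by (simp add: euler_op_def sum_distrib_left sum_distrib_right sum.distrib)
qed

lemma d_monom_euler_op:
  "d_monom u * euler_op A i = euler_op A i * d_monom u + of_int (exp_action A i u) * (d_monom u :: ('d::finite, 'n::finite) diffop)"
proof (induction u rule: exponent_induct)
  case (add j u)
  have "d_monom (single j 1 + u) * euler_op A i = d_partial j * (d_monom u * euler_op A i)"
    by (simp only: d_monom_single_add mult.assoc)
  also have "\<dots> = (d_partial j * euler_op A i) * d_monom u + of_int (exp_action A i u) * (d_partial j * d_monom u :: ('d, 'n) diffop)"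
    unfolding add.IH distrib_left
    by (simp only: mult_of_int_commute[of "exp_action A i u" "d_partial j", symmetric] flip: mult.assoc)
  also have "\<dots> = euler_op A i * d_monom (single j 1 + u)
      + of_int (exp_action A i (single j 1 + u)) * d_monom (single j 1 + u)"
    unfolding d_partial_euler_op d_monom_single_add exp_action_add
    by (simp add: distrib_right mult.assoc)
  finally show ?case .
qed simp

lemma op_of_euler_shift: "op_of (euler_shift A i P) = op_of P * euler_op A i"
proof (induction P rule: symbol_induct)
  case (single m u c)
  let ?f = "d_coef (to_fract (single m c))"
  have a: "of_int k * x = x * of_int k" for k and x :: "('a, 'b) diffop" by (rule mult_of_int_commute)
  have 1: "to_fract (single m (of_int k * c)) = to_fract (single m c) * of_int k" for k
  proof -
    have "single m (of_int k * c) = single m c * const_poly (of_int k)"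
      by (simp only: mult_single) (simp add: mult.commute)
    then show ?thesis by (simp add: to_fract_mult to_fract_of_int)
  qed
  have 2: "to_fract (single (single (X_var j) 1 + m) (of_int k * c))
      = to_fract (single m c) * of_int k * x_ratfun j" for j k
  proof -
    have "single (single (X_var j) 1 + m) (of_int k * c)
        = single m c * const_poly (of_int k) * var_poly (X_var j)"
      by (simp only: mult_single var_poly_def) (simp add: ac_simps)
    then show ?thesis by (simp add: to_fract_mult to_fract_of_int x_ratfun_def)
  qed
  have "op_of (euler_shift A i (single m (single u c)))
      = (\<Sum>j\<in>UNIV. ?f * (of_int (A $ i $ j) * d_coef (x_ratfun j) * d_partial j) * d_monom u)
        + ?f * of_int (exp_action A i u) * d_monom u"
    unfolding euler_shift_single op_of_add op_of_sum op_of_single 1 2 d_monom_single_add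
    by (simp add: d_coef_mult d_coef_of_int mult.assoc)
  also have "\<dots> = ?f * (euler_op A i * d_monom u + of_int (exp_action A i u) * d_monom u)"
    by (simp add: euler_op_def sum_distrib_left sum_distrib_right distrib_left mult.assoc)
  also have "\<dots> = op_of (single m (single u c)) * euler_op A i"
    by (simp add: op_of_single mult.assoc flip: d_monom_euler_op)
  finally show ?case .
qed (simp_all add: euler_shift_add op_of_add distrib_right)

lemma d_monom_s_ratfun: "d_monom u * d_coef (s_ratfun i) = d_coef (s_ratfun i) * d_monom u"
proof (induction u rule: exponent_induct)
  case (add j u)
  then show ?case
    by (simp only: d_monom_single_add mult.assoc) (simp add: d_partial_coef flip: mult.assoc)
qed simp

lemma op_of_s_symbol: "op_of (s_symbol i * P) = op_of P * d_coef (s_ratfun i)"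
proof (induction P rule: symbol_induct)
  case (single m u c)
  then show ?case
    by (simp add: s_symbol_def op_of_coef op_of_single mult.assoc d_monom_s_ratfun flip: s_ratfun_def)
       (simp add: mult.commute[of "s_ratfun i"] flip: mult.assoc d_coef_mult)
qed (simp_all add: distrib_left op_of_add distrib_right)

section \<open>Operators are determined by their symbols\<close>

lemma d_monom_action:
  "Rep_diffop (d_monom u :: ('d::finite, 'n::finite) diffop) (to_fract (single (xexp v) 1))
    = to_fract (single (xexp (v - u)) (of_nat (falling_fact v u)))"
proof (induction u rule: exponent_induct)
  case zero
  have "falling_fact v 0 = 1" by (simp add: falling_fact_def)
  then show ?case by (simp add: one_diffop.rep_eq)
next
  case (add j u)
  have "(xexp (v - u) :: ('d, 'n) indet \<Rightarrow>\<^sub>0 nat) - single (X_var j) 1 = xexp (v - (single j 1 + u))"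
    by (rule indet_exp_eqI) (simp_all add: lookup_minus lookup_add lookup_single when_def)
  then show ?case unfolding d_monom_single_add
    by (simp add: times_diffop.rep_eq d_partial.rep_eq add ratfun_deriv_to_fract poly_deriv_single
      falling_fact_add_single[simplified] lookup_minus mult.commute)
qed

lemma op_of_action:
  "Rep_diffop (op_of P) (to_fract (single (xexp v) 1)) = to_fract (monom_action v P)"
proof (induction P rule: symbol_induct)
  case (single m u c)
  show ?case
    by (simp add: op_of_single times_diffop.rep_eq d_coef.rep_eq d_monom_action monom_action_single
      mult_single mult.commute flip: to_fract_mult)
qed (simp_all add: op_of_add monom_action_add plus_diffop.rep_eq zero_diffop.rep_eq)

text \<open>An operator that vanishes as a map on \<open>C(s,x)\<close> kills in particular all
  \<open>x\<^sup>v\<close>, and these detect its symbol. This is the linear independence of the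
  \<open>\<partial>\<^sup>u\<close> over \<open>C[s,x]\<close>.\<close>

lemma op_of_eq_0_iff: "op_of P = 0 \<longleftrightarrow> P = 0"
proof
  assume "op_of P = 0"
  then have "to_fract (monom_action v P) = 0" for v
    unfolding op_of_action[symmetric] by (simp add: zero_diffop.rep_eq)
  then show "P = 0" by (intro monom_action_eq_0_imp_eq_0) simp
qed simp

lemma inj_d_monom: "inj (d_monom :: ('n::finite \<Rightarrow>\<^sub>0 nat) \<Rightarrow> ('d::finite, 'n) diffop)"
proof (rule injI)
  fix u v :: "'n \<Rightarrow>\<^sub>0 nat" assume "d_monom u = (d_monom v :: ('d, 'n) diffop)"
  then have "op_of (d_symbol u - d_symbol v :: ('d, 'n) symbol) = 0"
    by (simp add: op_of_diff op_of_d_symbol)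
  then have "(d_symbol u :: ('d, 'n) symbol) = d_symbol v" by (simp add: op_of_eq_0_iff)
  then have "lookup (lookup (d_symbol u :: ('d, 'n) symbol) 0) u
      = lookup (lookup (d_symbol v :: ('d, 'n) symbol) 0) u" by simp
  then show "u = v" by (simp add: d_symbol_def lookup_single when_def split: if_splits)
qed


section \<open>The left ideal of the system\<close>

text \<open>The Ore condition for polynomial denominators. For \<open>\<partial>\<^sub>j\<close> it
  comes from \<open>q\<^sup>2 \<partial>\<^sub>j S = q \<partial>\<^sub>j (q S) -
  (\<partial>\<^sub>j q) (q S)\<close>, where the last \<open>\<partial>\<^sub>j q\<close> is the
  derivative of \<open>q\<close>.\<close>

lemma left_ideal_of_fractions:
  fixes N :: "('d::finite, 'n::finite) symbol set"
  assumes "0 \<in> N" and add: "\<And>P Q. P \<in> N \<Longrightarrow> Q \<in> N \<Longrightarrow> P + Q \<in> N"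
    and coef: "\<And>c P. P \<in> N \<Longrightarrow> coef_symbol c * P \<in> N"
    and partial: "\<And>j P. P \<in> N \<Longrightarrow> partial_shift j P \<in> N"
  shows "left_ideal_of UNIV {R. \<exists>q P. q \<noteq> 0 \<and> P \<in> N \<and> d_coef (to_fract q) * R = op_of P}"
    (is "left_ideal_of UNIV ?Y")
proof -
  have 0: "0 \<in> ?Y" using assms(1) by (intro CollectI exI[of _ "1 :: ('d, 'n) sxpoly"] exI[of _ "0 :: ('d, 'n) symbol"]) simp
  have plus: "R + S \<in> ?Y" if R: "R \<in> ?Y" and S: "S \<in> ?Y" for R S
  proof -
    obtain q P q' P' where *: "q \<noteq> 0" "P \<in> N" "d_coef (to_fract q) * R = op_of P"
        "q' \<noteq> 0" "P' \<in> N" "d_coef (to_fract q') * S = op_of P'" using R S by auto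
    have "d_coef (to_fract (q * q')) * (R + S)
        = d_coef (to_fract q') * (d_coef (to_fract q) * R) + d_coef (to_fract q) * (d_coef (to_fract q') * S)"
      by (simp add: distrib_left mult.commute[of q] to_fract_mult d_coef_mult flip: mult.assoc)
         (simp add: mult.commute flip: d_coef_mult to_fract_mult)
    also have "\<dots> = op_of (coef_symbol q' * P + coef_symbol q * P')"
      by (simp add: * op_of_add op_of_coef)
    finally show ?thesis using * add coef
      by (intro CollectI exI[of _ "q * q'"] exI[of _ "coef_symbol q' * P + coef_symbol q * P'"]) simp
  qed
  have "\<forall>S\<in>?Y. R * S \<in> ?Y" for R
  proof (induction R rule: diffop_induct)
    case (coef f)
    show ?case
    proof
      fix S assume "S \<in> ?Y"
      then obtain q P where *: "q \<noteq> 0" "P \<in> N" "d_coef (to_fract q) * S = op_of P" by auto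
      obtain a b where f: "f = Fract a b" "b \<noteq> 0" by (cases f) auto
      have "to_fract b * f = to_fract a" using f by (simp add: to_fract_def eq_fract)
      then have "to_fract (b * q) * f = to_fract a * to_fract q"
        by (simp only: to_fract_mult) (metis mult.assoc mult.commute)
      moreover have "d_coef (to_fract (b * q)) * (d_coef f * S) = d_coef (to_fract (b * q) * f) * S"
        by (simp only: d_coef_mult mult.assoc)
      ultimately have "d_coef (to_fract (b * q)) * (d_coef f * S) = op_of (coef_symbol a * P)"
        by (simp only: op_of_coef d_coef_mult mult.assoc *(3))
      then show "d_coef f * S \<in> ?Y" using * f assms(3)
        by (intro CollectI exI[of _ "b * q"] exI[of _ "coef_symbol a * P"]) simp
    qed
  next
    case (partial j)
    show ?case
    proof
      fix S assume "S \<in> ?Y"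
      then obtain q P where *: "q \<noteq> 0" "P \<in> N" "d_coef (to_fract q) * S = op_of P" by auto
      let ?q' = "poly_deriv (X_var j) q"
      have "d_partial j * op_of P = d_coef (to_fract q) * (d_partial j * S) + d_coef (to_fract ?q') * S"
        by (simp add: d_partial_coef ratfun_deriv_to_fract distrib_right mult.assoc flip: *(3))
           (simp add: d_partial_coef ratfun_deriv_to_fract distrib_right flip: mult.assoc)
      then have "d_coef (to_fract q) * (d_partial j * op_of P)
          = d_coef (to_fract (q * q)) * (d_partial j * S) + d_coef (to_fract ?q') * op_of P"
        by (simp add: distrib_left to_fract_mult d_coef_mult mult.assoc flip: *(3))
           (simp add: mult.commute flip: d_coef_mult mult.assoc)
      then have "d_coef (to_fract (q * q)) * (d_partial j * S)
          = op_of (coef_symbol q * partial_shift j P + coef_symbol (- ?q') * P)"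
        by (simp add: op_of_coef op_of_partial_shift op_of_diff coef_symbol_uminus)
      then show "d_partial j * S \<in> ?Y" using * assms
        by (intro CollectI exI[of _ "q * q"] exI[of _ "coef_symbol q * partial_shift j P + coef_symbol (- ?q') * P"]) simp
    qed
  next
    case (add R R')
    then show ?case using plus by (simp only: distrib_right) blast
  next
    case (mult R R')
    then show ?case by (simp only: mult.assoc) blast
  qed
  then show ?thesis unfolding left_ideal_of_def using 0 plus by blast
qed

text \<open>The common form of \<open>initial_system\<close> and of the left ideal generated by
  \<open>hypergeom_ideal\<close>, so that both are treated at once.\<close>

definition system_ideal :: "int ^ 'n::finite ^ 'd::finite \<Rightarrow> 'n dpoly set \<Rightarrow> ('d, 'n) diffop set" where
  "system_ideal A I = left_ideal_gen UNIV (d_embed ` I \<union> euler_ops A)"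

lemma system_ideal_ideal: "left_ideal_of UNIV (system_ideal A I)"
  unfolding system_ideal_def by (rule left_ideal_of_gen_UNIV)

lemma op_of_in_system_ideal:
  assumes "P \<in> system_relations A I"
  shows "op_of P \<in> system_ideal A I"
proof -
  have gen: "d_embed ` I \<union> euler_ops A \<subseteq> system_ideal A I"
    unfolding system_ideal_def by (rule left_ideal_gen_superset)
  obtain Q R where PQR: "P = (\<Sum>i\<in>UNIV. euler_shift A i (Q i) - s_symbol i * Q i) + R" "R \<in> extend_ideal I"
    using assms by (auto simp: system_relations_def euler_relations_def)
  have "op_of (euler_shift A i (Q i) - s_symbol i * Q i) \<in> system_ideal A I" for i
  proof -
    have "op_of (euler_shift A i (Q i) - s_symbol i * Q i) = op_of (Q i) * (euler_op A i - d_coef (s_ratfun i))"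
      by (simp add: op_of_diff op_of_euler_shift op_of_s_symbol right_diff_distrib)
    moreover have "euler_op A i - d_coef (s_ratfun i) \<in> system_ideal A I"
      using gen by (auto simp: euler_ops_def)
    ultimately show ?thesis using left_ideal_mult[OF system_ideal_ideal] by metis
  qed
  moreover have "op_of R \<in> system_ideal A I"
    unfolding op_of_def using gen PQR(2)
    by (intro left_ideal_sum[OF system_ideal_ideal] left_ideal_mult[OF system_ideal_ideal])
       (auto simp: extend_ideal_def)
  ultimately show ?thesis unfolding PQR(1) op_of_add op_of_sum
    by (intro left_ideal_add[OF system_ideal_ideal] left_ideal_sum[OF system_ideal_ideal])
qed

lemma system_ideal_fractions:
  fixes A :: "int ^ 'n::finite ^ 'd::finite"
  assumes I: "left_ideal_of UNIV I" and R: "R \<in> system_ideal A I"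
  shows "\<exists>q P. q \<noteq> 0 \<and> P \<in> system_relations A I \<and> d_coef (to_fract q) * R = op_of P"
proof -
  have "system_ideal A I \<subseteq> {R. \<exists>q P. q \<noteq> 0 \<and> P \<in> system_relations A I \<and> d_coef (to_fract q) * R = op_of P}"
    unfolding system_ideal_def
  proof (rule left_ideal_gen_minimal)
    show "left_ideal_of UNIV {R. \<exists>q P. q \<noteq> 0 \<and> P \<in> system_relations A I \<and> d_coef (to_fract q) * R = op_of P}"
      by (intro left_ideal_of_fractions system_relations_0[OF I] system_relations_add[OF I]
        system_relations_coef[OF I] system_relations_partial[OF I])
    show "d_embed ` I \<union> euler_ops A \<subseteq> {R. \<exists>q P. q \<noteq> 0 \<and> P \<in> system_relations A I \<and> d_coef (to_fract q) * R = op_of P}"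
    proof (rule Un_least)
      show "d_embed ` I \<subseteq> {R. \<exists>q P. q \<noteq> 0 \<and> P \<in> system_relations A I \<and> d_coef (to_fract q) * R = op_of P}"
      proof clarify
        fix p assume p: "p \<in> I"
        then have "(dpoly_symbol p :: ('d, 'n) symbol) \<in> extend_ideal I"
          by (auto simp: extend_ideal_def dpoly_symbol_def lookup_single when_def left_ideal_zero[OF I])
        moreover have "op_of (dpoly_symbol p :: ('d, 'n) symbol) = d_embed p"
          by (simp add: dpoly_symbol_def op_of_single_dpoly)
        ultimately show "\<exists>q P. q \<noteq> 0 \<and> P \<in> system_relations A I \<and> d_coef (to_fract q) * d_embed p = op_of P"
          using system_relations_superset(2)[OF I] by (intro exI[of _ "1 :: ('d, 'n) sxpoly"] exI[of _ "dpoly_symbol p"]) auto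
      qed
      show "euler_ops A \<subseteq> {R. \<exists>q P. q \<noteq> 0 \<and> P \<in> system_relations A I \<and> d_coef (to_fract q) * R = op_of P}"
        unfolding euler_ops_def
      proof clarify
        fix i
        have "op_of (euler_shift A i 1 - s_symbol i * 1) = euler_op A i - d_coef (s_ratfun i)"
          unfolding op_of_diff op_of_euler_shift op_of_s_symbol by simp
        then show "\<exists>q P. q \<noteq> 0 \<and> P \<in> system_relations A I
            \<and> d_coef (to_fract q) * (euler_op A i - d_coef (s_ratfun i)) = op_of P"
          using system_relations_superset(1)[OF I] euler_relations_generator[of A i 1]
          by (intro exI[of _ "1 :: ('d, 'n) sxpoly"] exI[of _ "euler_shift A i 1 - s_symbol i * 1"]) auto
      qed
    qed
  qed
  then show ?thesis using R by blast
qed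

text \<open>Membership of an operator gives a multiple \<open>q\<close> times it in the image of
  \<open>system_relations\<close>; as \<open>op_of\<close> is injective, the same multiple works for
  the symbol.\<close>

lemma op_of_in_system_ideal_iff:
  assumes I: "left_ideal_of UNIV I"
  shows "op_of P \<in> system_ideal A I \<longleftrightarrow> (\<exists>q. q \<noteq> 0 \<and> coef_symbol q * P \<in> system_relations A I)"
proof
  assume "op_of P \<in> system_ideal A I"
  then obtain q P' where q: "q \<noteq> 0" "P' \<in> system_relations A I" "d_coef (to_fract q) * op_of P = op_of P'"
    using system_ideal_fractions[OF I] by blast
  then have "op_of (coef_symbol q * P - P') = 0" by (simp add: op_of_diff op_of_coef)
  then have "coef_symbol q * P = P'" by (simp add: op_of_eq_0_iff)
  then show "\<exists>q. q \<noteq> 0 \<and> coef_symbol q * P \<in> system_relations A I" using q by blast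
next
  assume "\<exists>q. q \<noteq> 0 \<and> coef_symbol q * P \<in> system_relations A I"
  then obtain q where q: "q \<noteq> 0" "coef_symbol q * P \<in> system_relations A I" by blast
  have "d_coef (inverse (to_fract q)) * op_of (coef_symbol q * P) \<in> system_ideal A I"
    using left_ideal_mult[OF system_ideal_ideal] op_of_in_system_ideal[OF q(2)] by blast
  also have "d_coef (inverse (to_fract q)) * op_of (coef_symbol q * P) = op_of P"
    using q(1) by (simp add: op_of_coef flip: mult.assoc d_coef_mult)
  finally show "op_of P \<in> system_ideal A I" .
qed


section \<open>Bases of the quotient in terms of symbols and exponents\<close>

lemma common_denominator:
  fixes c :: "'b \<Rightarrow> 'a::idom fract"
  assumes "finite F"
  shows "\<exists>q p. q \<noteq> 0 \<and> (\<forall>b\<in>F. to_fract q * c b = to_fract (p b))"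
  using assms
proof (induction F rule: finite_induct)
  case empty
  show ?case by (intro exI[of _ "1 :: 'a"]) simp
next
  case (insert x F)
  then obtain q p where q: "q \<noteq> 0" "\<forall>b\<in>F. to_fract q * c b = to_fract (p b)" by blast
  obtain a e where c: "c x = Fract a e" "e \<noteq> 0" by (cases "c x") auto
  have e: "to_fract e * c x = to_fract a" using c by (simp add: to_fract_def eq_fract)
  have "to_fract (q * e) * c b = to_fract ((if b = x then q * a else e * p b))" if "b \<in> insert x F" for b
  proof (cases "b = x")
    case True
    have "to_fract (q * e) * c x = to_fract q * (to_fract e * c x)" by (simp add: mult.assoc)
    then show ?thesis using e True by simp
  next
    case False
    have "to_fract (q * e) * c b = to_fract e * (to_fract q * c b)" by (simp add: mult_ac)
    then show ?thesis using q(2) False that by simp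
  qed
  then show ?case using q(1) c(2)
    by (intro exI[of _ "q * e"] exI[of _ "\<lambda>b. if b = x then q * a else e * p b"]) simp
qed

text \<open>Independence over \<open>C(s,x)\<close> of the classes of the
  \<open>\<partial>\<^sup>u\<close>, with denominators cleared. Exponents replace operators, which
  \<open>inj_d_monom\<close> permits.\<close>

definition independent_mod_system ::
    "int ^ 'n::finite ^ 'd::finite \<Rightarrow> 'n dpoly set \<Rightarrow> ('n \<Rightarrow>\<^sub>0 nat) set \<Rightarrow> bool" where
  "independent_mod_system A I E \<longleftrightarrow>
     (\<forall>c :: _ \<Rightarrow> ('d, 'n) sxpoly. (\<Sum>u\<in>E. coef_symbol (c u) * d_symbol u) \<in> system_relations A I
        \<longrightarrow> (\<forall>u\<in>E. c u = 0))"

definition in_span_mod_system ::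
    "int ^ 'n::finite ^ 'd::finite \<Rightarrow> 'n dpoly set \<Rightarrow> ('n \<Rightarrow>\<^sub>0 nat) set \<Rightarrow> ('n \<Rightarrow>\<^sub>0 nat) \<Rightarrow> bool" where
  "in_span_mod_system A I E v \<longleftrightarrow>
     (\<exists>(q :: ('d, 'n) sxpoly) c. q \<noteq> 0 \<and>
       coef_symbol q * d_symbol v - (\<Sum>u\<in>E. coef_symbol (c u) * d_symbol u) \<in> system_relations A I)"

lemma op_of_combination:
  "op_of (\<Sum>u\<in>E. coef_symbol (c u) * d_symbol u) = (\<Sum>u\<in>E. d_coef (to_fract (c u)) * d_monom u)"
  by (simp add: op_of_sum op_of_coef op_of_d_symbol)

lemma quot_basis_imp_independent:
  fixes A :: "int ^ 'n::finite ^ 'd::finite"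
  assumes "finite E" and basis: "quot_basis d_scale UNIV (system_ideal A I) (d_monom ` E)"
  shows "independent_mod_system A I E"
  unfolding independent_mod_system_def
proof (intro allI impI ballI)
  fix c :: "_ \<Rightarrow> ('d, 'n) sxpoly" and u
  assume rel: "(\<Sum>u\<in>E. coef_symbol (c u) * d_symbol u) \<in> system_relations A I" and u: "u \<in> E"
  have inj: "inj_on d_monom E" for E :: "('n \<Rightarrow>\<^sub>0 nat) set"
    using inj_d_monom inj_on_subset by blast
  define c' where "c' b = to_fract (c (the_inv (d_monom :: _ \<Rightarrow> ('d, 'n) diffop) b))" for b
  have "(\<Sum>b\<in>d_monom ` E. d_scale (c' b) b) = op_of (\<Sum>u\<in>E. coef_symbol (c u) * d_symbol u)"
    unfolding op_of_combination c'_def d_scale_def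
    by (simp add: sum.reindex[OF inj] the_inv_f_f[OF inj_d_monom])
  then have "(\<Sum>b\<in>d_monom ` E. d_scale (c' b) b) \<in> system_ideal A I"
    using op_of_in_system_ideal[OF rel] by simp
  then have "c' (d_monom u) = 0"
    using quot_basis_independent[OF basis] assms(1) u by blast
  then show "c u = 0" by (simp add: c'_def the_inv_f_f[OF inj_d_monom])
qed

lemma quot_basis_imp_spanning:
  fixes A :: "int ^ 'n::finite ^ 'd::finite"
  assumes I: "left_ideal_of UNIV I" and "finite E"
    and basis: "quot_basis d_scale UNIV (system_ideal A I) (d_monom ` E)"
  shows "in_span_mod_system A I E v"
proof -
  have inj: "inj_on d_monom E" for E :: "('n \<Rightarrow>\<^sub>0 nat) set"
    using inj_d_monom inj_on_subset by blast
  obtain F c where F: "F \<subseteq> d_monom ` E" "d_monom v - (\<Sum>b\<in>F. d_scale (c b) b) \<in> system_ideal A I"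
    using quot_basis_spans[OF basis, of "d_monom v"] by blast
  define c' where "c' u = (if d_monom u \<in> F then c (d_monom u) else 0)" for u
  have "(\<Sum>b\<in>F. d_scale (c b) b) = (\<Sum>b\<in>d_monom ` E. d_scale (if b \<in> F then c b else 0) b)"
    using assms(2) F(1) by (intro sum.mono_neutral_cong_left) (auto simp: d_scale_def)
  also have "\<dots> = (\<Sum>u\<in>E. d_coef (c' u) * d_monom u)"
    by (simp add: sum.reindex[OF inj] c'_def d_scale_def)
  finally have mem: "d_monom v - (\<Sum>u\<in>E. d_coef (c' u) * d_monom u) \<in> system_ideal A I"
    using F(2) by simp
  obtain q p where q: "q \<noteq> 0" "\<And>u. u \<in> E \<Longrightarrow> to_fract q * c' u = to_fract (p u)"
    using common_denominator[OF assms(2), of c'] by blast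
  define P where "P = coef_symbol q * d_symbol v - (\<Sum>u\<in>E. coef_symbol (p u) * d_symbol u)"
  have "op_of P = d_coef (to_fract q) * (d_monom v - (\<Sum>u\<in>E. d_coef (c' u) * d_monom u))"
    unfolding P_def op_of_diff op_of_combination
    by (simp add: op_of_coef op_of_d_symbol right_diff_distrib sum_distrib_left q(2)[symmetric] flip: mult.assoc d_coef_mult)
  then have "op_of P \<in> system_ideal A I" using left_ideal_mult[OF system_ideal_ideal mem] by metis
  then obtain q' where q': "q' \<noteq> 0" "coef_symbol q' * P \<in> system_relations A I"
    unfolding op_of_in_system_ideal_iff[OF I] by blast
  have "coef_symbol q' * P = coef_symbol (q' * q) * d_symbol v - (\<Sum>u\<in>E. coef_symbol (q' * p u) * d_symbol u)"
    by (simp add: P_def right_diff_distrib sum_distrib_left coef_symbol_mult mult.assoc)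
  then show ?thesis unfolding in_span_mod_system_def using q q'
    by (intro exI[of _ "q' * q"] exI[of _ "\<lambda>u. q' * p u"]) simp
qed

lemma quot_basis_of_independent_spanning:
  fixes A :: "int ^ 'n::finite ^ 'd::finite"
  assumes I: "left_ideal_of UNIV I" and fin: "finite E"
    and indep: "independent_mod_system A I E" and span: "\<And>v. in_span_mod_system A I E v"
  shows "quot_basis d_scale UNIV (system_ideal A I) (d_monom ` E)"
proof -
  have inj: "inj_on d_monom E" for E :: "('n \<Rightarrow>\<^sub>0 nat) set"
    using inj_d_monom inj_on_subset by blast
  have 1: "c b = 0" if F: "finite F" "F \<subseteq> d_monom ` E" "(\<Sum>b\<in>F. d_scale (c b) b) \<in> system_ideal A I" "b \<in> F"
    for F c b
  proof -
    define c' where "c' u = (if d_monom u \<in> F then c (d_monom u) else 0)" for u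
    have "(\<Sum>b\<in>F. d_scale (c b) b) = (\<Sum>b\<in>d_monom ` E. d_scale (if b \<in> F then c b else 0) b)"
      using fin F(2) by (intro sum.mono_neutral_cong_left) (auto simp: d_scale_def)
    also have "\<dots> = (\<Sum>u\<in>E. d_coef (c' u) * d_monom u)"
      by (simp add: sum.reindex[OF inj] c'_def d_scale_def)
    finally have mem: "(\<Sum>u\<in>E. d_coef (c' u) * d_monom u) \<in> system_ideal A I"
      using F(3) by simp
    obtain q p where q: "q \<noteq> 0" "\<And>u. u \<in> E \<Longrightarrow> to_fract q * c' u = to_fract (p u)"
      using common_denominator[OF fin, of c'] by blast
    define P where "P = (\<Sum>u\<in>E. coef_symbol (p u) * d_symbol u)"
    have "op_of P = d_coef (to_fract q) * (\<Sum>u\<in>E. d_coef (c' u) * d_monom u)"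
      unfolding P_def op_of_combination
      by (simp add: sum_distrib_left q(2)[symmetric] flip: mult.assoc d_coef_mult)
    then have "op_of P \<in> system_ideal A I" using left_ideal_mult[OF system_ideal_ideal mem] by metis
    then obtain q' where q': "q' \<noteq> 0" "coef_symbol q' * P \<in> system_relations A I"
      unfolding op_of_in_system_ideal_iff[OF I] by blast
    have "coef_symbol q' * P = (\<Sum>u\<in>E. coef_symbol (q' * p u) * d_symbol u)"
      by (simp add: P_def sum_distrib_left coef_symbol_mult mult.assoc)
    then have zero: "q' * p u = 0" if "u \<in> E" for u
      using indep[unfolded independent_mod_system_def, rule_format, of "\<lambda>u. q' * p u" u] q'(2) that by simp
    obtain u where u: "u \<in> E" "b = d_monom u" using F by blast
    have "to_fract q * c' u = 0" using zero[OF u(1)] q'(1) q(2)[OF u(1)] by simp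
    then have "c' u = 0" using q(1) by simp
    then show "c b = 0" using u F by (simp add: c'_def)
  qed
  define G where "G = {R. \<exists>c. R - (\<Sum>u\<in>E. d_coef (c u) * d_monom u) \<in> system_ideal A I}"
  have G_add: "R + S \<in> G" if R: "R \<in> G" and S: "S \<in> G" for R S
  proof -
    obtain c c' where "R - (\<Sum>u\<in>E. d_coef (c u) * d_monom u) \<in> system_ideal A I"
        "S - (\<Sum>u\<in>E. d_coef (c' u) * d_monom u) \<in> system_ideal A I"
      using R S by (auto simp: G_def)
    then have "(R - (\<Sum>u\<in>E. d_coef (c u) * d_monom u)) + (S - (\<Sum>u\<in>E. d_coef (c' u) * d_monom u)) \<in> system_ideal A I"
      by (rule left_ideal_add[OF system_ideal_ideal])
    then have "R + S - (\<Sum>u\<in>E. d_coef (c u + c' u) * d_monom u) \<in> system_ideal A I"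
      by (simp add: d_coef_add distrib_right sum.distrib algebra_simps)
    then show ?thesis unfolding G_def by (intro CollectI exI[of _ "\<lambda>u. c u + c' u"])
  qed
  have G_coef: "d_coef f * R \<in> G" if R: "R \<in> G" for R f
  proof -
    obtain c where "R - (\<Sum>u\<in>E. d_coef (c u) * d_monom u) \<in> system_ideal A I"
      using R by (auto simp: G_def)
    then have "d_coef f * (R - (\<Sum>u\<in>E. d_coef (c u) * d_monom u)) \<in> system_ideal A I"
      by (rule left_ideal_mult[OF system_ideal_ideal])
    then have "d_coef f * R - (\<Sum>u\<in>E. d_coef (f * c u) * d_monom u) \<in> system_ideal A I"
      by (simp add: d_coef_mult right_diff_distrib sum_distrib_left mult.assoc)
    then show ?thesis unfolding G_def by (intro CollectI exI[of _ "\<lambda>u. f * c u"])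
  qed
  have G_monom: "d_monom v \<in> G" for v
  proof -
    obtain q c where q: "q \<noteq> 0"
        "coef_symbol q * d_symbol v - (\<Sum>u\<in>E. coef_symbol (c u) * d_symbol u) \<in> system_relations A I"
      using span[of v] unfolding in_span_mod_system_def by blast
    have "d_coef (to_fract q) * d_monom v - (\<Sum>u\<in>E. d_coef (to_fract (c u)) * d_monom u) \<in> system_ideal A I"
      using op_of_in_system_ideal[OF q(2)] by (simp add: op_of_diff op_of_combination op_of_coef op_of_d_symbol)
    then have "d_coef (to_fract q) * d_monom v \<in> G"
      unfolding G_def by (intro CollectI exI[of _ "\<lambda>u. to_fract (c u)"])
    then have "d_coef (inverse (to_fract q)) * (d_coef (to_fract q) * d_monom v) \<in> G" by (rule G_coef)
    then show ?thesis using q(1) by (simp flip: mult.assoc d_coef_mult)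
  qed
  have "(0 :: ('d, 'n) diffop) \<in> G" using G_coef[OF G_monom, of 0] by simp
  then have G_op: "op_of P \<in> G" for P
    by (induction P rule: symbol_induct) (auto simp: op_of_add op_of_single intro: G_add G_coef G_monom)
  \<comment> \<open>For \<open>N = UNIV\<close> the left ideal of fractions contains 1, so every
    operator acquires a normally ordered form with polynomial coefficients after multiplication by a
    denominator.\<close>
  have G_UNIV: "R \<in> G" for R
  proof -
    have "left_ideal_of UNIV {R. \<exists>q P. q \<noteq> 0 \<and> P \<in> UNIV \<and> d_coef (to_fract q) * R = op_of P}"
      (is "left_ideal_of _ ?Y") by (rule left_ideal_of_fractions) auto
    moreover have "(1 :: ('d, 'n) diffop) \<in> ?Y"
      by (intro CollectI exI[of _ "1 :: ('d, 'n) sxpoly"] exI[of _ "1 :: ('d, 'n) symbol"]) simp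
    ultimately have "R * 1 \<in> ?Y" by (rule left_ideal_mult)
    then obtain q P where "q \<noteq> 0" "d_coef (to_fract q) * R = op_of P" by auto
    then have "d_coef (inverse (to_fract q)) * (d_coef (to_fract q) * R) \<in> G" using G_op G_coef by metis
    then show ?thesis using \<open>q \<noteq> 0\<close> by (simp flip: mult.assoc d_coef_mult)
  qed
  have 2: "\<exists>F c. finite F \<and> F \<subseteq> d_monom ` E \<and> R - (\<Sum>b\<in>F. d_scale (c b) b) \<in> system_ideal A I" for R
  proof -
    obtain c where c: "R - (\<Sum>u\<in>E. d_coef (c u) * d_monom u) \<in> system_ideal A I"
      using G_UNIV[of R] by (auto simp: G_def)
    have "(\<Sum>b\<in>d_monom ` E. d_scale (c (the_inv d_monom b)) b) = (\<Sum>u\<in>E. d_coef (c u) * d_monom u :: ('d, 'n) diffop)"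
      by (simp add: sum.reindex[OF inj] d_scale_def the_inv_f_f[OF inj_d_monom])
    then show ?thesis using c fin
      by (intro exI[of _ "d_monom ` E"] exI[of _ "\<lambda>b. c (the_inv d_monom b)"]) simp
  qed
  show ?thesis unfolding quot_basis_def using 1 2 by blast
qed

section \<open>The hypergeometric ideal and the left ideal it generates\<close>

lemma weyl_algebra_closed:
  "0 \<in> weyl_algebra" "P \<in> weyl_algebra \<Longrightarrow> Q \<in> weyl_algebra \<Longrightarrow> P + Q \<in> weyl_algebra"
  "P \<in> weyl_algebra \<Longrightarrow> Q \<in> weyl_algebra \<Longrightarrow> P * Q \<in> weyl_algebra"
proof -
  show 0: "0 \<in> weyl_algebra" unfolding weyl_algebra_def
    using subring_gen.diff[OF subring_gen.one subring_gen.one] by simp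
  show "P * Q \<in> weyl_algebra" if "P \<in> weyl_algebra" "Q \<in> weyl_algebra"
    using that unfolding weyl_algebra_def by (rule subring_gen.mult)
  show "P + Q \<in> weyl_algebra" if "P \<in> weyl_algebra" "Q \<in> weyl_algebra"
    using subring_gen.diff[OF that(1)[unfolded weyl_algebra_def] subring_gen.diff[OF 0[unfolded weyl_algebra_def] that(2)[unfolded weyl_algebra_def]]]
    unfolding weyl_algebra_def by simp
qed

lemma weyl_algebra_sum: "(\<And>i. i \<in> F \<Longrightarrow> f i \<in> weyl_algebra) \<Longrightarrow> sum f F \<in> weyl_algebra"
  by (induction F rule: infinite_finite_induct) (auto intro: weyl_algebra_closed)

lemma s_ratfuns_polynomial: "s_only p \<Longrightarrow> to_fract p \<in> s_ratfuns"
  unfolding s_ratfuns_def by (intro CollectI exI[of _ p] exI[of _ 1]) (simp add: s_only_def)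

lemma weyl_algebra_generators:
  "d_partial j \<in> weyl_algebra" "d_coef (x_ratfun j) \<in> weyl_algebra" "d_coef (s_ratfun i) \<in> weyl_algebra"
  "d_coef (ratfun_const c) \<in> weyl_algebra"
  unfolding weyl_algebra_def s_ratfun_def ratfun_const_def
  by (auto intro!: subring_gen.gen imageI s_ratfuns_polynomial simp: s_only_def var_poly_def lookup_single)

lemma d_monom_in_weyl_algebra: "d_monom u \<in> weyl_algebra"
proof (induction u rule: exponent_induct)
  case zero
  show ?case unfolding weyl_algebra_def by (simp add: subring_gen.one)
qed (simp only: d_monom_single_add weyl_algebra_closed weyl_algebra_generators)

text \<open>The generators lie in \<open>weyl_algebra\<close>, and a left ideal of the large ring
  meets \<open>weyl_algebra\<close> in a left ideal; so generating in two stages gives nothing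
  new.\<close>

lemma hypergeom_ideal_generates:
  "left_ideal_gen UNIV (hypergeom_ideal A) = system_ideal A (toric_ideal A)"
proof (rule antisym)
  let ?G = "d_embed ` toric_ideal A \<union> euler_ops A"
  have "?G \<subseteq> weyl_algebra"
  proof (rule Un_least)
    show "d_embed ` toric_ideal A \<subseteq> weyl_algebra" unfolding d_embed_def
      by (auto intro!: weyl_algebra_sum weyl_algebra_closed weyl_algebra_generators d_monom_in_weyl_algebra)
    have "euler_op A i - d_coef (s_ratfun i) \<in> weyl_algebra" for i
    proof -
      have "of_int k = d_coef (ratfun_const (of_int k))" for k
        unfolding ratfun_const_def by (simp add: to_fract_of_int d_coef_of_int)
      then have "euler_op A i \<in> weyl_algebra" unfolding euler_op_def
        by (metis (no_types, lifting) weyl_algebra_sum weyl_algebra_closed(3) weyl_algebra_generators)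
      then show ?thesis using weyl_algebra_generators(3)[of i] unfolding weyl_algebra_def by (rule subring_gen.diff)
    qed
    then show "euler_ops A \<subseteq> weyl_algebra" by (auto simp: euler_ops_def)
  qed
  moreover have "?G \<subseteq> system_ideal A (toric_ideal A)"
    unfolding system_ideal_def by (rule left_ideal_gen_superset)
  moreover have "left_ideal_of weyl_algebra (system_ideal A (toric_ideal A) \<inter> weyl_algebra)"
    unfolding left_ideal_of_def
    using left_ideal_zero[OF system_ideal_ideal] left_ideal_add[OF system_ideal_ideal]
      left_ideal_mult[OF system_ideal_ideal] weyl_algebra_closed by blast
  ultimately have "hypergeom_ideal A \<subseteq> system_ideal A (toric_ideal A) \<inter> weyl_algebra"
    unfolding hypergeom_ideal_def by (intro left_ideal_gen_minimal) blast+
  then show "left_ideal_gen UNIV (hypergeom_ideal A) \<subseteq> system_ideal A (toric_ideal A)"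
    by (intro left_ideal_gen_minimal system_ideal_ideal) blast
  have "?G \<subseteq> hypergeom_ideal A" unfolding hypergeom_ideal_def by (rule left_ideal_gen_superset)
  then have "?G \<subseteq> left_ideal_gen UNIV (hypergeom_ideal A)"
    using left_ideal_gen_superset by blast
  then show "system_ideal A (toric_ideal A) \<subseteq> left_ideal_gen UNIV (hypergeom_ideal A)"
    unfolding system_ideal_def by (intro left_ideal_gen_minimal left_ideal_of_gen_UNIV)
qed

section \<open>Independence passes from the initial system to the hypergeometric system\<close>

lemma symbol_sum_singles:
  "(P :: ('d, 'n) symbol) = (\<Sum>m\<in>keys P. \<Sum>u\<in>keys (lookup P m).
     single m (single u (lookup (lookup P m) u)))"
proof -
  have sum_single: "(\<Sum>u\<in>F. single m (f u)) = single m (sum f F)"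
    for m :: "('d, 'n) indet \<Rightarrow>\<^sub>0 nat" and f :: "('n \<Rightarrow>\<^sub>0 nat) \<Rightarrow> 'n dpoly" and F
    by (induction F rule: infinite_finite_induct) (simp_all add: single_add)
  show ?thesis
    unfolding sum_single poly_mapping_sum_singles[symmetric] ..
qed

lemma sfree_euler_shift:
  assumes "sfree P"
  shows "sfree (euler_shift A i P)"
proof -
  have int: "sfree (of_int k :: ('a, 'b) symbol)" for k
    by (subst single_of_int[symmetric], rule sfree_single) (simp add: s_part_def)
  have "sfree (x_symbol j :: ('a, 'b) symbol)" for j
    unfolding x_symbol_def var_poly_def
    by (intro sfree_coef_symbol sfree_single) (simp add: s_part_def lookup_single)
  moreover have "sfree (d_symbol u :: ('a, 'b) symbol)" for u
    unfolding d_symbol_def by (intro sfree_single) (simp add: s_part_def)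
  ultimately have "sfree (euler_symbol A i)"
    unfolding euler_symbol_def using int by (intro sfree_sum sfree_mult)
  then have "sfree (euler_symbol A i * P)" using assms by (rule sfree_mult)
  moreover have "sfree (grading_deriv_symbol A i P)"
    using assms by (auto simp: sfree_def in_keys_iff lookup_grading_deriv_symbol)
  ultimately show ?thesis unfolding euler_shift_def by (rule sfree_add)
qed

text \<open>The powers of \<open>s\<close> are replaced one monomial at a time; gradedness keeps
  each result inside the extended ideal.\<close>

lemma extend_ideal_reduce:
  fixes A :: "int ^ 'n::finite ^ 'd::finite"
  assumes I: "graded_ideal A I" and R: "R \<in> extend_ideal I"
  shows "\<exists>R'\<in>extend_ideal I. sfree R' \<and> R - R' \<in> (euler_relations A :: ('d, 'n) symbol set)"
proof -
  have I': "left_ideal_of UNIV I" using I by (simp add: graded_ideal_def)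
  note ext = extend_ideal_ideal[OF I', where ?'d = 'd]
  have "\<exists>R'\<in>extend_ideal I \<inter> Collect sfree. s_monom (s_part m) * single (xexp (x_part m)) (lookup R m) - R' \<in> euler_relations A" for m
  proof -
    have "single (xexp (x_part m)) (lookup R m) \<in> extend_ideal I \<inter> Collect sfree"
      using R by (auto simp: extend_ideal_def lookup_single when_def left_ideal_zero[OF I'] intro: sfree_single)
    then show ?thesis
      using s_monom_reduce[of "\<lambda>_. extend_ideal I \<inter> Collect sfree" A] extend_ideal_euler_shift[OF I] sfree_euler_shift
      by (metis (no_types, lifting) IntE IntI mem_Collect_eq)
  qed
  moreover have "s_monom (s_part m) * single (xexp (x_part m)) p = single m p" for m p
    by (simp add: s_monom_def coef_symbol_single mult_single flip: indet_exp_split)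
  ultimately have "\<forall>m. \<exists>R'. R' \<in> extend_ideal I \<inter> Collect sfree
      \<and> single m (lookup R m) - R' \<in> euler_relations A" by metis
  then obtain R' where R': "\<And>m. R' m \<in> extend_ideal I" "\<And>m. sfree (R' m)"
      "\<And>m. single m (lookup R m) - R' m \<in> euler_relations A"
    by (auto dest!: choice)
  have sum_rel: "sum f F \<in> euler_relations A" if "\<And>m. f m \<in> euler_relations A" for f :: "_ \<Rightarrow> ('d, 'n) symbol" and F
    using that by (induction F rule: infinite_finite_induct) (auto intro: euler_relations_0 euler_relations_add)
  let ?R = "\<Sum>m\<in>keys R. R' m"
  have "R - ?R = (\<Sum>m\<in>keys R. single m (lookup R m) - R' m)"
    by (subst poly_mapping_sum_singles[of R]) (simp add: sum_subtractf)
  then have "R - ?R \<in> euler_relations A" using sum_rel[OF R'(3)] by simp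
  moreover have "?R \<in> extend_ideal I" using R'(1) by (intro left_ideal_sum[OF ext])
  moreover have "sfree ?R" using R'(2) by (rule sfree_sum)
  ultimately show ?thesis by blast
qed

text \<open>Subtract an \<open>s\<close>-free representative of the part coming from
  \<open>I\<close>; the difference is an \<open>s\<close>-free Euler relation, hence 0. So
  \<open>C[x] \<otimes> C[\<partial>]/I\<close> embeds in the module of the system, and ranks over
  \<open>C[x]\<close> can be counted by standard monomials.\<close>

lemma sfree_system_relation:
  fixes A :: "int ^ 'n::finite ^ 'd::finite"
  assumes I: "graded_ideal A I" and P: "P \<in> system_relations A I" "sfree P"
  shows "P \<in> extend_ideal I"
proof -
  obtain Q R where P_eq: "P = Q + R" "Q \<in> euler_relations A" "R \<in> extend_ideal I"
    using P(1) by (auto simp: system_relations_def)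
  obtain R' where R': "R' \<in> extend_ideal I" "sfree R'" "R - R' \<in> euler_relations A"
    using extend_ideal_reduce[OF I P_eq(3)] by blast
  have "P - R' = Q + (R - R')" using P_eq(1) by simp
  then have "P - R' \<in> euler_relations A" using euler_relations_add[OF P_eq(2) R'(3)] by metis
  then have "P - R' = 0" by (rule sfree_euler_relation_eq_0) (rule sfree_diff[OF P(2) R'(2)])
  then show ?thesis using R'(1) by simp
qed

section \<open>Weights and initial forms\<close>

definition xweight :: "int ^ 'n::finite \<Rightarrow> (('d, 'n) indet \<Rightarrow>\<^sub>0 nat) \<Rightarrow> int" where
  "xweight w m = (\<Sum>j\<in>UNIV. w $ j * int (lookup m (X_var j)))"

text \<open>The weight vector \<open>(-w, w)\<close> on the variables \<open>(x, \<partial>)\<close>, for which the Euler operators have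
  weight \<open>0\<close>.\<close>

definition weight_homogeneous :: "int ^ 'n::finite \<Rightarrow> int \<Rightarrow> ('d, 'n) symbol \<Rightarrow> bool" where
  "weight_homogeneous w l P \<longleftrightarrow> (\<forall>m\<in>keys P.
     \<forall>u\<in>keys (lookup P m). weight w u - xweight w m = l)"

lemma weight_homogeneous_iff:
  "weight_homogeneous w l P \<longleftrightarrow> (\<forall>m u. lookup (lookup P m) u \<noteq> 0 \<longrightarrow> weight w u - xweight w m = l)"
  unfolding weight_homogeneous_def by (metis in_keys_iff lookup_zero)

lemma weight_homogeneous_add:
  "weight_homogeneous w l P \<Longrightarrow> weight_homogeneous w l Q \<Longrightarrow> weight_homogeneous w l (P + Q)"
  unfolding weight_homogeneous_iff by (simp add: lookup_add) (metis add_cancel_right_left)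

lemma weight_homogeneous_sum:
  "(\<And>i. i \<in> F \<Longrightarrow> weight_homogeneous w l (f i)) \<Longrightarrow> weight_homogeneous w l (sum f F)"
proof (induction F rule: infinite_finite_induct)
  case (insert x F)
  then show ?case by (simp add: weight_homogeneous_add)
qed (simp_all add: weight_homogeneous_def)

lemma weight_homogeneous_single:
  "weight w u - xweight w m = l \<Longrightarrow> weight_homogeneous w l (single m (single u c))"
  by (auto simp: weight_homogeneous_iff lookup_single when_def split: if_splits)

lemma weight_add: "weight w (u + v) = weight w u + weight w v"
  by (simp add: weight_def lookup_add distrib_left sum.distrib)

lemma xweight_add: "xweight w (m + m') = xweight w m + xweight w m'"
  by (simp add: xweight_def lookup_add distrib_left sum.distrib)

lemma weight_single: "weight w (single j 1) = w $ j"
proof -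
  have "weight w (single j 1) = (\<Sum>l\<in>UNIV. if l = j then w $ j else 0)"
    unfolding weight_def by (intro sum.cong) (auto simp: lookup_single)
  then show ?thesis by simp
qed

lemma xweight_single: "xweight w (single (X_var j) 1) = w $ j"
proof -
  have "xweight w (single (X_var j) 1) = (\<Sum>l\<in>UNIV. if l = j then w $ j else 0)"
    unfolding xweight_def by (intro sum.cong) (auto simp: lookup_single)
  then show ?thesis by simp
qed

lemma weight_homogeneous_euler_shift:
  fixes A :: "int ^ 'n::finite ^ 'd::finite"
  assumes "weight_homogeneous w l P"
  shows "weight_homogeneous w l (euler_shift A i P)"
proof -
  have single: "weight_homogeneous w l (euler_shift A i (single m (single u c)))"
    if "weight w u - xweight w m = l" for m u c
    unfolding euler_shift_single using that
    by (intro weight_homogeneous_add weight_homogeneous_sum weight_homogeneous_single)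
       (simp_all add: weight_add xweight_add weight_single[simplified] xweight_single[simplified])
  have "weight_homogeneous w l (\<Sum>m\<in>keys P. \<Sum>u\<in>keys (lookup P m).
      euler_shift A i (single m (single u (lookup (lookup P m) u))))"
  proof (intro weight_homogeneous_sum)
    fix m u assume "m \<in> keys P" "u \<in> keys (lookup P m)"
    then have "weight w u - xweight w m = l" using assms by (simp add: weight_homogeneous_def)
    then show "weight_homogeneous w l (euler_shift A i (single m
        (single u (lookup (lookup P m) u))))" by (rule single)
  qed
  then show ?thesis
    by (subst symbol_sum_singles[of P]) (simp add: euler_shift_sum)
qed

lemma lookup_initial_form:
  "lookup (initial_form w p) u
    = (if u \<in> keys p \<and> (\<forall>v\<in>keys p. weight w v \<le> weight w u)
       then lookup p u else 0)"
proof -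
  have "finite {u. u \<in> keys p \<and> (\<forall>v\<in>keys p. weight w v \<le> weight w u)}" by simp
  then show ?thesis
    unfolding initial_form_def by (simp add: lookup_sum lookup_single when_def sum.delta')
qed

lemma initial_form_eq:
  assumes "a \<noteq> 0" and "\<And>u. u \<in> keys a \<Longrightarrow> weight w u = l"
    and "\<And>u. u \<in> keys b \<Longrightarrow> weight w u < l"
  shows "initial_form w (a + b) = a"
proof (rule poly_mapping_eqI)
  fix u
  have "\<exists>u. lookup a u \<noteq> 0" using assms(1) by (metis lookup_zero poly_mapping_eqI)
  then obtain u0 where u0: "u0 \<in> keys a" by (auto simp: in_keys_iff)
  have b0: "lookup b u = 0" if "weight w u = l" for u
    using assms(3)[of u] that by (auto simp: in_keys_iff)
  have a0: "lookup a u = 0" if "weight w u \<noteq> l" for u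
    using assms(2)[of u] that by (auto simp: in_keys_iff)
  have k: "u0 \<in> keys (a + b)" using u0 b0 assms(2) by (simp add: in_keys_iff lookup_add)
  have le: "weight w v \<le> l" if "v \<in> keys (a + b)" for v
    using that keys_add[of a b] assms(2)[of v] assms(3)[of v] by fastforce
  show "lookup (initial_form w (a + b)) u = lookup a u"
  proof (cases "weight w u = l")
    case True
    then show ?thesis using le b0 by (auto simp: lookup_initial_form lookup_add in_keys_iff)
  next
    case False
    have "\<not> (u \<in> keys (a + b) \<and> (\<forall>v\<in>keys (a + b). weight w v \<le> weight w u))"
      using le[of u] False k assms(2)[OF u0] by fastforce
    then show ?thesis unfolding lookup_initial_form a0[OF False] by auto
  qed
qed

text \<open>The relation has to become \<open>s\<close>-free before initial forms are taken, since
  only then does each of its coefficients lie in \<open>I\<close>. The reduction is carried out term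
  by term, so that the part of top weight can still be traced back to the original
  coefficients.\<close>

lemma independent_initial_imp_independent:
  fixes A :: "int ^ 'n::finite ^ 'd::finite"
  assumes I: "graded_ideal A I" and fin: "finite E"
    and indep: "independent_mod_system A (initial_ideal w I) E"
  shows "independent_mod_system A I E"
proof (rule ccontr)
  assume "\<not> independent_mod_system A I E"
  then obtain c :: "_ \<Rightarrow> ('d, 'n) sxpoly" and u0 where
    rel: "(\<Sum>u\<in>E. coef_symbol (c u) * d_symbol u) \<in> system_relations A I" and u0: "u0 \<in> E" "c u0 \<noteq> 0"
    unfolding independent_mod_system_def by blast
  have M: "left_ideal_of UNIV (initial_ideal w I)"
    unfolding initial_ideal_def by (rule left_ideal_of_gen_UNIV)
  have I': "left_ideal_of UNIV I" using I by (simp add: graded_ideal_def)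
  define S where "S = (SIGMA u:E. keys (c u))"
  define wt where "wt = (\<lambda>(u, m :: ('d, 'n) indet \<Rightarrow>\<^sub>0 nat). weight w u - xweight w m)"
  define h where "h = (\<lambda>(u, m). single m (single u (lookup (c u) m)) :: ('d, 'n) symbol)"
  have finS: "finite S" using fin by (simp add: S_def)
  have expand: "coef_symbol e * d_symbol u = (\<Sum>m\<in>keys e. single m (single u (lookup e m)))"
    for e :: "('d, 'n) sxpoly" and u
    by (subst poly_mapping_sum_singles[of e])
       (simp add: coef_symbol_sum coef_symbol_single d_symbol_def sum_distrib_right mult_single)
  have h_sum: "(\<Sum>u\<in>E. coef_symbol (c u) * d_symbol u) = (\<Sum>t\<in>S. h t)"
    unfolding expand S_def h_def using fin by (subst sum.Sigma) auto
  \<comment> \<open>The reduction preserves the weight of a term: \<open>s\<close> counts with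
    weight 0, and so do the Euler operators replacing it.\<close>
  have "\<forall>t. \<exists>P'. sfree P' \<and> weight_homogeneous w (wt t) P' \<and> h t - P' \<in> euler_relations A"
  proof
    fix t :: "('n \<Rightarrow>\<^sub>0 nat) \<times> (('d, 'n) indet \<Rightarrow>\<^sub>0 nat)"
    obtain u m where t: "t = (u, m)" by (cases t)
    define P0 :: "('d, 'n) symbol" where "P0 = single (xexp (x_part m)) (single u (lookup (c u) m))"
    have "h t = s_monom (s_part m) * P0"
      by (simp add: h_def t P0_def s_monom_def coef_symbol_single mult_single flip: indet_exp_split)
    moreover have "xweight w (xexp (x_part m) :: ('d, 'n) indet \<Rightarrow>\<^sub>0 nat) = xweight w m" by (simp add: xweight_def)
    then have "P0 \<in> {P'. sfree P' \<and> weight_homogeneous w (wt t) P'}"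
      unfolding P0_def by (auto intro!: sfree_single weight_homogeneous_single simp: wt_def t)
    moreover have "\<exists>P'\<in>{P'. sfree P' \<and> weight_homogeneous w (wt t) P'}. s_monom (s_part m) * P0 - P' \<in> euler_relations A"
      if "P0 \<in> {P'. sfree P' \<and> weight_homogeneous w (wt t) P'}"
      by (rule s_monom_reduce[of "\<lambda>_. {P'. sfree P' \<and> weight_homogeneous w (wt t) P'}" A P0 0, OF _ that])
         (auto intro: sfree_euler_shift weight_homogeneous_euler_shift)
    ultimately have "\<exists>P'\<in>{P'. sfree P' \<and> weight_homogeneous w (wt t) P'}. h t - P' \<in> euler_relations A"
      by metis
    then show "\<exists>P'. sfree P' \<and> weight_homogeneous w (wt t) P' \<and> h t - P' \<in> euler_relations A" by blast
  qed
  then obtain p where p: "\<And>t. sfree (p t)" "\<And>t. weight_homogeneous w (wt t) (p t)" "\<And>t. h t - p t \<in> euler_relations A"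
    by (metis (no_types))
  have rel_diff: "(\<Sum>t\<in>T. h t) - (\<Sum>t\<in>T. p t) \<in> euler_relations A" for T
    unfolding sum_subtractf[symmetric] using p(3)
    by (induction T rule: infinite_finite_induct) (auto intro: euler_relations_0 euler_relations_add)
  have "(\<Sum>t\<in>S. p t) \<in> extend_ideal I"
  proof (rule sfree_system_relation[OF I])
    have "(\<Sum>t\<in>S. h t) - ((\<Sum>t\<in>S. h t) - (\<Sum>t\<in>S. p t)) \<in> system_relations A I"
      by (rule system_relations_diff[OF I' rel[unfolded h_sum] subsetD[OF system_relations_superset(1)[OF I'] rel_diff]])
    then show "(\<Sum>t\<in>S. p t) \<in> system_relations A I" by simp
  qed (rule sfree_sum, rule p(1))
  note sum_in = this
  obtain m0 where "m0 \<in> keys (c u0)" using u0(2)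
    by (metis all_not_in_conv keys_zero lookup_zero poly_mapping_eqI in_keys_iff)
  then have "(u0, m0) \<in> S" using u0(1) by (simp add: S_def)
  then have "S \<noteq> {}" by blast
  define l where "l = Max (wt ` S)"
  define T where "T = {t\<in>S. wt t = l}"
  have "l \<in> wt ` S" unfolding l_def using finS \<open>S \<noteq> {}\<close> by (intro Max_in) auto
  then obtain t1 where t1: "t1 \<in> T" by (auto simp: T_def)
  have lt: "wt t < l" if "t \<in> S - T" for t
    using that finS unfolding T_def l_def by (auto intro: le_neq_trans)
  have "(\<Sum>t\<in>T. p t) \<in> extend_ideal (initial_ideal w I)"
    unfolding extend_ideal_def
  proof (intro CollectI allI)
    fix m
    \<comment> \<open>At a fixed monomial \<open>m\<close>, all exponents in \<open>a\<close> have
      weight \<open>l + xweight w m\<close> and those in \<open>b\<close> a smaller one. So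
      \<open>a\<close> is 0, by cancellation, or the initial form of \<open>a + b\<close>.\<close>
    define a where "a = lookup (\<Sum>t\<in>T. p t) m"
    define b where "b = lookup (\<Sum>t\<in>S - T. p t) m"
    have "(\<Sum>t\<in>S. p t) = (\<Sum>t\<in>T. p t) + (\<Sum>t\<in>S - T. p t)"
      using finS by (intro sum.subset_diff[THEN trans, OF _ _ add.commute]) (auto simp: T_def)
    then have "a + b = lookup (\<Sum>t\<in>S. p t) m" by (simp add: a_def b_def lookup_add)
    then have ab: "a + b \<in> I" using sum_in by (simp add: extend_ideal_def)
    show "lookup (\<Sum>t\<in>T. p t) m \<in> initial_ideal w I"
    proof (cases "a = 0")
      case True
      then show ?thesis using left_ideal_zero[OF M] by (simp add: a_def)
    next
      case False
      have "initial_form w (a + b) = a"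
      proof (rule initial_form_eq[OF False])
        fix u assume "u \<in> keys a"
        moreover have "weight_homogeneous w l (\<Sum>t\<in>T. p t)"
          using p(2) by (intro weight_homogeneous_sum) (auto simp: T_def)
        ultimately have "weight w u - xweight w m = l"
          unfolding weight_homogeneous_iff a_def in_keys_iff by blast
        then show "weight w u = l + xweight w m" by simp
      next
        fix u assume "u \<in> keys b"
        then obtain t where t: "t \<in> S - T" "lookup (lookup (p t) m) u \<noteq> 0"
          by (auto simp: b_def in_keys_iff lookup_sum elim: sum.not_neutral_contains_not_neutral)
        then have "weight w u - xweight w m = wt t" using p(2)[of t] by (auto simp: weight_homogeneous_iff)
        then show "weight w u < l + xweight w m" using lt[OF t(1)] by simp
      qed
      then have "a \<in> initial_form w ` I" using ab by (metis image_eqI)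
      then show ?thesis unfolding initial_ideal_def a_def[symmetric]
        using left_ideal_gen_superset by blast
    qed
  qed
  then have "(\<Sum>t\<in>T. h t) - (\<Sum>t\<in>T. p t) + (\<Sum>t\<in>T. p t) \<in> system_relations A (initial_ideal w I)"
    using rel_diff[of T] system_relations_superset[OF M] by (intro system_relations_add[OF M]) auto
  then have hT: "(\<Sum>t\<in>T. h t) \<in> system_relations A (initial_ideal w I)" by simp
  \<comment> \<open>The part of \<open>c u\<close> contributing to the top weight; the term
    \<open>t1\<close> shows that it is nonzero for some \<open>u\<close>.\<close>
  define c0 where "c0 u = (\<Sum>m\<in>{m\<in>keys (c u). wt (u, m) = l}. single m (lookup (c u) m))" for u
  have "T = (SIGMA u:E. {m\<in>keys (c u). wt (u, m) = l})" by (auto simp: T_def S_def)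
  then have "(\<Sum>t\<in>T. h t) = (\<Sum>u\<in>E. \<Sum>m\<in>{m\<in>keys (c u). wt (u, m) = l}. h (u, m))"
    using fin by (simp add: sum.Sigma)
  also have "\<dots> = (\<Sum>u\<in>E. coef_symbol (c0 u) * d_symbol u)"
    by (simp add: c0_def h_def coef_symbol_sum coef_symbol_single d_symbol_def sum_distrib_right mult_single)
  finally have c0: "c0 u = 0" if "u \<in> E" for u
    using indep[unfolded independent_mod_system_def, rule_format, of c0 u] hT that by simp
  obtain u m where um: "t1 = (u, m)" by (cases t1)
  then have *: "u \<in> E" "m \<in> keys (c u)" "wt (u, m) = l" using t1 by (auto simp: T_def S_def)
  have "lookup (c0 u) m = lookup (c u) m"
    using * by (simp add: c0_def lookup_sum lookup_single when_def sum.delta')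
  then show False using c0[OF *(1)] *(2) by (simp add: in_keys_iff)
qed

section \<open>Independent monomials and the degree of the toric ideal\<close>

text \<open>Only the degree in \<open>\<partial>\<close> is bounded, not the degree in
  \<open>x\<close>, because all counts are ranks over \<open>C[x]\<close>.\<close>

definition bounded_symbols :: "nat \<Rightarrow> ('d::finite, 'n::finite) symbol set" where
  "bounded_symbols t = {P. sfree P \<and> (\<forall>m. \<forall>u\<in>keys (lookup P m). tdeg u \<le> t)}"

lemma bounded_symbols_iff:
  "P \<in> bounded_symbols t \<longleftrightarrow> sfree P \<and> (\<forall>m u. lookup (lookup P m) u \<noteq> 0 \<longrightarrow> tdeg u \<le> t)"
  by (auto simp: bounded_symbols_def in_keys_iff)

lemma bounded_symbols_add: "P \<in> bounded_symbols t \<Longrightarrow> Q \<in> bounded_symbols t \<Longrightarrow> P + Q \<in> bounded_symbols t"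
  unfolding bounded_symbols_iff by (simp add: sfree_add lookup_add) (metis add_cancel_right_left)

lemma bounded_symbols_sum: "(\<And>i. i \<in> F \<Longrightarrow> f i \<in> bounded_symbols t) \<Longrightarrow> sum f F \<in> bounded_symbols t"
proof (induction F rule: infinite_finite_induct)
  case (insert x F)
  then show ?case by (simp add: bounded_symbols_add)
qed (simp_all add: bounded_symbols_def)

lemma bounded_symbols_single:
  "s_part m = 0 \<Longrightarrow> tdeg u \<le> t \<Longrightarrow> single m (single u c) \<in> bounded_symbols t"
  by (auto simp: bounded_symbols_iff lookup_single when_def sfree_single split: if_splits)

lemma bounded_symbols_euler_shift:
  assumes P: "P \<in> bounded_symbols t"
  shows "euler_shift A i P \<in> bounded_symbols (Suc t)"
proof -
  have "(\<Sum>m\<in>keys P. \<Sum>u\<in>keys (lookup P m).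
      euler_shift A i (single m (single u (lookup (lookup P m) u))))
      \<in> bounded_symbols (Suc t)"
  proof (intro bounded_symbols_sum)
    fix m u assume m: "m \<in> keys P" and u: "u \<in> keys (lookup P m)"
    have "s_part m = 0" using m P by (simp add: bounded_symbols_def sfree_def)
    moreover have "s_part (single (X_var j) 1 + m) = s_part m" for j
      by (rule poly_mapping_eqI) (simp add: lookup_add lookup_single)
    moreover have "tdeg u \<le> t" using u P by (auto simp: bounded_symbols_def)
    ultimately show "euler_shift A i (single m (single u (lookup (lookup P m) u)))
        \<in> bounded_symbols (Suc t)"
      unfolding euler_shift_single
      by (intro bounded_symbols_add bounded_symbols_sum bounded_symbols_single) (simp_all add: tdeg_add)
  qed
  then show ?thesis by (subst symbol_sum_singles[of P]) (simp add: euler_shift_sum)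
qed

lemma reduce_bounded_symbol:
  fixes P :: "('d::finite, 'n::finite) symbol"
  assumes I: "left_ideal_of UNIV I" and P: "P \<in> bounded_symbols t"
  shows "\<exists>n. (\<forall>b. sfree (n b)) \<and> P - (\<Sum>b\<in>standard_exps I t. coef_symbol (n b) * d_symbol b) \<in> extend_ideal I"
proof -
  note ext = extend_ideal_ideal[OF I, where ?'d = 'd]
  define G where "G = {P :: ('d, 'n) symbol. \<exists>n. (\<forall>b. sfree (n b)) \<and>
      P - (\<Sum>b\<in>standard_exps I t. coef_symbol (n b) * d_symbol b) \<in> extend_ideal I}"
  have add: "P + Q \<in> G" if PQ: "P \<in> G" "Q \<in> G" for P Q
  proof -
    obtain n n' where n: "\<forall>b. sfree (n b)" "P - (\<Sum>b\<in>standard_exps I t. coef_symbol (n b) * d_symbol b) \<in> extend_ideal I"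
        and n': "\<forall>b. sfree (n' b)" "Q - (\<Sum>b\<in>standard_exps I t. coef_symbol (n' b) * d_symbol b) \<in> extend_ideal I"
      using PQ by (auto simp: G_def)
    have "P + Q - (\<Sum>b\<in>standard_exps I t. coef_symbol (n b + n' b) * d_symbol b) \<in> extend_ideal I"
      using left_ideal_add[OF ext n(2) n'(2)]
      by (simp add: coef_symbol_add distrib_right sum.distrib algebra_simps)
    then show ?thesis using n(1) n'(1) unfolding G_def
      by (intro CollectI exI[of _ "\<lambda>b. n b + n' b"]) (simp add: sfree_add)
  qed
  have zero: "0 \<in> G" unfolding G_def
    by (intro CollectI exI[of _ "\<lambda>_. 0"]) (simp add: left_ideal_zero[OF ext])
  have sum: "sum f F \<in> G" if "\<And>i. i \<in> F \<Longrightarrow> f i \<in> G" for f :: "'x \<Rightarrow> ('d, 'n) symbol" and F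
    using that by (induction F rule: infinite_finite_induct) (auto intro: add zero)
  have single: "single m (single u c) \<in> G" if "s_part m = 0" "tdeg u \<le> t" for m u c
  proof -
    obtain r where r: "keys r \<subseteq> standard_exps I (tdeg u)" "single u 1 - r \<in> I"
      using reduce_to_standard[OF I] by blast
    have sub: "keys r \<subseteq> standard_exps I t" using r(1) that(2) by (auto simp: standard_exps_def)
    define n where "n b = (single m (c * lookup r b) :: ('d, 'n) sxpoly)" for b
    have "(\<Sum>b\<in>standard_exps I t. coef_symbol (n b) * d_symbol b)
        = (\<Sum>b\<in>standard_exps I t. single m (single b (c * lookup r b)))"
      by (simp add: n_def coef_symbol_single d_symbol_def mult_single)
    also have "\<dots> = (\<Sum>b\<in>keys r. single m (single b (c * lookup r b)))"
      using sub finite_standard_exps by (intro sum.mono_neutral_right) (auto simp: in_keys_iff)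
    also have "\<dots> = single m (const_poly c * (\<Sum>b\<in>keys r. single b (lookup r b)))"
    proof -
      have "(\<Sum>b\<in>F. single m (f b)) = single m (sum f F)" for f :: "_ \<Rightarrow> 'n dpoly" and F
        by (induction F rule: infinite_finite_induct) (simp_all add: single_add)
      then show ?thesis by (simp add: sum_distrib_left mult_single)
    qed
    finally have eq: "(\<Sum>b\<in>standard_exps I t. coef_symbol (n b) * d_symbol b) = single m (const_poly c * r)"
      by (simp flip: poly_mapping_sum_singles)
    have "const_poly c * (single u 1 - r) \<in> I" by (rule left_ideal_mult[OF I r(2)])
    then have "single m (const_poly c * (single u 1 - r)) \<in> (extend_ideal I :: ('d, 'n) symbol set)"
      by (simp add: extend_ideal_def lookup_single when_def left_ideal_zero[OF I])
    then have "single m (single u c) - (\<Sum>b\<in>standard_exps I t. coef_symbol (n b) * d_symbol b)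
        \<in> extend_ideal I"
      unfolding eq by (simp add: right_diff_distrib mult_single single_diff)
    then show ?thesis unfolding G_def using that(1) by (intro CollectI exI[of _ n]) (simp add: n_def sfree_single)
  qed
  have "P \<in> G"
  proof (subst symbol_sum_singles[of P], intro sum single)
    fix m u assume "m \<in> keys P" "u \<in> keys (lookup P m)"
    then show "s_part m = 0" "tdeg u \<le> t" using P by (auto simp: bounded_symbols_def sfree_def)
  qed
  then show ?thesis by (simp add: G_def)
qed

text \<open>Independence of the \<open>\<partial>\<^sup>u\<close> over \<open>C(s,x)\<close> makes
  all \<open>s\<^sup>a \<partial>\<^sup>u\<close> with \<open>tdeg a \<le> m\<close> independent
  over \<open>C[x]\<close>. Each reduces to an \<open>s\<close>-free symbol of degree at most
  \<open>m + k\<close> in \<open>\<partial>\<close>, and these have rank at most the right-hand side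
  modulo the system.\<close>

lemma independent_card_le:
  fixes A :: "int ^ 'n::finite ^ 'd::finite"
  assumes I: "graded_ideal A I" and fin: "finite E" and indep: "independent_mod_system A I E"
    and k: "\<And>u. u \<in> E \<Longrightarrow> tdeg u \<le> k"
  shows "card E * ((m + CARD('d)) choose m) \<le> card (standard_exps I (m + k))"
proof (rule ccontr)
  assume "\<not> ?thesis"
  moreover define S where "S = {a :: 'd \<Rightarrow>\<^sub>0 nat. tdeg a \<le> m}"
  ultimately have lt: "card (standard_exps I (m + k)) < card (E \<times> S)"
    by (simp add: card_cartesian_product card_tdeg_le)
  have I': "left_ideal_of UNIV I" using I by (simp add: graded_ideal_def)
  have finS: "finite S" unfolding S_def by (rule finite_tdeg_le)
  have "\<forall>t\<in>E \<times> S. \<exists>n. (\<forall>b. sfree (n b)) \<and> s_monom (snd t) * d_symbol (fst t)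
      - (\<Sum>b\<in>standard_exps I (m + k). coef_symbol (n b) * d_symbol b) \<in> (system_relations A I :: ('d, 'n) symbol set)"
  proof
    fix t assume t: "t \<in> E \<times> S"
    obtain u a where ua: "t = (u, a)" "u \<in> E" "tdeg a \<le> m" using t by (cases t) (auto simp: S_def)
    have "(d_symbol u :: ('d, 'n) symbol) \<in> bounded_symbols k"
      unfolding d_symbol_def using k[OF ua(2)] by (intro bounded_symbols_single) (auto intro: poly_mapping_eqI)
    then have "\<exists>P'\<in>bounded_symbols (k + tdeg a). s_monom a * d_symbol u - P' \<in> (euler_relations A :: ('d, 'n) symbol set)"
      by (intro s_monom_reduce) (auto intro: bounded_symbols_euler_shift)
    then obtain P' :: "('d, 'n) symbol" where P': "P' \<in> bounded_symbols (k + tdeg a)"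
        "s_monom a * d_symbol u - P' \<in> euler_relations A" by blast
    have "P' \<in> bounded_symbols (m + k)" using P'(1) ua(3) by (force simp: bounded_symbols_def)
    then obtain n where n: "\<forall>b. sfree (n b)"
        "P' - (\<Sum>b\<in>standard_exps I (m + k). coef_symbol (n b) * d_symbol b) \<in> extend_ideal I"
      using reduce_bounded_symbol[OF I'] by blast
    have "(s_monom a * d_symbol u - P') + (P' - (\<Sum>b\<in>standard_exps I (m + k). coef_symbol (n b) * d_symbol b)) \<in> system_relations A I"
      using P'(2) n(2) system_relations_superset[OF I'] by (intro system_relations_add[OF I']) auto
    then have "s_monom a * d_symbol u - (\<Sum>b\<in>standard_exps I (m + k). coef_symbol (n b) * d_symbol b) \<in> system_relations A I"
      by simp
    then show "\<exists>n. (\<forall>b. sfree (n b)) \<and> s_monom (snd t) * d_symbol (fst t)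
      - (\<Sum>b\<in>standard_exps I (m + k). coef_symbol (n b) * d_symbol b) \<in> (system_relations A I :: ('d, 'n) symbol set)"
      using n(1) ua(1) by auto
  qed
  from bchoice[OF this] obtain n where "\<forall>t\<in>E \<times> S. (\<forall>b. sfree (n t b)) \<and> s_monom (snd t) * d_symbol (fst t)
      - (\<Sum>b\<in>standard_exps I (m + k). coef_symbol (n t b) * d_symbol b) \<in> (system_relations A I :: ('d, 'n) symbol set)" ..
  then have n: "\<And>t b. t \<in> E \<times> S \<Longrightarrow> sfree (n t b)"
      "\<And>t. t \<in> E \<times> S \<Longrightarrow> s_monom (snd t) * d_symbol (fst t)
        - (\<Sum>b\<in>standard_exps I (m + k). coef_symbol (n t b) * d_symbol b) \<in> (system_relations A I :: ('d, 'n) symbol set)"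
    by blast+
  \<comment> \<open>The solution is sought among \<open>s\<close>-free polynomials: only then can
    its entries be recovered from the sums of the \<open>s\<^sup>a c(u,a)\<close>.\<close>
  have "\<exists>c. (\<forall>t. c t \<in> Collect sfree) \<and> (\<exists>t\<in>E \<times> S. c t \<noteq> 0)
      \<and> (\<forall>b\<in>standard_exps I (m + k). (\<Sum>t\<in>E \<times> S. c t * n t b) = 0)"
    using lt fin finS finite_standard_exps n(1)
    by (intro homogeneous_system_nontrivial) (auto intro: sfree_diff sfree_mult)
  then obtain c where c: "\<And>t. sfree (c t)" "\<exists>t\<in>E \<times> S. c t \<noteq> 0"
      "\<And>b. b \<in> standard_exps I (m + k) \<Longrightarrow> (\<Sum>t\<in>E \<times> S. c t * n t b) = 0" by auto
  have "(\<Sum>t\<in>E \<times> S. coef_symbol (c t) * (s_monom (snd t) * d_symbol (fst t)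
        - (\<Sum>b\<in>standard_exps I (m + k). coef_symbol (n t b) * d_symbol b))) \<in> system_relations A I"
    using n(2) by (intro system_relations_sum[OF I'] system_relations_coef[OF I'])
  also have "(\<Sum>t\<in>E \<times> S. coef_symbol (c t) * (s_monom (snd t) * d_symbol (fst t)
        - (\<Sum>b\<in>standard_exps I (m + k). coef_symbol (n t b) * d_symbol b)))
      = (\<Sum>t\<in>E \<times> S. coef_symbol (c t) * s_monom (snd t) * d_symbol (fst t))
        - (\<Sum>b\<in>standard_exps I (m + k). coef_symbol (\<Sum>t\<in>E \<times> S. c t * n t b) * d_symbol b)"
  proof -
    have "(\<Sum>t\<in>E \<times> S. coef_symbol (c t) * (\<Sum>b\<in>standard_exps I (m + k). coef_symbol (n t b) * d_symbol b))
        = (\<Sum>t\<in>E \<times> S. \<Sum>b\<in>standard_exps I (m + k). coef_symbol (c t * n t b) * d_symbol b)"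
      by (simp add: sum_distrib_left coef_symbol_mult mult.assoc)
    also have "\<dots> = (\<Sum>b\<in>standard_exps I (m + k). coef_symbol (\<Sum>t\<in>E \<times> S. c t * n t b) * d_symbol b)"
      by (subst sum.swap) (simp add: coef_symbol_sum sum_distrib_right)
    finally show ?thesis by (simp add: right_diff_distrib sum_subtractf mult.assoc)
  qed
  also have "\<dots> = (\<Sum>t\<in>E \<times> S. coef_symbol (c t) * s_monom (snd t) * d_symbol (fst t))"
    using c(3) by simp
  also have "\<dots> = (\<Sum>u\<in>E. coef_symbol (\<Sum>a\<in>S. single (sexp a) 1 * c (u, a)) * d_symbol u)"
    by (simp add: sum.cartesian_product' s_monom_def coef_symbol_sum sum_distrib_left sum_distrib_right mult.commute
      flip: coef_symbol_mult)
  finally have "(\<Sum>a\<in>S. single (sexp a) 1 * c (u, a)) = 0" if "u \<in> E" for u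
    using indep[unfolded independent_mod_system_def, rule_format, of "\<lambda>u. \<Sum>a\<in>S. single (sexp a) 1 * c (u, a)" u] that
    by simp
  then have "c (u, a) = 0" if "u \<in> E" "a \<in> S" for u a
    using s_expansion_unique[OF finS, of "\<lambda>a. c (u, a)" a] c(1) that by simp
  then show False using c(2) by auto
qed

section \<open>Spanning monomials and the degree of a monomial ideal\<close>

lemma rational_common_denominator:
  fixes c :: "'a \<Rightarrow> rat"
  assumes "finite F"
  shows "\<exists>N>0::int. \<forall>x\<in>F. \<exists>z::int. of_int N * c x = of_int z"
  using assms
proof (induction F rule: finite_induct)
  case empty
  show ?case by (intro exI[of _ 1]) simp
next
  case (insert x F)
  then obtain N :: int where N: "N > 0" "\<forall>y\<in>F. \<exists>z::int. of_int N * c y = of_int z" by blast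
  obtain a b where ab: "c x = Rat.Fract a b" "b > 0" by (cases "c x")
  then have "of_int b * c x = of_int a" by (simp add: Fract_of_int_quotient)
  then have "of_int (N * b) * c x = of_int (N * a)" by (simp add: mult.assoc)
  moreover have "\<exists>z::int. of_int (N * b) * c y = of_int z" if "y \<in> F" for y
  proof -
    obtain z :: int where z: "of_int N * c y = of_int z" using N(2) \<open>y \<in> F\<close> by blast
    have "of_int (N * b) * c y = of_int b * (of_int N * c y)" by (simp add: mult_ac)
    also have "\<dots> = of_int (b * z)" by (simp only: z of_int_mult)
    finally show ?thesis by (rule exI)
  qed
  ultimately have "\<forall>y\<in>insert x F. \<exists>z::int. of_int (N * b) * c y = of_int z" by blast
  moreover have "0 < N * b" using N(1) ab(2) by simp
  ultimately show ?case by blast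
qed

text \<open>If no relation among the columns in \<open>F\<close> involves \<open>j\<close>, then
  column \<open>j\<close> lies outside the rational span of the others, and a functional separates
  it from them.\<close>

lemma column_functional:
  fixes A :: "int ^ 'n::finite ^ 'd::finite"
  assumes "j \<in> F"
    and no_rel: "\<And>z :: 'n \<Rightarrow> int. (\<And>l. l \<notin> F \<Longrightarrow> z l = 0) \<Longrightarrow> (\<And>i. (\<Sum>l\<in>UNIV. A $ i $ l * z l) = 0) \<Longrightarrow> z j = 0"
  shows "\<exists>k :: 'd \<Rightarrow> complex. (\<Sum>i\<in>UNIV. k i * of_int (A $ i $ j)) = 1
    \<and> (\<forall>l\<in>F - {j}. (\<Sum>i\<in>UNIV. k i * of_int (A $ i $ l)) = 0)"
proof -
  define a :: "'n \<Rightarrow> rat ^ 'd" where "a l = (\<chi> i. of_int (A $ i $ l))" for l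
  define S where "S = a ` (F - {j})"
  have nin: "a j \<notin> vec.span S"
  proof
    assume "a j \<in> vec.span S"
    have "vec.span S \<subseteq> range (\<lambda>c. \<Sum>l\<in>F - {j}. c l *s a l)"
    proof (rule vec.span_minimal)
      show "S \<subseteq> range (\<lambda>c. \<Sum>l\<in>F - {j}. c l *s a l)"
      proof
        fix v assume "v \<in> S"
        then obtain l0 where l0: "l0 \<in> F - {j}" "v = a l0" by (auto simp: S_def)
        have "v = (\<Sum>l\<in>F - {j}. (if l = l0 then 1 else 0) *s a l)"
          using l0 by (subst sum.remove[of _ l0]) auto
        then show "v \<in> range (\<lambda>c. \<Sum>l\<in>F - {j}. c l *s a l)"
          by (rule range_eqI[of _ _ "\<lambda>l. if l = l0 then 1 else 0"])
      qed
      show "vec.subspace (range (\<lambda>c. \<Sum>l\<in>F - {j}. c l *s a l))"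
      proof (rule vec.subspaceI)
        show "0 \<in> range (\<lambda>c. \<Sum>l\<in>F - {j}. c l *s a l)" by (rule range_eqI[of _ _ "\<lambda>_. 0"]) simp
      next
        fix x y assume "x \<in> range (\<lambda>c. \<Sum>l\<in>F - {j}. c l *s a l)" "y \<in> range (\<lambda>c. \<Sum>l\<in>F - {j}. c l *s a l)"
        then obtain c c' where "x = (\<Sum>l\<in>F - {j}. c l *s a l)" "y = (\<Sum>l\<in>F - {j}. c' l *s a l)" by blast
        then have "x + y = (\<Sum>l\<in>F - {j}. (c l + c' l) *s a l)"
          by (simp add: vec.scale_left_distrib sum.distrib)
        then show "x + y \<in> range (\<lambda>c. \<Sum>l\<in>F - {j}. c l *s a l)"
          by (rule range_eqI[of _ _ "\<lambda>l. c l + c' l"])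
      next
        fix r x assume "x \<in> range (\<lambda>c. \<Sum>l\<in>F - {j}. c l *s a l)"
        then obtain c where "x = (\<Sum>l\<in>F - {j}. c l *s a l)" by blast
        then have "r *s x = (\<Sum>l\<in>F - {j}. (r * c l) *s a l)"
          by (simp add: vec.scale_sum_right)
        then show "r *s x \<in> range (\<lambda>c. \<Sum>l\<in>F - {j}. c l *s a l)"
          by (rule range_eqI[of _ _ "\<lambda>l. r * c l"])
      qed
    qed
    then obtain c where c: "a j = (\<Sum>l\<in>F - {j}. c l *s a l)" using \<open>a j \<in> vec.span S\<close> by blast
    define e where "e l = (if l = j then - 1 else if l \<in> F then c l else 0)" for l
    have e: "(\<Sum>l\<in>UNIV. of_int (A $ i $ l) * e l) = 0" for i
    proof -
      have "(\<Sum>l\<in>UNIV. of_int (A $ i $ l) * e l) = (\<Sum>l\<in>F. of_int (A $ i $ l) * e l)"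
        using assms(1) by (intro sum.mono_neutral_right) (auto simp: e_def)
      also have "\<dots> = - of_int (A $ i $ j) + (\<Sum>l\<in>F - {j}. of_int (A $ i $ l) * e l)"
        using assms(1) by (subst sum.remove[of F j]) (auto simp: e_def)
      also have "(\<Sum>l\<in>F - {j}. of_int (A $ i $ l) * e l) = (\<Sum>l\<in>F - {j}. c l * of_int (A $ i $ l))"
        by (intro sum.cong) (auto simp: e_def)
      also have "\<dots> = of_int (A $ i $ j)"
        using arg_cong[OF c, of "\<lambda>v. v $ i"] by (simp add: a_def)
      finally show ?thesis by simp
    qed
    \<comment> \<open>Clearing denominators turns \<open>e\<close> into an integer relation with
      entry \<open>- N\<close> at \<open>j\<close>, which \<open>no_rel\<close> forbids.\<close>
    obtain N :: int where N: "N > 0" "\<forall>l\<in>UNIV. \<exists>z::int. of_int N * e l = of_int z"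
      using rational_common_denominator[of UNIV e] by auto
    then have "\<forall>l. \<exists>z::int. of_int N * e l = of_int z" by blast
    from choice[OF this] obtain z :: "'n \<Rightarrow> int" where z: "\<forall>l. of_int N * e l = of_int (z l)" ..
    have "z j = 0"
    proof (rule no_rel)
      fix l assume "l \<notin> F"
      then have "e l = 0" using assms(1) by (auto simp: e_def)
      then show "z l = 0" using z[rule_format, of l] by simp
    next
      fix i
      have "(of_int (\<Sum>l\<in>UNIV. A $ i $ l * z l) :: rat) = of_int N * (\<Sum>l\<in>UNIV. of_int (A $ i $ l) * e l)"
        by (simp add: sum_distrib_left mult.left_commute flip: z[rule_format])
      then have "(of_int (\<Sum>l\<in>UNIV. A $ i $ l * z l) :: rat) = of_int 0" unfolding e by simp
      then show "(\<Sum>l\<in>UNIV. A $ i $ l * z l) = 0" by (simp only: of_int_eq_iff)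
    qed
    then show False using z[rule_format, of j] N(1) by (simp add: e_def)
  qed
  obtain B where B: "B \<subseteq> S" "vec.independent B" "S \<subseteq> vec.span B"
    using vec.maximal_independent_subset[of S] .
  have "vec.span B \<subseteq> vec.span S" using B(1) by (rule vec.span_mono)
  then have "a j \<notin> vec.span B" using nin by blast
  then have "vec.independent (insert (a j) B)" using B(2) by (rule vec.independent_insertI)
  \<comment> \<open>Every coordinate of the vector-valued map \<open>g\<close> is a functional with
    value 1 at \<open>a j\<close> and 0 on the other columns; \<open>i0\<close> selects one of
    them.\<close>
  from vec.linear_independent_extend[OF this, of "\<lambda>x. if x = a j then (\<chi> i. 1) else 0 :: rat ^ 'd"]
  obtain g where g: "Vector_Spaces.linear (*s) (*s) g"
      "\<forall>x\<in>insert (a j) B. g x = (if x = a j then (\<chi> i. 1) else 0 :: rat ^ 'd)"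
    by blast
  interpret g: Vector_Spaces.linear "(*s)" "(*s)" g by (rule g(1))
  have gB: "g x = 0" if "x \<in> B" for x
    using g(2) that \<open>a j \<notin> vec.span B\<close> vec.span_base by fastforce
  have gS: "g x = 0" if "x \<in> vec.span B" for x
    using that gB by (rule g.eq_0_on_span[rotated])
  define i0 where "i0 = (undefined :: 'd)"
  define k where "k i = (of_rat (matrix g $ i0 $ i) :: complex)" for i
  have k: "(\<Sum>i\<in>UNIV. k i * of_int (A $ i $ l)) = of_rat (g (a l) $ i0)" for l
  proof -
    have "g (a l) = matrix g *v a l" by (rule matrix_works[OF g(1), symmetric])
    then have "g (a l) $ i0 = (\<Sum>i\<in>UNIV. matrix g $ i0 $ i * of_int (A $ i $ l))"
      by (simp only: matrix_vector_mult_def a_def vec_lambda_beta)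
    then show ?thesis by (simp add: k_def of_rat_sum of_rat_mult)
  qed
  have "g (a l) = 0" if "l \<in> F - {j}" for l
    using that B(3) gS by (auto simp: S_def)
  then show ?thesis using g(2) by (intro exI[of _ k]) (simp add: k)
qed

text \<open>Equivalently, the monomials outside \<open>M\<close> have pairwise distinct degrees
  \<open>Au\<close>.\<close>

definition face_independent :: "int ^ 'n::finite ^ 'd::finite \<Rightarrow> 'n dpoly set \<Rightarrow> bool" where
  "face_independent A M \<longleftrightarrow> (\<forall>u v. A *v int_exponent u = A *v int_exponent v \<longrightarrow> u \<noteq> v \<longrightarrow>
     single u 1 \<in> M \<or> single v 1 \<in> M)"

text \<open>The positive and the negative part of an integer relation among the columns in
  \<open>F\<close> are two monomials of equal degree supported in \<open>F\<close>. Neither lies in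
  \<open>M\<close>, so they coincide and the relation is 0.\<close>

lemma face_functional:
  fixes A :: "int ^ 'n::finite ^ 'd::finite"
  assumes M: "face_independent A M" and F: "\<And>u. single u 1 \<in> M \<Longrightarrow> \<not> keys u \<subseteq> F"
    and j: "j \<in> F"
  shows "\<exists>k :: 'd \<Rightarrow> complex. (\<Sum>i\<in>UNIV. k i * of_int (A $ i $ j)) = 1
    \<and> (\<forall>l\<in>F - {j}. (\<Sum>i\<in>UNIV. k i * of_int (A $ i $ l)) = 0)"
proof (rule column_functional[OF j])
  fix z :: "'n \<Rightarrow> int"
  assume z: "\<And>l. l \<notin> F \<Longrightarrow> z l = 0" and rel: "\<And>i. (\<Sum>l\<in>UNIV. A $ i $ l * z l) = 0"
  define u where "u = (\<Sum>l\<in>UNIV. single l (nat (z l)))"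
  define v where "v = (\<Sum>l\<in>UNIV. single l (nat (- z l)))"
  have u: "lookup u l = nat (z l)" and v: "lookup v l = nat (- z l)" for l
    by (simp_all add: u_def v_def lookup_sum lookup_single when_def)
  have "A *v int_exponent u = A *v int_exponent v"
  proof (rule vec_eq_iff[THEN iffD2], rule allI)
    fix i
    have "(A *v int_exponent u) $ i - (A *v int_exponent v) $ i
        = (\<Sum>l\<in>UNIV. A $ i $ l * (int (nat (z l)) - int (nat (- z l))))"
      by (simp add: matrix_vector_mult_def int_exponent_def u v algebra_simps sum_subtractf)
    also have "\<dots> = (\<Sum>l\<in>UNIV. A $ i $ l * z l)" by (intro sum.cong) auto
    finally show "(A *v int_exponent u) $ i = (A *v int_exponent v) $ i" using rel[of i] by simp
  qed
  moreover have "keys u \<subseteq> F" "keys v \<subseteq> F"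
    using z by (force simp: in_keys_iff u v)+
  ultimately have "u = v" using M F unfolding face_independent_def by blast
  then have "nat (z j) = nat (- z j)" using u v by metis
  then show "z j = 0" by linarith
qed

section \<open>The Euler operators as a system of parameters modulo a monomial ideal\<close>

definition xd_symbol :: "('n::finite \<Rightarrow>\<^sub>0 nat) \<Rightarrow> ('d::finite, 'n) symbol" where
  "xd_symbol v = single (xexp v) (single v 1)"

text \<open>In the commuting symbols of \<open>x\<^sub>l \<partial>\<^sub>l\<close>, whose monomials
  are the \<open>xd_symbol v\<close>, the Euler symbols are linear forms with the rows of
  \<open>A\<close> as coefficients. Reduction modulo them becomes a problem in a polynomial
  ring.\<close>

lemma euler_symbol_xd_symbol:
  "euler_symbol A i * xd_symbol v
    = (\<Sum>l\<in>UNIV. coef_symbol (const_poly (of_int (A $ i $ l))) * (xd_symbol (single l 1 + v) :: ('d::finite, 'n::finite) symbol))"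
proof -
  have "euler_symbol A i * xd_symbol v + single (xexp v) (single v (of_int (exp_action A i v)))
      = euler_shift A i (xd_symbol v :: ('d, 'n) symbol)"
    by (simp add: euler_shift_def xd_symbol_def grading_deriv_symbol_single grading_deriv_single)
  also have "\<dots> = (\<Sum>l\<in>UNIV. coef_symbol (const_poly (of_int (A $ i $ l))) * xd_symbol (single l 1 + v))
      + single (xexp v) (single v (of_int (exp_action A i v)))"
    unfolding xd_symbol_def euler_shift_single
    by (simp only: coef_symbol_single mult_single xexp_add xexp_single add_0 mult_1_right)
  finally show ?thesis by simp
qed

text \<open>The sets that contain a symbol as soon as it is a homogeneous combination of the
  \<open>euler_symbol A i * xd_symbol v\<close> with \<open>v\<close> of degree \<open>m - 1\<close>, modulo the ideal.\<close>

definition admissible :: "int ^ 'n::finite ^ 'd::finite \<Rightarrow> 'n dpoly set \<Rightarrow> nat \<Rightarrow> ('d, 'n) symbol set \<Rightarrow> bool" where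
  "admissible A M m W \<longleftrightarrow> extend_ideal M \<subseteq> W \<and> (\<forall>P\<in>W. \<forall>Q\<in>W. P + Q \<in> W)
     \<and> (\<forall>c. \<forall>P\<in>W. coef_symbol (const_poly c) * P \<in> W)
     \<and> (\<forall>i v. Suc (tdeg v) = m \<longrightarrow> euler_symbol A i * xd_symbol v \<in> W)"

lemma admissible_sum:
  assumes "admissible A M m W" "left_ideal_of UNIV M" "\<And>i. i \<in> F \<Longrightarrow> f i \<in> W"
  shows "sum f F \<in> W"
proof -
  have "0 \<in> W" using assms(1,2) left_ideal_zero[OF extend_ideal_ideal[OF assms(2)]]
    unfolding admissible_def by blast
  then show ?thesis using assms(1,3)
    by (induction F rule: infinite_finite_induct) (auto simp: admissible_def)
qed

text \<open>Every face has independent columns, so modulo the Euler symbols a variable of the face can be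
  traded for variables outside the face; downward induction on the face.\<close>

lemma face_power_bound:
  fixes A :: "int ^ 'n::finite ^ 'd::finite"
  assumes M: "left_ideal_of UNIV M" "face_independent A M" and "F \<noteq> {}"
  shows "\<exists>N. \<forall>W m v. admissible A M m W \<longrightarrow> tdeg v = m \<longrightarrow> (\<forall>j\<in>F. N \<le> lookup v j)
    \<longrightarrow> (xd_symbol v :: ('d, 'n) symbol) \<in> W"
  using assms(3)
proof (induction "card (UNIV - F)" arbitrary: F rule: less_induct)
  case less
  show ?case
  proof (cases "\<exists>u. single u 1 \<in> M \<and> keys u \<subseteq> F")
    case True
    then obtain u where u: "single u 1 \<in> M" "keys u \<subseteq> F" by blast
    have "(xd_symbol v :: ('d, 'n) symbol) \<in> extend_ideal M" if "\<forall>j\<in>F. tdeg u \<le> lookup v j" for v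
    proof -
      have "lookup u l \<le> lookup v l" for l
      proof (cases "l \<in> F")
        case True
        then show ?thesis using that lookup_le_tdeg[of u l] by force
      next
        case False
        then have "l \<notin> keys u" using u(2) by blast
        then show ?thesis by (simp add: in_keys_iff)
      qed
      then have "\<exists>x. v = u + x" using exponent_le_iff by blast
      then obtain x where "v = u + x" ..
      then have "single v 1 = single x 1 * (single u 1 :: 'n dpoly)"
        by (simp add: mult_single add.commute)
      then have "(single v 1 :: 'n dpoly) \<in> M" using left_ideal_mult[OF M(1) u(1)] by metis
      then show ?thesis by (simp add: xd_symbol_def extend_ideal_def lookup_single when_def left_ideal_zero[OF M(1)])
    qed
    then show ?thesis by (intro exI[of _ "tdeg u"]) (auto simp: admissible_def)
  next
    case False
    obtain j where j: "j \<in> F" using less.prems by blast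
    have "\<exists>k :: 'd \<Rightarrow> complex. (\<Sum>i\<in>UNIV. k i * of_int (A $ i $ j)) = 1
        \<and> (\<forall>l\<in>F - {j}. (\<Sum>i\<in>UNIV. k i * of_int (A $ i $ l)) = 0)"
      by (rule face_functional[OF M(2) _ j]) (use False in blast)
    then obtain k :: "'d \<Rightarrow> complex" where k: "(\<Sum>i\<in>UNIV. k i * of_int (A $ i $ j)) = 1"
        "\<And>l. l \<in> F - {j} \<Longrightarrow> (\<Sum>i\<in>UNIV. k i * of_int (A $ i $ l)) = 0" by blast
    \<comment> \<open>The coefficients of the linear form obtained by combining the Euler symbols
      with \<open>k\<close>: 1 at \<open>j\<close> and 0 on the rest of \<open>F\<close>. Multiplied
      by \<open>xd_symbol v'\<close>, it trades one unit of \<open>j\<close> for units outside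
      \<open>F\<close>.\<close>
    define k' where "k' l = (\<Sum>i\<in>UNIV. k i * of_int (A $ i $ l))" for l
    have "\<forall>i\<in>- F. \<exists>N. \<forall>W m v. admissible A M m W \<longrightarrow> tdeg v = m \<longrightarrow> (\<forall>j\<in>insert i F. N \<le> lookup v j)
        \<longrightarrow> (xd_symbol v :: ('d, 'n) symbol) \<in> W"
    proof
      fix i assume i: "i \<in> - F"
      show "\<exists>N. \<forall>W m v. admissible A M m W \<longrightarrow> tdeg v = m \<longrightarrow> (\<forall>j\<in>insert i F. N \<le> lookup v j)
        \<longrightarrow> (xd_symbol v :: ('d, 'n) symbol) \<in> W"
        by (rule less.hyps, rule psubset_card_mono) (use i in auto)
    qed
    from bchoice[OF this] obtain N where N: "\<forall>i\<in>- F. \<forall>W m v. admissible A M m W \<longrightarrow> tdeg v = m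
        \<longrightarrow> (\<forall>j\<in>insert i F. N i \<le> lookup v j) \<longrightarrow> (xd_symbol v :: ('d, 'n) symbol) \<in> W" ..
    \<comment> \<open>The sum dominates every \<open>N i\<close>; the successor makes
      \<open>N'\<close> positive, so that a unit of \<open>j\<close> can be split off as soon as
      \<open>N'\<close> bounds its exponent from below.\<close>
    define N' where "N' = Suc (\<Sum>i\<in>- F. N i)"
    have N': "N i \<le> N'" if "i \<in> - F" for i
      using member_le_sum[of i "- F" N] that by (simp add: N'_def)
    \<comment> \<open>A trade lowers the exponent of \<open>j\<close> by one and raises an exponent
      outside \<open>F\<close> still below \<open>N'\<close>. So the last quantity is invariant
      while the induction measure drops. The minima add up to at most
      \<open>card (- F) * N'\<close>, which keeps the exponent of \<open>j\<close> at
      \<open>N'\<close> or more. Once an exponent outside \<open>F\<close> reaches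
      \<open>N'\<close>, the larger face takes over.\<close>
    have main: "(xd_symbol v :: ('d, 'n) symbol) \<in> W"
      if W: "admissible A M m W" and "tdeg v = m" and "\<forall>l\<in>F - {j}. N' \<le> lookup v l"
        and "N' + card (- F) * N' \<le> lookup v j + (\<Sum>i\<in>- F. min (lookup v i) N')"
      for W m v
      using that(2-)
    proof (induction "\<Sum>i\<in>- F. N' - lookup v i" arbitrary: v rule: less_induct)
      case (less v)
      have "(\<Sum>i\<in>- F. min (lookup v i) N') \<le> card (- F) * N'"
        using sum_bounded_above[of "- F" "\<lambda>i. min (lookup v i) N'" N'] by simp
      then have vj: "N' \<le> lookup v j" using less.prems(3) by linarith
      show ?case
      proof (cases "\<exists>i\<in>- F. N' \<le> lookup v i")
        case True
        then obtain i where i: "i \<in> - F" "N' \<le> lookup v i" by blast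
        have "\<forall>l\<in>insert i F. N' \<le> lookup v l" using i vj less.prems(2) by blast
        then have "\<forall>l\<in>insert i F. N i \<le> lookup v l" using N'[OF i(1)] order_trans by blast
        then show ?thesis using N W less.prems(1) i(1) by blast
      next
        case False
        then have small: "lookup v i < N'" if "i \<in> - F" for i using that by force
        define v' where "v' = v - single j 1"
        have v: "v = single j 1 + v'"
          using vj by (intro poly_mapping_eqI) (auto simp: v'_def N'_def lookup_add lookup_minus lookup_single when_def)
        then have m: "Suc (tdeg v') = m" using less.prems(1) by (simp add: tdeg_add)
        have step: "(xd_symbol (single l 1 + v') :: ('d, 'n) symbol) \<in> W" if l: "l \<in> - F" for l
        proof (rule less.hyps)
          let ?u = "single l 1 + v'"
          have lj: "l \<noteq> j" using l j by blast
          have look: "lookup ?u i = (if i = l then Suc (lookup v i)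
              else if i = j then lookup v i - 1 else lookup v i)" for i
            using lj by (auto simp: v'_def lookup_add lookup_minus lookup_single when_def)
          have "(\<Sum>i\<in>- F. f (lookup ?u i)) = f (Suc (lookup v l)) + (\<Sum>i\<in>- F - {l}. f (lookup v i))"
            for f :: "nat \<Rightarrow> nat"
            using l j by (subst sum.remove[of _ l]) (auto simp: look[simplified] split: if_splits intro!: sum.cong)
          moreover have "(\<Sum>i\<in>- F. f (lookup v i)) = f (lookup v l) + (\<Sum>i\<in>- F - {l}. f (lookup v i))"
            for f :: "nat \<Rightarrow> nat"
            using l by (subst sum.remove[of _ l]) auto
          ultimately have sums: "(\<Sum>i\<in>- F. f (lookup ?u i)) + f (lookup v l)
              = (\<Sum>i\<in>- F. f (lookup v i)) + f (Suc (lookup v l))" for f :: "nat \<Rightarrow> nat"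
            by simp
          show "(\<Sum>i\<in>- F. N' - lookup ?u i) < (\<Sum>i\<in>- F. N' - lookup v i)"
            using sums[of "\<lambda>x. N' - x"] small[OF l] by linarith
          show "tdeg ?u = m" using m by (simp add: tdeg_add)
          show "\<forall>i\<in>F - {j}. N' \<le> lookup ?u i" using less.prems(2) l by (auto simp: look[simplified])
          show "N' + card (- F) * N' \<le> lookup ?u j + (\<Sum>i\<in>- F. min (lookup ?u i) N')"
            using sums[of "\<lambda>x. min x N'"] small[OF l] less.prems(3) vj lj by (simp add: look[of j, simplified] N'_def)
        qed
        have "(\<Sum>i\<in>UNIV. coef_symbol (const_poly (k i)) * (euler_symbol A i * xd_symbol v')) \<in> W"
          using W m by (intro admissible_sum[OF W M(1)]) (simp add: admissible_def)
        also have "(\<Sum>i\<in>UNIV. coef_symbol (const_poly (k i)) * (euler_symbol A i * xd_symbol v'))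
            = (\<Sum>l\<in>UNIV. coef_symbol (const_poly (k' l)) * (xd_symbol (single l 1 + v') :: ('d, 'n) symbol))"
        proof -
          have const_sum: "(\<Sum>i\<in>UNIV. const_poly (f i)) = const_poly (\<Sum>i\<in>UNIV. f i)" for f :: "'d \<Rightarrow> complex"
            by (rule poly_mapping_eqI) (simp add: lookup_sum lookup_single when_def)
          have "(\<Sum>i\<in>UNIV. coef_symbol (const_poly (k i)) * (euler_symbol A i * xd_symbol v'))
              = (\<Sum>i\<in>UNIV. \<Sum>l\<in>UNIV. coef_symbol (const_poly (k i * of_int (A $ i $ l))) * (xd_symbol (single l 1 + v') :: ('d, 'n) symbol))"
          proof -
            have "const_poly (k i * of_int z) = const_poly (k i) * (const_poly (of_int z) :: ('d, 'n) sxpoly)" for i z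
              by (simp only: mult_single add_0)
            then show ?thesis
              by (simp only: euler_symbol_xd_symbol sum_distrib_left coef_symbol_mult mult.assoc)
          qed
          also have "\<dots> = (\<Sum>l\<in>UNIV. (\<Sum>i\<in>UNIV. coef_symbol (const_poly (k i * of_int (A $ i $ l)))) * xd_symbol (single l 1 + v'))"
            by (subst sum.swap) (simp only: sum_distrib_right)
          finally show ?thesis by (simp only: k'_def coef_symbol_sum[symmetric] const_sum)
        qed
        also have "\<dots> = xd_symbol v + (\<Sum>l\<in>- F. coef_symbol (const_poly (k' l)) * xd_symbol (single l 1 + v'))"
        proof -
          have "(\<Sum>l\<in>UNIV. coef_symbol (const_poly (k' l)) * (xd_symbol (single l 1 + v') :: ('d, 'n) symbol))
              = (\<Sum>l\<in>insert j (- F). coef_symbol (const_poly (k' l)) * xd_symbol (single l 1 + v'))"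
            using k(2) by (intro sum.mono_neutral_right) (auto simp: k'_def)
          then show ?thesis using j k(1) v by (simp add: k'_def)
        qed
        finally have total: "xd_symbol v + (\<Sum>l\<in>- F. coef_symbol (const_poly (k' l)) * (xd_symbol (single l 1 + v') :: ('d, 'n) symbol)) \<in> W" .
        have rest: "(\<Sum>l\<in>- F. coef_symbol (const_poly (- k' l)) * (xd_symbol (single l 1 + v') :: ('d, 'n) symbol)) \<in> W"
          using W step by (intro admissible_sum[OF W M(1)]) (simp add: admissible_def)
        define R where "R = (\<Sum>l\<in>- F. coef_symbol (const_poly (k' l)) * (xd_symbol (single l 1 + v') :: ('d, 'n) symbol))"
        have "- R = (\<Sum>l\<in>- F. coef_symbol (const_poly (- k' l)) * (xd_symbol (single l 1 + v') :: ('d, 'n) symbol))"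
          by (simp add: R_def single_uminus coef_symbol_uminus sum_negf)
        then have "- R \<in> W" using rest by simp
        moreover have "xd_symbol v + R \<in> W" using total by (simp add: R_def)
        moreover have "\<forall>P\<in>W. \<forall>Q\<in>W. P + Q \<in> W" using W by (simp add: admissible_def)
        ultimately have "(xd_symbol v + R) + - R \<in> W" by blast
        then show "xd_symbol v \<in> W" by simp
      qed
    qed
    show ?thesis
    proof (intro exI[of _ "N' + card (- F) * N'"] allI impI)
      fix W m v
      assume "admissible A M m W" "tdeg v = m" "\<forall>j\<in>F. N' + card (- F) * N' \<le> lookup v j"
      then show "(xd_symbol v :: ('d, 'n) symbol) \<in> W"
        using j by (intro main[of m W v]) (auto intro: trans_le_add1 add_leD1)
    qed
  qed
qed

text \<open>A monomial of large degree has one large exponent, so the faces with a single element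
  suffice. In ring terms, \<open>M\<close> and the linear forms of the Euler symbols together
  contain all monomials of degree above \<open>K\<close>.\<close>

lemma power_bound:
  fixes A :: "int ^ 'n::finite ^ 'd::finite"
  assumes M: "left_ideal_of UNIV M" "face_independent A M"
  shows "\<exists>K. \<forall>W m v. admissible A M m W \<longrightarrow> tdeg v = m \<longrightarrow> K < m \<longrightarrow> (xd_symbol v :: ('d, 'n) symbol) \<in> W"
proof -
  have "\<forall>j. \<exists>N. \<forall>W m v. admissible A M m W \<longrightarrow> tdeg v = m \<longrightarrow> N \<le> lookup v j
      \<longrightarrow> (xd_symbol v :: ('d, 'n) symbol) \<in> W"
  proof
    fix j :: 'n
    show "\<exists>N. \<forall>W m v. admissible A M m W \<longrightarrow> tdeg v = m \<longrightarrow> N \<le> lookup v j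
      \<longrightarrow> (xd_symbol v :: ('d, 'n) symbol) \<in> W"
      using face_power_bound[OF M, of "{j}"] by simp
  qed
  from choice[OF this] obtain N where N: "\<forall>j W m v. admissible A M m W \<longrightarrow> tdeg v = m \<longrightarrow> N j \<le> lookup v j
      \<longrightarrow> (xd_symbol v :: ('d, 'n) symbol) \<in> W" by blast
  have "\<exists>j. N j \<le> lookup v j" if "(\<Sum>j\<in>UNIV. N j) < tdeg v" for v
  proof (rule ccontr)
    assume "\<not> (\<exists>j. N j \<le> lookup v j)"
    then have "tdeg v \<le> (\<Sum>j\<in>UNIV. N j)" unfolding tdeg_def by (intro sum_mono) (simp add: not_le less_imp_le)
    then show False using that by simp
  qed
  then show ?thesis using N by (intro exI[of _ "\<Sum>j\<in>UNIV. N j"]) blast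
qed

section \<open>Spans over \<open>C[x]\<close> and over \<open>C(x)\<close> modulo the system\<close>

definition xspan :: "int ^ 'n::finite ^ 'd::finite \<Rightarrow> 'n dpoly set \<Rightarrow> ('d, 'n) symbol set \<Rightarrow> ('d, 'n) symbol set" where
  "xspan A I G = {P. \<exists>c. (\<forall>g. sfree (c g)) \<and> P - (\<Sum>g\<in>G. coef_symbol (c g) * g) \<in> system_relations A I}"

text \<open>The saturation plays the role of the span over \<open>C(x)\<close> without forming
  fractions.\<close>

definition xspan_sat :: "int ^ 'n::finite ^ 'd::finite \<Rightarrow> 'n dpoly set \<Rightarrow> ('d, 'n) symbol set \<Rightarrow> ('d, 'n) symbol set" where
  "xspan_sat A I G = {P. \<exists>f. f \<noteq> 0 \<and> sfree f \<and> coef_symbol f * P \<in> xspan A I G}"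

lemma xspan_rel: "P \<in> system_relations A I \<Longrightarrow> P \<in> xspan A I G"
  unfolding xspan_def by (intro CollectI exI[of _ "\<lambda>_. 0"]) simp

lemma xspan_add:
  assumes I: "left_ideal_of UNIV I" and "P \<in> xspan A I G" "Q \<in> xspan A I G"
  shows "P + Q \<in> xspan A I G"
proof -
  obtain c c' where c: "\<forall>g. sfree (c g)" "P - (\<Sum>g\<in>G. coef_symbol (c g) * g) \<in> system_relations A I"
    and c': "\<forall>g. sfree (c' g)" "Q - (\<Sum>g\<in>G. coef_symbol (c' g) * g) \<in> system_relations A I"
    using assms(2,3) unfolding xspan_def by auto
  have "P + Q - (\<Sum>g\<in>G. coef_symbol (c g + c' g) * g)
      = (P - (\<Sum>g\<in>G. coef_symbol (c g) * g)) + (Q - (\<Sum>g\<in>G. coef_symbol (c' g) * g))"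
    by (simp add: coef_symbol_add distrib_right sum.distrib)
  then have "P + Q - (\<Sum>g\<in>G. coef_symbol (c g + c' g) * g) \<in> system_relations A I"
    using system_relations_add[OF I c(2) c'(2)] by metis
  then show ?thesis unfolding xspan_def using c(1) c'(1)
    by (intro CollectI exI[of _ "\<lambda>g. c g + c' g"]) (simp add: sfree_add)
qed

lemma xspan_coef:
  assumes I: "left_ideal_of UNIV I" and "P \<in> xspan A I G" "sfree f"
  shows "coef_symbol f * P \<in> xspan A I G"
proof -
  obtain c where c: "\<forall>g. sfree (c g)" "P - (\<Sum>g\<in>G. coef_symbol (c g) * g) \<in> system_relations A I"
    using assms(2) unfolding xspan_def by auto
  have "coef_symbol f * P - (\<Sum>g\<in>G. coef_symbol (f * c g) * g) = coef_symbol f * (P - (\<Sum>g\<in>G. coef_symbol (c g) * g))"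
    by (simp add: coef_symbol_mult right_diff_distrib sum_distrib_left mult.assoc)
  then have "coef_symbol f * P - (\<Sum>g\<in>G. coef_symbol (f * c g) * g) \<in> system_relations A I"
    using system_relations_coef[OF I c(2)] by simp
  then show ?thesis unfolding xspan_def using c(1) assms(3)
    by (intro CollectI exI[of _ "\<lambda>g. f * c g"]) (simp add: sfree_mult)
qed

lemma xspan_sum:
  assumes I: "left_ideal_of UNIV I" and "\<And>i. i \<in> F \<Longrightarrow> f i \<in> xspan A I G"
  shows "sum f F \<in> xspan A I G"
  using assms(2) by (induction F rule: infinite_finite_induct)
    (auto intro: xspan_rel system_relations_0[OF I] xspan_add[OF I])

lemma xspan_base:
  assumes I: "left_ideal_of UNIV I" and "finite G" "g \<in> G"
  shows "g \<in> xspan A I G"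
proof -
  have "(\<Sum>h\<in>G. coef_symbol (if h = g then 1 else 0) * h) = g"
    using assms(2,3) by (subst sum.remove[of G g]) auto
  then show ?thesis unfolding xspan_def using system_relations_0[OF I]
    by (intro CollectI exI[of _ "\<lambda>h. if h = g then 1 else 0"]) simp
qed

lemma xspan_mult_trans:
  assumes I: "left_ideal_of UNIV I" and "P \<in> xspan A I G"
    and G': "\<And>g. g \<in> G \<Longrightarrow> coef_symbol q * g \<in> xspan A I G'"
  shows "coef_symbol q * P \<in> xspan A I G'"
proof -
  obtain c where c: "\<forall>g. sfree (c g)" "P - (\<Sum>g\<in>G. coef_symbol (c g) * g) \<in> system_relations A I"
    using assms(2) unfolding xspan_def by auto
  have "coef_symbol q * P = coef_symbol q * (P - (\<Sum>g\<in>G. coef_symbol (c g) * g))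
      + (\<Sum>g\<in>G. coef_symbol (c g) * (coef_symbol q * g))"
    by (simp add: right_diff_distrib sum_distrib_left mult.left_commute)
  moreover have "coef_symbol q * (P - (\<Sum>g\<in>G. coef_symbol (c g) * g)) \<in> xspan A I G'"
    by (rule xspan_rel, rule system_relations_coef[OF I c(2)])
  moreover have "(\<Sum>g\<in>G. coef_symbol (c g) * (coef_symbol q * g)) \<in> xspan A I G'"
  proof (intro xspan_sum[OF I])
    fix g assume "g \<in> G"
    then show "coef_symbol (c g) * (coef_symbol q * g) \<in> xspan A I G'"
      using xspan_coef[OF I G'] c(1) by blast
  qed
  ultimately show ?thesis using xspan_add[OF I] by simp
qed

lemma xspan_mono:
  assumes I: "left_ideal_of UNIV I" and "P \<in> xspan A I G" "G \<subseteq> G'" "finite G'"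
  shows "P \<in> xspan A I G'"
  using xspan_mult_trans[OF I assms(2), of 1 G'] xspan_base[OF I assms(4)] assms(3) by auto

lemma xspan_sat_superset: "xspan A I G \<subseteq> xspan_sat A I G"
proof
  fix P assume "P \<in> xspan A I G"
  then show "P \<in> xspan_sat A I G" unfolding xspan_sat_def by (intro CollectI exI[of _ 1]) simp
qed

lemma xspan_sat_add:
  assumes I: "left_ideal_of UNIV I" and "P \<in> xspan_sat A I G" "Q \<in> xspan_sat A I G"
  shows "P + Q \<in> xspan_sat A I G"
proof -
  obtain f f' where f: "f \<noteq> 0" "sfree f" "coef_symbol f * P \<in> xspan A I G"
    and f': "f' \<noteq> 0" "sfree f'" "coef_symbol f' * Q \<in> xspan A I G"
    using assms(2,3) unfolding xspan_sat_def by auto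
  have "coef_symbol (f * f') * (P + Q) = coef_symbol f' * (coef_symbol f * P) + coef_symbol f * (coef_symbol f' * Q)"
    by (simp add: coef_symbol_mult distrib_left mult_ac)
  also have "\<dots> \<in> xspan A I G" 
    by (rule xspan_add[OF I xspan_coef[OF I f(3) f'(2)] xspan_coef[OF I f'(3) f(2)]])
  finally show ?thesis unfolding xspan_sat_def using f f'
    by (intro CollectI exI[of _ "f * f'"]) (simp add: sfree_mult)
qed

lemma xspan_sat_coef:
  assumes I: "left_ideal_of UNIV I" and "P \<in> xspan_sat A I G" "sfree g"
  shows "coef_symbol g * P \<in> xspan_sat A I G"
proof -
  obtain f where f: "f \<noteq> 0" "sfree f" "coef_symbol f * P \<in> xspan A I G"
    using assms(2) unfolding xspan_sat_def by auto
  have "coef_symbol f * (coef_symbol g * P) = coef_symbol g * (coef_symbol f * P)" by (simp add: mult_ac)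
  also have "\<dots> \<in> xspan A I G" using f(3) assms(3) by (rule xspan_coef[OF I])
  finally show ?thesis unfolding xspan_sat_def using f by blast
qed

lemma xspan_sat_cancel:
  assumes "coef_symbol g * P \<in> xspan_sat A I G" "g \<noteq> 0" "sfree g"
  shows "P \<in> xspan_sat A I G"
proof -
  obtain f where f: "f \<noteq> 0" "sfree f" "coef_symbol f * (coef_symbol g * P) \<in> xspan A I G"
    using assms(1) unfolding xspan_sat_def by auto
  then have "coef_symbol (f * g) * P \<in> xspan A I G" by (simp add: coef_symbol_mult mult.assoc)
  then show ?thesis unfolding xspan_sat_def using f assms(2,3)
    by (intro CollectI exI[of _ "f * g"]) (simp add: sfree_mult)
qed

lemma xspan_sat_sum:
  assumes I: "left_ideal_of UNIV I" and "\<And>i. i \<in> F \<Longrightarrow> f i \<in> xspan_sat A I G"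
  shows "sum f F \<in> xspan_sat A I G"
  using assms(2)
proof (induction F rule: infinite_finite_induct)
  case (insert x F)
  then show ?case by (simp add: xspan_sat_add[OF I])
qed (use subsetD[OF xspan_sat_superset xspan_rel[OF system_relations_0[OF I]]] in simp_all)

lemma xspan_sat_trans:
  assumes I: "left_ideal_of UNIV I" and "P \<in> xspan A I G" and G': "\<And>g. g \<in> G \<Longrightarrow> g \<in> xspan_sat A I G'"
  shows "P \<in> xspan_sat A I G'"
proof -
  obtain c where c: "\<forall>g. sfree (c g)" "P - (\<Sum>g\<in>G. coef_symbol (c g) * g) \<in> system_relations A I"
    using assms(2) unfolding xspan_def by auto
  have "(P - (\<Sum>g\<in>G. coef_symbol (c g) * g)) + (\<Sum>g\<in>G. coef_symbol (c g) * g) \<in> xspan_sat A I G'"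
  proof (rule xspan_sat_add[OF I])
    show "P - (\<Sum>g\<in>G. coef_symbol (c g) * g) \<in> xspan_sat A I G'"
      using xspan_rel[OF c(2)] xspan_sat_superset by blast
    show "(\<Sum>g\<in>G. coef_symbol (c g) * g) \<in> xspan_sat A I G'"
      using c(1) G' by (intro xspan_sat_sum[OF I] xspan_sat_coef[OF I]) auto
  qed
  then show ?thesis by simp
qed

definition monomial_symbols :: "nat \<Rightarrow> nat \<Rightarrow> ('d::finite, 'n::finite) symbol set" where
  "monomial_symbols m k = (\<lambda>(a, b). s_monom a * d_symbol b) ` ({a. tdeg a \<le> m} \<times> {b. tdeg b \<le> k})"

lemma finite_monomial_symbols: "finite (monomial_symbols m k)"
  unfolding monomial_symbols_def by (intro finite_imageI finite_cartesian_product finite_tdeg_le)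

lemma xd_symbol_eq: "xd_symbol v = coef_symbol (single (xexp v) 1) * d_symbol v"
  by (simp add: xd_symbol_def coef_symbol_single d_symbol_def mult_single)

text \<open>Finite generation over \<open>C[x][s]\<close> by the \<open>\<partial>\<^sup>b\<close>
  with \<open>tdeg b \<le> K\<close>, up to monomials in \<open>x\<close>. The count to come rests
  on the accompanying control of degrees: the degree in \<open>s\<close> does not exceed
  \<open>tdeg v\<close>.\<close>

lemma xd_symbol_in_xspan:
  fixes A :: "int ^ 'n::finite ^ 'd::finite"
  assumes M: "left_ideal_of UNIV M" "face_independent A M"
  shows "\<exists>K. \<forall>v. (xd_symbol v :: ('d, 'n) symbol) \<in> xspan A M (monomial_symbols (tdeg v) K)"
proof -
  obtain K where K: "\<forall>W m v. admissible A M m W \<longrightarrow> tdeg v = m \<longrightarrow> K < m \<longrightarrow> (xd_symbol v :: ('d, 'n) symbol) \<in> W"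
    using power_bound[OF M] by blast
  have "(xd_symbol v :: ('d, 'n) symbol) \<in> xspan A M (monomial_symbols (tdeg v) K)" for v
  proof (induction "tdeg v" arbitrary: v rule: less_induct)
    case less
    let ?G = "monomial_symbols (tdeg v) K :: ('d, 'n) symbol set"
    show ?case
    proof (cases "tdeg v \<le> K")
      case True
      then have "s_monom 0 * d_symbol v \<in> ?G"
        unfolding monomial_symbols_def by (intro image_eqI[of _ _ "(0, v)"]) auto
      then have "d_symbol v \<in> xspan A M ?G" using xspan_base[OF M(1) finite_monomial_symbols] by simp
      then show ?thesis unfolding xd_symbol_eq by (rule xspan_coef[OF M(1)]) (simp add: sfree_single)
    next
      case False
      \<comment> \<open>The last closure condition uses the induction hypothesis for
        \<open>v'\<close>: modulo the Euler relations, \<open>euler_symbol A i\<close> acts on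
        \<open>xd_symbol v'\<close> as \<open>s\<^sub>i - (Av')\<^sub>i\<close>, and
        \<open>s\<^sub>i\<close> raises the permitted degree in \<open>s\<close> from
        \<open>tdeg v'\<close> to \<open>tdeg v\<close>.\<close>
      have "admissible A M (tdeg v) (xspan A M ?G)"
        unfolding admissible_def
      proof (intro conjI ballI allI impI)
        show "extend_ideal M \<subseteq> xspan A M ?G"
          using system_relations_superset(2)[OF M(1)] xspan_rel by blast
        show "P + Q \<in> xspan A M ?G" if "P \<in> xspan A M ?G" "Q \<in> xspan A M ?G" for P Q
          using that by (rule xspan_add[OF M(1)])
        have "s_part (0 :: ('d, 'n) indet \<Rightarrow>\<^sub>0 nat) = 0" by (simp add: s_part_def)
        then show "coef_symbol (const_poly c) * P \<in> xspan A M ?G" if "P \<in> xspan A M ?G" for c P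
          using that by (intro xspan_coef[OF M(1)] sfree_single)
        fix i and v' :: "'n \<Rightarrow>\<^sub>0 nat" assume v': "Suc (tdeg v') = tdeg v"
        let ?x = "xd_symbol v' :: ('d, 'n) symbol"
        have IH: "?x \<in> xspan A M (monomial_symbols (tdeg v') K)" using less v' by simp
        have "monomial_symbols (tdeg v') K \<subseteq> ?G"
          using v' unfolding monomial_symbols_def by (intro image_mono Sigma_mono) auto
        then have x: "?x \<in> xspan A M ?G" using xspan_mono[OF M(1) IH] finite_monomial_symbols by blast
        have "coef_symbol (var_poly (S_var i)) * ?x \<in> xspan A M ?G"
        proof (rule xspan_mult_trans[OF M(1) IH])
          fix g :: "('d, 'n) symbol" assume "g \<in> monomial_symbols (tdeg v') K"
          then obtain a b where ab: "g = s_monom a * d_symbol b" "tdeg a \<le> tdeg v'" "tdeg b \<le> K"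
            by (auto simp: monomial_symbols_def)
          have "coef_symbol (var_poly (S_var i)) * g = s_monom (single i 1 + a) * d_symbol b"
            unfolding ab(1) s_monom_add s_monom_single s_symbol_def by (rule mult.assoc[symmetric])
          moreover have "\<dots> \<in> ?G" unfolding monomial_symbols_def
            using ab v' by (intro image_eqI[of _ _ "(single i 1 + a, b)"]) (auto simp: tdeg_add)
          ultimately show "coef_symbol (var_poly (S_var i)) * g \<in> xspan A M ?G"
            using xspan_base[OF M(1) finite_monomial_symbols] by simp
        qed
        then have s: "s_symbol i * ?x \<in> xspan A M ?G" by (simp only: s_symbol_def)
        have rel: "euler_shift A i ?x - s_symbol i * ?x \<in> xspan A M ?G"
          using euler_relations_generator system_relations_superset(1)[OF M(1)] xspan_rel by blast
        have "coef_symbol (const_poly (- of_int (exp_action A i v'))) * ?x \<in> xspan A M ?G"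
          using x \<open>s_part 0 = 0\<close> by (intro xspan_coef[OF M(1)] sfree_single)
        then have "(euler_shift A i ?x - s_symbol i * ?x) + s_symbol i * ?x
            + coef_symbol (const_poly (- of_int (exp_action A i v'))) * ?x \<in> xspan A M ?G"
          using rel s by (intro xspan_add[OF M(1)])
        moreover have "coef_symbol (const_poly (- of_int (exp_action A i v'))) * ?x = - grading_deriv_symbol A i ?x"
          by (simp only: xd_symbol_def grading_deriv_symbol_single grading_deriv_single coef_symbol_single mult_single)
             (simp add: single_uminus)
        ultimately show "euler_symbol A i * ?x \<in> xspan A M ?G" by (simp add: euler_shift_def)
      qed
      then show ?thesis using K False by (metis not_le)
    qed
  qed
  then show ?thesis by blast
qed

lemma common_spanning_denominator:
  fixes A :: "int ^ 'n::finite ^ 'd::finite"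
  assumes I: "left_ideal_of UNIV I" and "finite B" and span: "\<And>v. in_span_mod_system A I E v"
  shows "\<exists>q :: ('d, 'n) sxpoly. q \<noteq> 0 \<and> (\<forall>b\<in>B. \<exists>c. coef_symbol q * d_symbol b
    - (\<Sum>u\<in>E. coef_symbol (c u) * d_symbol u) \<in> system_relations A I)"
  using assms(2)
proof (induction B rule: finite_induct)
  case empty
  show ?case by (intro exI[of _ 1]) simp
next
  case (insert x B)
  then obtain q :: "('d, 'n) sxpoly" where q: "q \<noteq> 0" "\<forall>b\<in>B. \<exists>c. coef_symbol q * d_symbol b
    - (\<Sum>u\<in>E. coef_symbol (c u) * d_symbol u) \<in> system_relations A I" by blast
  obtain q' :: "('d, 'n) sxpoly" and c' where q': "q' \<noteq> 0"
      "coef_symbol q' * d_symbol x - (\<Sum>u\<in>E. coef_symbol (c' u) * d_symbol u) \<in> system_relations A I"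
    using span[of x] unfolding in_span_mod_system_def by blast
  have scale: "\<exists>c. coef_symbol (r * p) * d_symbol b - (\<Sum>u\<in>E. coef_symbol (c u) * d_symbol u) \<in> system_relations A I"
    if "coef_symbol p * d_symbol b - (\<Sum>u\<in>E. coef_symbol (c u) * d_symbol u) \<in> system_relations A I"
    for r p :: "('d, 'n) sxpoly" and b c
  proof -
    have "coef_symbol r * (coef_symbol p * d_symbol b - (\<Sum>u\<in>E. coef_symbol (c u) * d_symbol u))
        = coef_symbol (r * p) * d_symbol b - (\<Sum>u\<in>E. coef_symbol (r * c u) * d_symbol u)"
      by (simp add: right_diff_distrib coef_symbol_mult sum_distrib_left mult.assoc)
    then show ?thesis using system_relations_coef[OF I that, of r]
      by (intro exI[of _ "\<lambda>u. r * c u"]) simp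
  qed
  have "\<exists>c. coef_symbol (q * q') * d_symbol b - (\<Sum>u\<in>E. coef_symbol (c u) * d_symbol u) \<in> system_relations A I"
    if "b \<in> insert x B" for b
  proof (cases "b = x")
    case True
    then show ?thesis using scale[OF q'(2), of q] by simp
  next
    case False
    then have "b \<in> B" using that by simp
    then obtain c where "coef_symbol q * d_symbol b - (\<Sum>u\<in>E. coef_symbol (c u) * d_symbol u) \<in> system_relations A I"
      using q(2) by blast
    from scale[OF this, of q'] show ?thesis by (simp add: mult.commute)
  qed
  then show ?case using q(1) q'(1) by (intro exI[of _ "q * q'"]) simp
qed

lemma s_coeff_nonzero:
  assumes "m0 \<in> keys q"
  shows "s_coeff (s_part m0) q \<noteq> 0"
proof -
  have "xexp (x_part m) = (xexp (x_part m0) :: ('a, 'b) indet \<Rightarrow>\<^sub>0 nat) \<longleftrightarrow> m = m0"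
    if "s_part m = s_part m0" for m :: "('a, 'b) indet \<Rightarrow>\<^sub>0 nat"
    using that indet_exp_split[of m] indet_exp_split[of m0] by metis
  then have "lookup (s_coeff (s_part m0) q) (xexp (x_part m0))
      = (\<Sum>m\<in>{m\<in>keys q. s_part m = s_part m0}. if m = m0 then lookup q m else 0)"
    unfolding s_coeff_def lookup_sum by (intro sum.cong) (auto simp: lookup_single)
  also have "\<dots> = lookup q m0" using assms by (simp add: sum.delta')
  finally show ?thesis using assms by (auto simp: in_keys_iff)
qed

lemma s_coeff_symbol_expansion:
  "coef_symbol q = (\<Sum>a\<in>s_part ` keys q. coef_symbol (s_coeff a q) * s_monom a)"
  by (subst s_coeff_expansion[of q])
     (simp add: coef_symbol_sum coef_symbol_mult s_monom_def mult.commute)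

text \<open>Division by a polynomial \<open>q\<close> with leading \<open>s\<close>-exponent \<open>g\<close>, up to factors in \<open>C[x]\<close>.\<close>

lemma division_by_denominator:
  fixes A :: "int ^ 'n::finite ^ 'd::finite" and q :: "('d, 'n) sxpoly"
  assumes I: "left_ideal_of UNIV I" and "finite E" "finite B" and q: "q \<noteq> 0"
    and rel: "\<forall>b\<in>B. \<exists>c. coef_symbol q * d_symbol b - (\<Sum>u\<in>E. coef_symbol (c u) * d_symbol u) \<in> system_relations A I"
  shows "\<exists>C g. \<forall>m a b. tdeg a \<le> m \<longrightarrow> b \<in> B \<longrightarrow> s_monom a * d_symbol b \<in> xspan_sat A I
    ((\<lambda>(a, u). s_monom a * d_symbol u) ` ({a. tdeg a \<le> m + C} \<times> E)
     \<union> (\<lambda>(a, b). s_monom a * d_symbol b) ` ({a. tdeg a \<le> m \<and> \<not> (\<exists>w. a = g + w)} \<times> B))"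
proof -
  from bchoice[OF rel] obtain c where c: "\<forall>b\<in>B. coef_symbol q * d_symbol b
      - (\<Sum>u\<in>E. coef_symbol (c b u) * d_symbol u) \<in> system_relations A I" ..
  \<comment> \<open>Bounds the degree in \<open>s\<close> of all coefficients in the relations
    expressing the \<open>q \<partial>\<^sup>b\<close> by \<open>E\<close>.\<close>
  define C where "C = (\<Sum>b\<in>B. \<Sum>u\<in>E. \<Sum>a\<in>s_part ` keys (c b u). tdeg a)"
  have C: "tdeg a \<le> C" if "b \<in> B" "u \<in> E" "a \<in> s_part ` keys (c b u)" for a b u
  proof -
    have "tdeg a \<le> (\<Sum>a\<in>s_part ` keys (c b u). tdeg a)"
      using that(3) by (intro member_le_sum) auto
    also have "\<dots> \<le> (\<Sum>u\<in>E. \<Sum>a\<in>s_part ` keys (c b u). tdeg a)"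
      using that(2) assms(2) by (intro member_le_sum[where f = "\<lambda>u. \<Sum>a\<in>s_part ` keys (c b u). tdeg a"]) auto
    also have "\<dots> \<le> C" unfolding C_def
      using that(1) assms(3) by (intro member_le_sum[where f = "\<lambda>b. \<Sum>u\<in>E. \<Sum>a\<in>s_part ` keys (c b u). tdeg a"]) auto
    finally show ?thesis .
  qed
  define S where "S = s_part ` keys q"
  have finS: "finite S" by (simp add: S_def)
  have "keys q \<noteq> {}"
    using q by (metis lookup_zero poly_mapping_eqI in_keys_iff all_not_in_conv)
  then have "graded_key ` S \<noteq> {}" by (simp add: S_def)
  then have "Max (graded_key ` S) \<in> graded_key ` S" using finS by (intro Max_in) auto
  \<comment> \<open>The leading exponent of \<open>q\<close> in \<open>s\<close> for the graded
    order. Its coefficient is a nonzero element of \<open>C[x]\<close>, which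
    \<open>xspan_sat\<close> allows to cancel.\<close>
  then obtain g where g: "g \<in> S" "graded_key g = Max (graded_key ` S)" by auto
  have g_max: "graded_key a < graded_key g" if "a \<in> S" "a \<noteq> g" for a
  proof -
    have "graded_key a \<le> graded_key g" using that(1) finS unfolding g(2) by (intro Max_ge) auto
    moreover have "graded_key a \<noteq> graded_key g" using that(2) by simp
    ultimately show ?thesis by (rule le_neq_trans)
  qed
  have g_nz: "s_coeff g q \<noteq> 0" using g(1) s_coeff_nonzero by (auto simp: S_def)
  define H where "H m = (\<lambda>(a, u). s_monom a * d_symbol u :: ('d, 'n) symbol) ` ({a. tdeg a \<le> m + C} \<times> E)
     \<union> (\<lambda>(a, b). s_monom a * d_symbol b) ` ({a. tdeg a \<le> m \<and> \<not> (\<exists>w. a = g + w)} \<times> B)" for m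
  have finH: "finite (H m)" for m
    unfolding H_def using assms(2,3)
    by (intro finite_UnI finite_imageI finite_cartesian_product)
       (auto intro: finite_subset[OF _ finite_tdeg_le])
  have "s_monom a * d_symbol b \<in> xspan_sat A I (H m)" if "tdeg a \<le> m" "b \<in> B" for m a b
    using that(1)
  proof (induction a rule: graded_key_induct)
    case (less a)
    show ?case
    proof (cases "\<exists>w. a = g + w")
      case False
      then have "s_monom a * d_symbol b \<in> H m" unfolding H_def
        using less.prems that(2) by (intro UnI2 image_eqI[of _ _ "(a, b)"]) auto
      then show ?thesis using xspan_base[OF I finH] xspan_sat_superset by blast
    next
      case True
      then obtain w where w: "a = g + w" ..
      have 1: "s_monom w * (coef_symbol q * d_symbol b) \<in> xspan A I (H m)"
      proof -
        let ?r = "coef_symbol q * d_symbol b - (\<Sum>u\<in>E. coef_symbol (c b u) * d_symbol u)"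
        have "s_monom w * ?r \<in> xspan A I (H m)"
          unfolding s_monom_def using c that(2) by (intro xspan_rel system_relations_coef[OF I]) auto
        moreover have "s_monom w * (\<Sum>u\<in>E. coef_symbol (c b u) * d_symbol u) \<in> xspan A I (H m)"
        proof -
          have "s_monom w * (\<Sum>u\<in>E. coef_symbol (c b u) * d_symbol u)
            = (\<Sum>u\<in>E. \<Sum>e\<in>s_part ` keys (c b u). coef_symbol (s_coeff e (c b u)) * (s_monom (e + w) * d_symbol u))"
            unfolding s_coeff_symbol_expansion[of "c b _"]
            by (simp only: sum_distrib_left sum_distrib_right s_monom_add mult_ac)
          also have "\<dots> \<in> xspan A I (H m)"
          proof (intro xspan_sum[OF I] xspan_coef[OF I] xspan_base[OF I finH])
            fix u e assume u: "u \<in> E" and e: "e \<in> s_part ` keys (c b u)"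
            have "tdeg (e + w) \<le> m + C" using C[OF that(2) u e] less.prems w by (simp add: tdeg_add)
            then show "s_monom (e + w) * d_symbol u \<in> H m" unfolding H_def
              using u by (intro UnI1 image_eqI[of _ _ "(e + w, u)"]) auto
          qed (rule sfree_s_coeff)
          finally show ?thesis .
        qed
        ultimately have "s_monom w * ?r + s_monom w * (\<Sum>u\<in>E. coef_symbol (c b u) * d_symbol u) \<in> xspan A I (H m)"
          by (rule xspan_add[OF I])
        then show ?thesis by (simp add: right_diff_distrib)
      qed
      have 2: "(\<Sum>e\<in>S - {g}. coef_symbol (- s_coeff e q) * (s_monom (e + w) * d_symbol b)) \<in> xspan_sat A I (H m)"
      proof (intro xspan_sat_sum[OF I] xspan_sat_coef[OF I])
        fix e assume e: "e \<in> S - {g}"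
        have "graded_key (e + w) < graded_key a"
          unfolding w graded_key_add using g_max[of e] e by simp
        moreover from this have "tdeg (e + w) \<le> m"
          using tdeg_le_of_graded_key_le[OF less_imp_le, of "e + w" a] less.prems by simp
        ultimately show "s_monom (e + w) * d_symbol b \<in> xspan_sat A I (H m)" by (rule less.IH)
        show "sfree (- s_coeff e q)" using sfree_diff[OF sfree_0 sfree_s_coeff, of e q] by simp
      qed
      \<comment> \<open>Solve \<open>s\<^sup>w q \<partial>\<^sup>b\<close> for its leading term in
        \<open>s\<close>. The product itself lies in the span by the relation for
        \<open>q \<partial>\<^sup>b\<close>, and the remaining terms have smaller exponents, so the
        induction covers them.\<close>
      have "coef_symbol (s_coeff g q) * (s_monom a * d_symbol b)
          = s_monom w * (coef_symbol q * d_symbol b) + (\<Sum>e\<in>S - {g}. coef_symbol (- s_coeff e q) * (s_monom (e + w) * d_symbol b))"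
      proof -
        have "s_monom w * (coef_symbol q * d_symbol b)
            = (\<Sum>e\<in>S. coef_symbol (s_coeff e q) * (s_monom (e + w) * d_symbol b))"
          unfolding s_coeff_symbol_expansion[of q] S_def
          by (simp only: sum_distrib_left sum_distrib_right s_monom_add mult_ac)
        also have "\<dots> = coef_symbol (s_coeff g q) * (s_monom a * d_symbol b)
            + (\<Sum>e\<in>S - {g}. coef_symbol (s_coeff e q) * (s_monom (e + w) * d_symbol b))"
          using finS g(1) by (subst sum.remove[of S g]) (auto simp: w)
        finally show ?thesis by (simp add: coef_symbol_uminus sum_negf)
      qed
      also have "\<dots> \<in> xspan_sat A I (H m)" using 1 2 xspan_sat_superset by (intro xspan_sat_add[OF I]) auto
      finally show ?thesis by (rule xspan_sat_cancel[OF _ g_nz sfree_s_coeff])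
    qed
  qed
  then show ?thesis unfolding H_def by blast
qed

text \<open>A difference of two polynomials in \<open>m\<close> with the same leading term, hence of
  lower order: the remainders of the division do not affect the degree.\<close>

lemma card_not_multiples:
  fixes g :: "'v::finite \<Rightarrow>\<^sub>0 nat"
  assumes "tdeg g \<le> m"
  shows "card {a. tdeg a \<le> m \<and> \<not> (\<exists>w. a = g + w)}
    = ((m + CARD('v)) choose m) - ((m - tdeg g + CARD('v)) choose (m - tdeg g))"
proof -
  have "{a. tdeg a \<le> m \<and> \<not> (\<exists>w. a = g + w)} = {a. tdeg a \<le> m} - (+) g ` {w. tdeg w \<le> m - tdeg g}"
    using assms by (auto simp: tdeg_add)
  moreover have "(+) g ` {w. tdeg w \<le> m - tdeg g} \<subseteq> {a. tdeg a \<le> m}"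
    using assms by (auto simp: tdeg_add)
  moreover have "card ((+) g ` {w. tdeg w \<le> m - tdeg g}) = (m - tdeg g + CARD('v)) choose (m - tdeg g)"
    by (simp add: card_image card_tdeg_le)
  ultimately show ?thesis
    by (simp add: card_Diff_subset finite_tdeg_le card_tdeg_le del: Diff_iff)
qed

text \<open>The right-hand side counts the generators left by the division:
  \<open>s\<close>-monomials times \<open>E\<close>, with \<open>C\<close> the extra degree from the
  denominator, and the remainders, with \<open>e\<close> the degree of the leading exponent and
  \<open>b\<close> the number of the bounded \<open>\<partial>\<close>-monomials.\<close>

lemma standard_card_le:
  fixes A :: "int ^ 'n::finite ^ 'd::finite"
  assumes M: "graded_ideal A M" "face_independent A M" and fin: "finite E"
    and span: "\<And>v. in_span_mod_system A M E v"
  shows "\<exists>C e b. \<forall>m\<ge>e. card (standard_exps M m)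
    \<le> card E * ((m + C + CARD('d)) choose (m + C)) + b * (((m + CARD('d)) choose m) - ((m - e + CARD('d)) choose (m - e)))"
proof -
  have M': "left_ideal_of UNIV M" using M(1) by (simp add: graded_ideal_def)
  obtain K where K: "\<And>v. (xd_symbol v :: ('d, 'n) symbol) \<in> xspan A M (monomial_symbols (tdeg v) K)"
    using xd_symbol_in_xspan[OF M' M(2)] by blast
  define B where "B = {b :: 'n \<Rightarrow>\<^sub>0 nat. tdeg b \<le> K}"
  have finB: "finite B" unfolding B_def by (rule finite_tdeg_le)
  obtain q :: "('d, 'n) sxpoly" where q: "q \<noteq> 0" "\<forall>b\<in>B. \<exists>c. coef_symbol q * d_symbol b
    - (\<Sum>u\<in>E. coef_symbol (c u) * d_symbol u) \<in> system_relations A M"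
    using common_spanning_denominator[OF M' finB span] by blast
  obtain C g where Cg: "\<forall>m a b. tdeg a \<le> m \<longrightarrow> b \<in> B \<longrightarrow> s_monom a * d_symbol b \<in> xspan_sat A M
    ((\<lambda>(a, u). s_monom a * d_symbol u) ` ({a. tdeg a \<le> m + C} \<times> E)
     \<union> (\<lambda>(a, b). s_monom a * d_symbol b) ` ({a. tdeg a \<le> m \<and> \<not> (\<exists>w. a = g + w)} \<times> B))"
    using division_by_denominator[OF M' fin finB q] by blast
  define H where "H m = (\<lambda>(a, u). s_monom a * d_symbol u :: ('d, 'n) symbol) ` ({a. tdeg a \<le> m + C} \<times> E)
     \<union> (\<lambda>(a, b). s_monom a * d_symbol b) ` ({a. tdeg a \<le> m \<and> \<not> (\<exists>w. a = g + w)} \<times> B)" for m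
  have finN: "finite {a. tdeg a \<le> m \<and> \<not> (\<exists>w. a = g + w)}" for m
    by (rule finite_subset[OF _ finite_tdeg_le[of m]]) auto
  have finH: "finite (H m)" for m
    unfolding H_def using fin finB finN
    by (intro finite_UnI finite_imageI finite_cartesian_product finite_tdeg_le)
  \<comment> \<open>\<open>xd_symbol v\<close> is \<open>x\<^sup>v\<close> times
    \<open>d_symbol v\<close>, and the saturation cancels \<open>x\<^sup>v\<close>.\<close>
  have H: "d_symbol v \<in> xspan_sat A M (H m)" if vm: "tdeg v \<le> m" for v m
  proof -
    have "(xd_symbol v :: ('d, 'n) symbol) \<in> xspan_sat A M (H m)"
    proof (rule xspan_sat_trans[OF M' K])
      fix x :: "('d, 'n) symbol" assume "x \<in> monomial_symbols (tdeg v) K"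
      then obtain a b where "x = s_monom a * d_symbol b" "tdeg a \<le> m" "b \<in> B"
        using vm unfolding monomial_symbols_def B_def by fastforce
      then show "x \<in> xspan_sat A M (H m)" using Cg unfolding H_def by blast
    qed
    then show ?thesis unfolding xd_symbol_eq
    proof (rule xspan_sat_cancel)
      show "single (xexp v) (1::complex) \<noteq> (0 :: ('d, 'n) sxpoly)"
        by (metis lookup_single_eq lookup_zero zero_neq_one)
    qed (simp add: sfree_single)
  qed
  \<comment> \<open>The standard \<open>\<partial>\<^sup>v\<close> are independent over
    \<open>C[x]\<close> modulo the system: a relation is \<open>s\<close>-free, so its coefficients
    lie in \<open>M\<close>, and they are supported on standard exponents. Hence they are at most as
    many as the spanning symbols.\<close>
  have card_le: "card (standard_exps M m) \<le> card (H m)" for m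
  proof (rule ccontr)
    assume "\<not> card (standard_exps M m) \<le> card (H m)"
    let ?S = "standard_exps M m"
    have "\<forall>v\<in>?S. \<exists>f c. f \<noteq> 0 \<and> sfree f \<and> (\<forall>h. sfree (c h))
      \<and> coef_symbol f * d_symbol v - (\<Sum>h\<in>H m. coef_symbol (c h) * h) \<in> (system_relations A M :: ('d, 'n) symbol set)"
    proof
      fix v assume "v \<in> ?S"
      then have "d_symbol v \<in> xspan_sat A M (H m)" by (intro H) (simp add: standard_exps_def)
      then obtain f where f: "f \<noteq> 0" "sfree f" "coef_symbol f * d_symbol v \<in> xspan A M (H m)"
        unfolding xspan_sat_def by blast
      then show "\<exists>f c. f \<noteq> 0 \<and> sfree f \<and> (\<forall>h. sfree (c h))
        \<and> coef_symbol f * d_symbol v - (\<Sum>h\<in>H m. coef_symbol (c h) * h) \<in> (system_relations A M :: ('d, 'n) symbol set)"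
        unfolding xspan_def by blast
    qed
    from bchoice[OF this] obtain f where "\<forall>v\<in>?S. \<exists>c. f v \<noteq> 0 \<and> sfree (f v) \<and> (\<forall>h. sfree (c h))
      \<and> coef_symbol (f v) * d_symbol v - (\<Sum>h\<in>H m. coef_symbol (c h) * h) \<in> (system_relations A M :: ('d, 'n) symbol set)" ..
    from bchoice[OF this] obtain c where fc: "\<forall>v\<in>?S. f v \<noteq> 0 \<and> sfree (f v) \<and> (\<forall>h. sfree (c v h))
      \<and> coef_symbol (f v) * d_symbol v - (\<Sum>h\<in>H m. coef_symbol (c v h) * h) \<in> (system_relations A M :: ('d, 'n) symbol set)" ..
    have "\<exists>l. (\<forall>v. l v \<in> Collect sfree) \<and> (\<exists>v\<in>?S. l v \<noteq> 0) \<and> (\<forall>h\<in>H m. (\<Sum>v\<in>?S. l v * c v h) = 0)"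
      using \<open>\<not> card ?S \<le> card (H m)\<close> fc finH finite_standard_exps
      by (intro homogeneous_system_nontrivial) (auto intro: sfree_diff sfree_mult)
    then obtain l where l: "\<And>v. sfree (l v)" "\<exists>v\<in>?S. l v \<noteq> 0" "\<And>h. h \<in> H m \<Longrightarrow> (\<Sum>v\<in>?S. l v * c v h) = 0"
      by auto
    define P where "P = (\<Sum>v\<in>?S. coef_symbol (l v * f v) * d_symbol v)"
    have "(\<Sum>v\<in>?S. coef_symbol (l v) * (coef_symbol (f v) * d_symbol v - (\<Sum>h\<in>H m. coef_symbol (c v h) * h))) \<in> system_relations A M"
      using fc by (intro system_relations_sum[OF M'] system_relations_coef[OF M']) auto
    also have "(\<Sum>v\<in>?S. coef_symbol (l v) * (coef_symbol (f v) * d_symbol v - (\<Sum>h\<in>H m. coef_symbol (c v h) * h)))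
        = P - (\<Sum>h\<in>H m. coef_symbol (\<Sum>v\<in>?S. l v * c v h) * h)"
    proof -
      have "(\<Sum>v\<in>?S. coef_symbol (l v) * (\<Sum>h\<in>H m. coef_symbol (c v h) * h))
          = (\<Sum>v\<in>?S. \<Sum>h\<in>H m. coef_symbol (l v * c v h) * h)"
        by (simp add: sum_distrib_left coef_symbol_mult mult.assoc)
      also have "\<dots> = (\<Sum>h\<in>H m. coef_symbol (\<Sum>v\<in>?S. l v * c v h) * h)"
        by (subst sum.swap) (simp add: coef_symbol_sum sum_distrib_right)
      finally show ?thesis
        by (simp add: P_def right_diff_distrib sum_subtractf coef_symbol_mult mult.assoc)
    qed
    also have "\<dots> = P" using l(3) by simp
    finally have "P \<in> system_relations A M" .
    moreover have "sfree P" unfolding P_def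
    proof (intro sfree_sum sfree_mult sfree_coef_symbol l(1))
      show "sfree (f v)" if "v \<in> ?S" for v using fc that by blast
      show "sfree (d_symbol v :: ('d, 'n) symbol)" for v
        unfolding d_symbol_def by (rule sfree_single) (simp add: s_part_def)
    qed
    ultimately have P: "P \<in> extend_ideal M" by (rule sfree_system_relation[OF M(1)])
    have look: "lookup P k = (\<Sum>v\<in>?S. single v (lookup (l v * f v) k))" for k
    proof -
      have "lookup (coef_symbol e * d_symbol v) k = single v (lookup e k)"
        for e :: "('d, 'n) sxpoly" and v
      proof -
        have "coef_symbol e * d_symbol v = single 0 (single v 1) * coef_symbol e"
          by (simp add: d_symbol_def mult.commute)
        then show ?thesis
          using lookup_single_mult[of 0 "single v 1" "coef_symbol e" k]
          by (simp add: coef_symbol_def lookup_map mult_single)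
      qed
      then show ?thesis by (simp add: P_def lookup_sum)
    qed
    have zero: "lookup P k = 0" for k
    proof (rule standard_independent)
      show "lookup P k \<in> M" using P by (simp add: extend_ideal_def)
      have "keys (lookup P k) \<subseteq> ?S"
        unfolding look by (auto simp: in_keys_iff lookup_sum lookup_single when_def
          elim!: sum.not_neutral_contains_not_neutral split: if_splits)
      then show "keys (lookup P k) \<inter> leading_exps M = {}"
        by (auto simp: standard_exps_def)
    qed
    obtain v where v: "v \<in> ?S" "l v \<noteq> 0" using l(2) by blast
    have "lookup (l v * f v) k = 0" for k
    proof -
      have "lookup (lookup P k) v = lookup (l v * f v) k"
        unfolding look using v(1)
        by (simp add: finite_standard_exps lookup_sum lookup_single when_def sum.delta')
      then show ?thesis using zero[of k] by simp
    qed
    then have "l v * f v = 0" by (intro poly_mapping_eqI) simp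
    then show False using v fc by auto
  qed
  have "card (standard_exps M m)
      \<le> card E * ((m + C + CARD('d)) choose (m + C)) + card B * (((m + CARD('d)) choose m) - ((m - tdeg g + CARD('d)) choose (m - tdeg g)))"
    if "tdeg g \<le> m" for m
  proof -
    have "card (H m) \<le> card ({a :: 'd \<Rightarrow>\<^sub>0 nat. tdeg a \<le> m + C} \<times> E) + card ({a. tdeg a \<le> m \<and> \<not> (\<exists>w. a = g + w)} \<times> B)"
      unfolding H_def
      by (rule order_trans[OF card_Un_le add_mono[OF card_image_le card_image_le]])
         (use fin finB finN finite_tdeg_le in \<open>auto intro!: finite_cartesian_product\<close>)
    also have "card ({a :: 'd \<Rightarrow>\<^sub>0 nat. tdeg a \<le> m + C} \<times> E) = card E * ((m + C + CARD('d)) choose (m + C))"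
      unfolding card_cartesian_product card_tdeg_le by (rule mult.commute)
    also have "card ({a. tdeg a \<le> m \<and> \<not> (\<exists>w. a = g + w)} \<times> B)
        = card B * (((m + CARD('d)) choose m) - ((m - tdeg g + CARD('d)) choose (m - tdeg g)))"
      unfolding card_cartesian_product card_not_multiples[OF that] by (rule mult.commute)
    finally show ?thesis using card_le[of m] by linarith
  qed
  then show ?thesis
    by (intro allI impI exI[where x = C, OF exI[where x = "tdeg g", OF exI[where x = "card B"]]])
qed

section \<open>Comparing the degrees\<close>

lemma poly_eventually_nonneg_lead_coeff:
  fixes p :: "real poly"
  assumes "\<forall>\<^sub>F t in sequentially. 0 \<le> poly p (of_nat t)"
  shows "0 \<le> lead_coeff p"
proof (rule ccontr)
  assume "\<not> 0 \<le> lead_coeff p"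
  then have lc: "lead_coeff (- p) > 0" by simp
  then obtain n where n: "\<forall>x\<ge>n. lead_coeff (- p) \<le> poly (- p) x" using poly_pinfty_gt_lc by blast
  obtain t where t: "0 \<le> poly p (of_nat t)" "nat \<lceil>n\<rceil> \<le> t"
    using eventually_conj[OF assms eventually_ge_at_top[of "nat \<lceil>n\<rceil>"]]
    by (auto dest: eventually_happens)
  have "n \<le> of_nat t" using t(2) by linarith
  then have "lead_coeff (- p) \<le> - poly p (of_nat t)" using n by simp
  then show False using lc t(1) by linarith
qed

text \<open>If \<open>p\<close> had the larger degree, the leading coefficients of \<open>p\<close>
  and \<open>q - p\<close> would be opposite, while both are nonnegative.\<close>

lemma degree_le_of_eventually_le:
  fixes p q :: "real poly"
  assumes nonneg: "\<forall>\<^sub>F t in sequentially. 0 \<le> poly p (of_nat t)"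
    and le: "\<forall>\<^sub>F t in sequentially. poly p (of_nat t) \<le> poly q (of_nat t)"
    and q: "Polynomial.degree q \<le> d"
  shows "Polynomial.degree p \<le> d"
proof (rule ccontr)
  assume d: "\<not> Polynomial.degree p \<le> d"
  then have "Polynomial.degree q < Polynomial.degree p" using q by simp
  then have "Polynomial.degree (q - p) = Polynomial.degree p"
    by (metis degree_minus degree_add_eq_right diff_conv_add_uminus)
  moreover have "poly.coeff q (Polynomial.degree p) = 0"
    using \<open>Polynomial.degree q < Polynomial.degree p\<close> by (rule coeff_eq_0)
  ultimately have "lead_coeff (q - p) = - lead_coeff p" by simp
  moreover have "0 \<le> lead_coeff (q - p)"
    by (rule poly_eventually_nonneg_lead_coeff) (use le in \<open>auto elim: eventually_mono\<close>)
  moreover have "0 \<le> lead_coeff p" using nonneg by (rule poly_eventually_nonneg_lead_coeff)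
  ultimately have "lead_coeff p = 0" by simp
  then show False using d by simp
qed

lemma coeff_le_of_eventually_le:
  fixes p q :: "real poly"
  assumes le: "\<forall>\<^sub>F t in sequentially. poly p (of_nat t) \<le> poly q (of_nat t)"
    and d: "Polynomial.degree p \<le> d" "Polynomial.degree q \<le> d"
  shows "poly.coeff p d \<le> poly.coeff q d"
proof -
  have nonneg: "0 \<le> lead_coeff (q - p)"
    by (rule poly_eventually_nonneg_lead_coeff) (use le in \<open>auto elim: eventually_mono\<close>)
  have "Polynomial.degree (q - p) \<le> d" using d by (rule degree_diff_le[rotated])
  moreover have "0 \<le> poly.coeff (q - p) d" if "Polynomial.degree (q - p) = d"
    using nonneg unfolding that .
  moreover have "poly.coeff (q - p) d = 0" if "Polynomial.degree (q - p) < d"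
    using that by (rule coeff_eq_0)
  ultimately have "0 \<le> poly.coeff (q - p) d" by fastforce
  then show ?thesis by simp
qed

lemma poly_map_poly_of_rat: "poly (map_poly of_rat p) (of_rat x) = (of_rat (poly p x) :: real)"
  by (induction p) (simp_all add: map_poly_pCons of_rat_add of_rat_mult)

lemma coeff_pcompose_shift:
  fixes p :: "'a::idom poly"
  assumes "Polynomial.degree p = d"
  shows "Polynomial.degree (pcompose p [:c, 1:]) = d" "poly.coeff (pcompose p [:c, 1:]) d = poly.coeff p d"
proof -
  show deg: "Polynomial.degree (pcompose p [:c, 1:]) = d"
    unfolding degree_pcompose using assms by simp
  have "lead_coeff (pcompose p [:c, 1:]) = lead_coeff p * 1 ^ Polynomial.degree p"
    by (subst lead_coeff_comp) auto
  then show "poly.coeff (pcompose p [:c, 1:]) d = poly.coeff p d" using deg assms by simp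
qed

text \<open>Real coefficients, because the asymptotic comparison of polynomials takes place over the
  reals.\<close>

definition hilbert_real :: "'n::finite dpoly set \<Rightarrow> real poly" where
  "hilbert_real I = map_poly of_rat (affine_hilbert_poly I)"

lemma hilbert_real_eventually:
  assumes "left_ideal_of UNIV I"
  shows "\<forall>\<^sub>F t in sequentially. poly (hilbert_real I) (of_nat t) = of_nat (card (standard_exps I t))"
  using affine_hilbert_poly[OF assms]
proof eventually_elim
  case (elim t)
  then show ?case using poly_map_poly_of_rat[of "affine_hilbert_poly I" "of_nat t"]
    by (simp add: hilbert_real_def)
qed

lemma ideal_degree_real: "of_rat (ideal_degree d I) = fact d * poly.coeff (hilbert_real I) d"
  by (simp add: ideal_degree_def hilbert_real_def of_rat_mult coeff_map_poly)
     (metis of_nat_fact of_rat_of_nat_eq)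

lemma hilbert_real_nonneg:
  assumes "left_ideal_of UNIV I"
  shows "\<forall>\<^sub>F t in sequentially. 0 \<le> poly (hilbert_real I) (of_nat t)"
  using hilbert_real_eventually[OF assms] by eventually_elim simp

lemma binomial_real: "poly (binomial_poly d) (real m) = real ((m + d) choose m)"
  using binomial_symmetric[of m "m + d"] by (simp add: poly_binomial_poly)

lemma ideal_degree_le_spanning:
  fixes A :: "int ^ 'n::finite ^ 'd::finite"
  assumes M: "graded_ideal A M" "face_independent A M" and fin: "finite E"
    and span: "\<And>v. in_span_mod_system A M E v"
  shows "of_rat (ideal_degree CARD('d) M) \<le> (of_nat (card E) :: real)"
proof -
  let ?d = "CARD('d)"
  have M': "left_ideal_of UNIV M" using M(1) by (simp add: graded_ideal_def)
  obtain C e b where bound: "\<And>m. m \<ge> e \<Longrightarrow> card (standard_exps M m)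
    \<le> card E * ((m + C + ?d) choose (m + C)) + b * (((m + ?d) choose m) - ((m - e + ?d) choose (m - e)))"
    using standard_card_le[OF M fin span] by blast
  define B where "B = (binomial_poly ?d :: real poly)"
  have B: "Polynomial.degree B = ?d" "poly.coeff B ?d = 1 / fact ?d"
    by (simp_all add: B_def degree_binomial_poly coeff_binomial_poly)
  \<comment> \<open>Shifts preserve the leading coefficient, so the second summand cancels in degree
    \<open>d\<close> and \<open>card E / d!\<close> remains.\<close>
  define q where "q = Polynomial.smult (of_nat (card E)) (pcompose B [:of_nat C, 1:])
    + Polynomial.smult (of_nat b) (B - pcompose B [:- of_nat e, 1:])"
  have degB: "Polynomial.degree (pcompose B [:c, 1:]) = ?d" "poly.coeff (pcompose B [:c, 1:]) ?d = 1 / fact ?d" for c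
    using coeff_pcompose_shift[OF B(1), of c] B(2) by simp_all
  have deg: "Polynomial.degree q \<le> ?d"
    unfolding q_def using B(1) degB(1)
    by (intro degree_add_le order_trans[OF degree_smult_le] degree_diff_le) auto
  have coeff: "poly.coeff q ?d = of_nat (card E) / fact ?d"
    by (simp add: q_def B(2) degB(2))
  have le: "\<forall>\<^sub>F t in sequentially. poly (hilbert_real M) (of_nat t) \<le> poly q (of_nat t)"
    using hilbert_real_eventually[OF M'] eventually_ge_at_top[of e]
  proof eventually_elim
    case (elim m)
    have "((m - e + ?d) choose (m - e)) \<le> ((m + ?d) choose m)"
    proof -
      have "card {u :: 'd \<Rightarrow>\<^sub>0 nat. tdeg u \<le> m - e} \<le> card {u :: 'd \<Rightarrow>\<^sub>0 nat. tdeg u \<le> m}"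
        by (rule card_mono[OF finite_tdeg_le]) auto
      then show ?thesis unfolding card_tdeg_le .
    qed
    then have "real (card (standard_exps M m)) \<le> real (card E) * real ((m + C + ?d) choose (m + C))
        + real b * (real ((m + ?d) choose m) - real ((m - e + ?d) choose (m - e)))"
      using bound[OF elim(2)] by (metis (mono_tags, lifting) of_nat_add of_nat_diff of_nat_le_iff of_nat_mult)
    also have "\<dots> = poly q (of_nat m)"
      using elim(2) binomial_real[of ?d "m + C"] binomial_real[of ?d "m - e"] binomial_real[of ?d m]
      by (simp add: q_def poly_pcompose B_def of_nat_diff add.commute)
    finally show ?case using elim(1) by simp
  qed
  \<comment> \<open>The upper bound also limits the degree, so the coefficients in degree
    \<open>d\<close> may be compared.\<close>
  have "Polynomial.degree (hilbert_real M) \<le> ?d"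
    using hilbert_real_nonneg[OF M'] le deg by (rule degree_le_of_eventually_le)
  then have "poly.coeff (hilbert_real M) ?d \<le> of_nat (card E) / fact ?d"
    using coeff_le_of_eventually_le[OF le _ deg] coeff by simp
  then show ?thesis by (simp add: ideal_degree_real field_simps)
qed

section \<open>The degree of the toric ideal as an upper bound for independent sets\<close>

lemma toric_ideal_binomial:
  "A *v int_exponent u = A *v int_exponent v \<Longrightarrow> single u 1 - single v 1 \<in> toric_ideal A"
  unfolding toric_ideal_def by (rule subsetD[OF left_ideal_gen_superset]) auto

text \<open>Standard exponents have distinct degrees \<open>Au\<close>, since otherwise a binomial
  of \<open>I\<^sub>A\<close> would be supported on them. For \<open>tdeg u \<le> m\<close> these
  degrees lie in a cube of side \<open>2cm + 1\<close>. So the Hilbert polynomial has degree at most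
  \<open>d\<close>.\<close>

lemma card_standard_exps_toric_le:
  fixes A :: "int ^ 'n::finite ^ 'd::finite"
  shows "\<exists>c. \<forall>m. card (standard_exps (toric_ideal A) m) \<le> (2 * (c * m) + 1) ^ CARD('d)"
proof -
  have I: "left_ideal_of UNIV (toric_ideal A)" unfolding toric_ideal_def by (rule left_ideal_of_gen_UNIV)
  define c where "c = (\<Sum>i\<in>UNIV. \<Sum>j\<in>UNIV. nat \<bar>A $ i $ j\<bar>)"
  have c: "nat \<bar>A $ i $ j\<bar> \<le> c" for i j
  proof -
    have "nat \<bar>A $ i $ j\<bar> \<le> (\<Sum>j\<in>UNIV. nat \<bar>A $ i $ j\<bar>)" by (rule member_le_sum) auto
    also have "\<dots> \<le> c" unfolding c_def by (rule member_le_sum[where f = "\<lambda>i. \<Sum>j\<in>UNIV. nat \<bar>A $ i $ j\<bar>"]) auto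
    finally show ?thesis .
  qed
  have "card (standard_exps (toric_ideal A) m) \<le> (2 * (c * m) + 1) ^ CARD('d)" for m
  proof -
    let ?S = "standard_exps (toric_ideal A) m"
    let ?f = "\<lambda>u i. exp_action A i u"
    have "inj_on ?f ?S"
    proof (rule inj_onI)
      fix u v assume u: "u \<in> ?S" and v: "v \<in> ?S" and eq: "?f u = ?f v"
      show "u = v"
      proof (rule ccontr)
        assume "u \<noteq> v"
        have "A *v int_exponent u = A *v int_exponent v"
          using eq by (simp add: vec_eq_iff fun_eq_iff exp_action_def)
        then have "single u 1 - single v 1 \<in> toric_ideal A"
          by (rule toric_ideal_binomial)
        then have "(single u 1 - single v 1 :: 'n dpoly) = 0"
        proof (rule standard_independent)
          show "keys (single u 1 - single v 1 :: 'n dpoly) \<inter> leading_exps (toric_ideal A) = {}"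
            using u v by (auto simp: in_keys_iff lookup_minus lookup_single when_def standard_exps_def split: if_splits)
        qed
        then have "lookup (single u 1 - single v 1 :: 'n dpoly) u = 0" by simp
        then show False using \<open>u \<noteq> v\<close> by (simp add: lookup_minus lookup_single)
      qed
    qed
    moreover have "?f ` ?S \<subseteq> (UNIV \<rightarrow>\<^sub>E {- int (c * m)..int (c * m)})"
    proof
      fix x assume "x \<in> ?f ` ?S"
      then obtain u where u: "x = ?f u" "tdeg u \<le> m" by (auto simp: standard_exps_def)
      have "\<bar>exp_action A i u\<bar> \<le> int (c * m)" for i
      proof -
        have "\<bar>exp_action A i u\<bar> \<le> (\<Sum>j\<in>UNIV. \<bar>A $ i $ j * int (lookup u j)\<bar>)"
          unfolding exp_action_eq by (rule sum_abs)
        also have "\<dots> \<le> (\<Sum>j\<in>UNIV. int c * int (lookup u j))"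
        proof (rule sum_mono)
          fix j
          have "\<bar>A $ i $ j\<bar> \<le> int c" using c[of i j] by linarith
          then show "\<bar>A $ i $ j * int (lookup u j)\<bar> \<le> int c * int (lookup u j)"
            by (simp add: abs_mult mult_right_mono)
        qed
        also have "\<dots> = int c * int (tdeg u)" by (simp add: tdeg_def sum_distrib_left)
        also have "\<dots> \<le> int (c * m)" using u(2) by (simp add: mult_left_mono)
        finally show ?thesis .
      qed
      then have "exp_action A i u \<in> {- int (c * m)..int (c * m)}" for i using abs_le_D1 abs_le_D2 by fastforce
      then show "x \<in> (UNIV \<rightarrow>\<^sub>E {- int (c * m)..int (c * m)})" using u(1) by auto
    qed
    ultimately have "card ?S \<le> card (UNIV \<rightarrow>\<^sub>E {- int (c * m)..int (c * m)} :: ('d \<Rightarrow> int) set)"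
      by (intro card_inj_on_le) (auto intro: finite_PiE)
    also have "\<dots> = (2 * (c * m) + 1) ^ CARD('d)"
    proof -
      have "card {- int (c * m)..int (c * m)} = 2 * (c * m) + 1"
        unfolding card_atLeastAtMost_int by linarith
      then show ?thesis by (simp add: card_PiE)
    qed
    finally show ?thesis .
  qed
  then show ?thesis by blast
qed

lemma independent_le_ideal_degree:
  fixes A :: "int ^ 'n::finite ^ 'd::finite"
  assumes I: "graded_ideal A (toric_ideal A)" and fin: "finite E"
    and indep: "independent_mod_system A (toric_ideal A) E"
  shows "(of_nat (card E) :: real) \<le> of_rat (ideal_degree CARD('d) (toric_ideal A))"
proof -
  let ?d = "CARD('d)" and ?I = "toric_ideal A"
  have I': "left_ideal_of UNIV ?I" using I by (simp add: graded_ideal_def)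
  define k where "k = (\<Sum>u\<in>E. tdeg u)"
  have k: "tdeg u \<le> k" if "u \<in> E" for u
    unfolding k_def using fin that by (intro member_le_sum) auto
  obtain c where c: "\<And>m. card (standard_exps ?I m) \<le> (2 * (c * m) + 1) ^ ?d"
    using card_standard_exps_toric_le[of A] by blast
  define q where "q = [:1, 2 * of_nat c :: real:] ^ ?d"
  have "Polynomial.degree q \<le> ?d"
    unfolding q_def using degree_power_le[of "[:1, 2 * of_nat c :: real:]" ?d]
    by (rule order_trans) simp
  moreover have "\<forall>\<^sub>F t in sequentially. poly (hilbert_real ?I) (of_nat t) \<le> poly q (of_nat t)"
    using hilbert_real_eventually[OF I']
  proof eventually_elim
    case (elim t)
    have "real (card (standard_exps ?I t)) \<le> real ((2 * (c * t) + 1) ^ ?d)" using c of_nat_le_iff by blast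
    also have "\<dots> = poly q (of_nat t)" by (simp add: q_def algebra_simps)
    finally show ?case using elim by simp
  qed
  ultimately have deg: "Polynomial.degree (hilbert_real ?I) \<le> ?d"
    using degree_le_of_eventually_le[OF hilbert_real_nonneg[OF I']] by blast
  define p where "p = Polynomial.smult (of_nat (card E)) (pcompose (binomial_poly ?d) [:- of_nat k, 1 :: real:])"
  have p: "Polynomial.degree p \<le> ?d" "poly.coeff p ?d = of_nat (card E) / fact ?d"
    using coeff_pcompose_shift[OF degree_binomial_poly[of ?d, where ?'a = real], of "- of_nat k"]
    by (auto simp: p_def coeff_binomial_poly intro: order_trans[OF degree_smult_le])
  have "\<forall>\<^sub>F t in sequentially. poly p (of_nat t) \<le> poly (hilbert_real ?I) (of_nat t)"
    using hilbert_real_eventually[OF I'] eventually_ge_at_top[of k]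
  proof eventually_elim
    case (elim t)
    \<comment> \<open>The monomials of \<open>E\<close> use up degree at most \<open>k\<close>,
      which leaves \<open>t - k\<close> for the monomials in \<open>s\<close>.\<close>
    have "card E * ((t - k + ?d) choose (t - k)) \<le> card (standard_exps ?I (t - k + k))"
      by (rule independent_card_le[OF I fin indep k])
    then have "real (card E) * real ((t - k + ?d) choose (t - k)) \<le> real (card (standard_exps ?I t))"
      using elim(2) by (metis le_add_diff_inverse2 of_nat_le_iff of_nat_mult)
    moreover have "poly p (of_nat t) = real (card E) * real ((t - k + ?d) choose (t - k))"
      using elim(2) binomial_real[of ?d "t - k"] by (simp add: p_def poly_pcompose of_nat_diff)
    ultimately show ?case using elim(1) by simp
  qed
  from coeff_le_of_eventually_le[OF this p(1) deg]
  have "of_nat (card E) / fact ?d \<le> poly.coeff (hilbert_real ?I) ?d" by (simp add: p(2))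
  then show ?thesis by (simp add: ideal_degree_real field_simps)
qed

section \<open>Gradedness and face independence of the ideals in question\<close>

lemma graded_ideal_gen:
  assumes "\<And>i g. g \<in> G \<Longrightarrow> grading_deriv A i g \<in> poly_ideal G"
  shows "graded_ideal A (poly_ideal G)"
proof -
  let ?I = "poly_ideal G"
  have I: "left_ideal_of UNIV ?I" by (rule left_ideal_of_gen_UNIV)
  \<comment> \<open>By the Leibniz rule the elements on the right form an ideal, so the generators
    decide.\<close>
  have "?I \<subseteq> {p \<in> ?I. \<forall>i. grading_deriv A i p \<in> ?I}"
  proof (rule left_ideal_gen_minimal)
    show "G \<subseteq> {p \<in> ?I. \<forall>i. grading_deriv A i p \<in> ?I}"
      using assms left_ideal_gen_superset by blast
    show "left_ideal_of UNIV {p \<in> ?I. \<forall>i. grading_deriv A i p \<in> ?I}"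
      unfolding left_ideal_of_def
      using left_ideal_zero[OF I] left_ideal_add[OF I] left_ideal_mult[OF I]
      by (auto simp: grading_deriv_add grading_deriv_mult)
  qed
  then show ?thesis unfolding graded_ideal_def using I by blast
qed

lemma graded_ideal_toric:
  fixes A :: "int ^ 'n::finite ^ 'd::finite"
  shows "graded_ideal A (toric_ideal A)"
  unfolding toric_ideal_def
proof (rule graded_ideal_gen)
  fix i and g :: "'n dpoly"
  assume "g \<in> {single u 1 - single v 1 | u v. A *v int_exponent u = A *v int_exponent v}"
  then obtain u v where g: "g = single u 1 - single v 1" "A *v int_exponent u = A *v int_exponent v"
    by blast
  have "grading_deriv A i g = const_poly (of_int (exp_action A i u)) * g"
  proof -
    have "grading_deriv A i (p - q) = grading_deriv A i p - grading_deriv A i q" for p q :: "'n dpoly"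
      by (rule poly_mapping_eqI) (simp add: lookup_grading_deriv lookup_minus right_diff_distrib)
    moreover have "exp_action A i v = exp_action A i u" using g(2) by (simp add: exp_action_def)
    ultimately show ?thesis
      unfolding g(1) by (simp only: grading_deriv_single right_diff_distrib mult_single add_0)
  qed
  moreover have "g \<in> poly_ideal {single u 1 - single v 1 | u v. A *v int_exponent u = A *v int_exponent v}"
    using toric_ideal_binomial[OF g(2)] unfolding g(1) toric_ideal_def .
  ultimately show "grading_deriv A i g \<in> poly_ideal {single u 1 - single v 1 | u v. A *v int_exponent u = A *v int_exponent v}"
    using left_ideal_mult[OF left_ideal_of_gen_UNIV] by simp
qed

lemma graded_ideal_monomial:
  assumes "monomial_ideal M"
  shows "graded_ideal A M"
proof -
  obtain S where M: "M = poly_ideal ((\<lambda>u. single u 1) ` S)"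
    using assms by (auto simp: monomial_ideal_def)
  show ?thesis unfolding M
  proof (rule graded_ideal_gen)
    fix i and g :: "'a dpoly" assume g: "g \<in> (\<lambda>u. single u 1) ` S"
    then obtain u where u: "g = single u 1" by blast
    have "grading_deriv A i g = const_poly (of_int (exp_action A i u)) * g"
      unfolding u by (simp only: grading_deriv_single mult_single add_0)
    moreover have "g \<in> poly_ideal ((\<lambda>u. single u 1) ` S)"
      using g by (rule subsetD[OF left_ideal_gen_superset])
    ultimately show "grading_deriv A i g \<in> poly_ideal ((\<lambda>u. single u 1) ` S)"
      using left_ideal_mult[OF left_ideal_of_gen_UNIV] by simp
  qed
qed

text \<open>The polynomials all of whose monomials lie in \<open>M\<close> form an ideal containing
  the monomial generators.\<close>

lemma monomial_ideal_terms:
  fixes M :: "'n::finite dpoly set"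
  assumes "monomial_ideal M" "p \<in> M" "u \<in> keys p"
  shows "single u 1 \<in> M"
proof -
  obtain S where M: "M = poly_ideal ((\<lambda>u. single u 1) ` S)"
    using assms(1) by (auto simp: monomial_ideal_def)
  have ideal: "left_ideal_of UNIV M" unfolding M by (rule left_ideal_of_gen_UNIV)
  define Y where "Y = {p :: 'n dpoly. \<forall>u\<in>keys p. single u 1 \<in> M}"
  have mult: "r * p \<in> Y" if p: "p \<in> Y" for r p
    unfolding Y_def
  proof (intro CollectI ballI)
    fix x assume "x \<in> keys (r * p)"
    then obtain a b where ab: "x = a + b" "b \<in> keys p" using keys_mult[of r p] by blast
    then have "single a 1 * single b 1 \<in> M"
      using p by (intro left_ideal_mult[OF ideal]) (auto simp: Y_def)
    then show "single x 1 \<in> M" using ab(1) by (simp add: mult_single)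
  qed
  have add: "p + q \<in> Y" if "p \<in> Y" "q \<in> Y" for p q
    using that keys_add[of p q] unfolding Y_def by blast
  have zero: "0 \<in> Y" by (simp add: Y_def)
  have "left_ideal_of UNIV Y"
    unfolding left_ideal_of_def using zero add mult by blast
  moreover have "(\<lambda>u. single u 1) ` S \<subseteq> Y"
  proof
    fix g :: "'n dpoly" assume g: "g \<in> (\<lambda>u. single u 1) ` S"
    then have "g \<in> M" unfolding M by (rule subsetD[OF left_ideal_gen_superset])
    moreover obtain u where "g = single u 1" using g by blast
    ultimately show "g \<in> Y" by (simp add: Y_def)
  qed
  ultimately have "M \<subseteq> Y" unfolding M by (intro left_ideal_gen_minimal)
  then show ?thesis using assms(2,3) by (auto simp: Y_def)
qed

lemma face_independent_initial:
  fixes A :: "int ^ 'n::finite ^ 'd::finite"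
  assumes "monomial_ideal (initial_ideal w (toric_ideal A))"
  shows "face_independent A (initial_ideal w (toric_ideal A))"
  unfolding face_independent_def
proof (intro allI impI)
  fix u v :: "'n \<Rightarrow>\<^sub>0 nat"
  assume eq: "A *v int_exponent u = A *v int_exponent v" and "u \<noteq> v"
  let ?p = "single u 1 - single v 1 :: 'n dpoly"
  have keys: "keys ?p = {u, v}"
    using \<open>u \<noteq> v\<close> by (auto simp: in_keys_iff lookup_minus lookup_single when_def split: if_splits)
  have in_p: "initial_form w ?p \<in> initial_ideal w (toric_ideal A)"
    unfolding initial_ideal_def
    by (rule subsetD[OF left_ideal_gen_superset], rule imageI, rule toric_ideal_binomial[OF eq])
  \<comment> \<open>The heavier monomial survives in the initial form. If the weights are equal, the
    initial form is the whole binomial, and the choice of \<open>u\<close> is as good as that of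
    \<open>v\<close>.\<close>
  define x where "x = (if weight w v \<le> weight w u then u else v)"
  have "x \<in> keys (initial_form w ?p)"
    unfolding in_keys_iff lookup_initial_form keys
    using \<open>u \<noteq> v\<close> by (auto simp: x_def lookup_minus lookup_single)
  then have "single x 1 \<in> initial_ideal w (toric_ideal A)"
    by (rule monomial_ideal_terms[OF assms in_p])
  then show "single u 1 \<in> initial_ideal w (toric_ideal A)
      \<or> single v 1 \<in> initial_ideal w (toric_ideal A)"
    by (auto simp: x_def split: if_splits)
qed

lemma maximal_independent_spans:
  fixes A :: "int ^ 'n::finite ^ 'd::finite"
  assumes fin: "finite E" and indep: "independent_mod_system A I E"
    and max: "\<not> independent_mod_system A I (insert v E)" and I: "left_ideal_of UNIV I"
  shows "in_span_mod_system A I E v"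
proof (cases "v \<in> E")
  case True
  then show ?thesis using indep max by (simp add: insert_absorb)
next
  case False
  obtain c :: "_ \<Rightarrow> ('d, 'n) sxpoly" and u where
    c: "(\<Sum>u\<in>insert v E. coef_symbol (c u) * d_symbol u) \<in> system_relations A I" and u: "u \<in> insert v E" "c u \<noteq> 0"
    using max unfolding independent_mod_system_def by blast
  have sum: "(\<Sum>u\<in>insert v E. coef_symbol (c u) * d_symbol u) = coef_symbol (c v) * d_symbol v + (\<Sum>u\<in>E. coef_symbol (c u) * d_symbol u)"
    using fin False by simp
  have "c v \<noteq> 0"
  proof
    assume "c v = 0"
    then have "(\<Sum>u\<in>E. coef_symbol (c u) * d_symbol u) \<in> system_relations A I" using c sum by simp
    then have "\<forall>u\<in>E. c u = 0" using indep[unfolded independent_mod_system_def, rule_format, of c] by blast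
    then show False using u \<open>c v = 0\<close> by auto
  qed
  moreover have "coef_symbol (c v) * d_symbol v - (\<Sum>u\<in>E. coef_symbol (- c u) * d_symbol u) \<in> system_relations A I"
    using c sum by (simp add: coef_symbol_uminus sum_negf)
  ultimately show ?thesis unfolding in_span_mod_system_def
    by (intro exI[of _ "c v"] exI[of _ "\<lambda>u. - c u"]) simp
qed

theorem theorem1:
  fixes A :: "int ^ 'n::finite ^ 'd::finite"
    and w :: "int ^ 'n"
    and U :: "('d, 'n) diffop set"
  assumes "module.span (*s) (columns A) = UNIV"
    and "monomial_ideal (initial_ideal w (toric_ideal A))"
    and "ideal_degree CARD('d) (initial_ideal w (toric_ideal A))
           = ideal_degree CARD('d) (toric_ideal A)"
    and "finite U" and "U \<subseteq> range d_monom"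
    and "quot_basis d_scale UNIV (initial_system A w) U"
  shows "quot_basis d_scale UNIV (left_ideal_gen UNIV (hypergeom_ideal A)) U"
proof -
  let ?I = "toric_ideal A" and ?M = "initial_ideal w (toric_ideal A)"
  have I: "graded_ideal A ?I" and M: "graded_ideal A ?M"
    using graded_ideal_toric graded_ideal_monomial[OF assms(2)] by blast+
  then have I': "left_ideal_of UNIV ?I" and M': "left_ideal_of UNIV ?M"
    by (simp_all add: graded_ideal_def)
  obtain E where E: "finite E" "U = d_monom ` E"
    using finite_subset_image[OF assms(4,5)] by blast
  have basis: "quot_basis d_scale UNIV (system_ideal A ?M) (d_monom ` E)"
    using assms(6) by (simp add: initial_system_def system_ideal_def E(2))
  have indep: "independent_mod_system A ?I E"
    by (rule independent_initial_imp_independent[OF I E(1) quot_basis_imp_independent[OF E(1) basis]])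
  have deg: "of_rat (ideal_degree CARD('d) ?I) \<le> (of_nat (card E) :: real)"
    using ideal_degree_le_spanning[OF M face_independent_initial[OF assms(2)] E(1) quot_basis_imp_spanning[OF M' E(1) basis]]
    by (simp add: assms(3))
  have "in_span_mod_system A ?I E v" for v
  proof (cases "v \<in> E")
    case True
    have "(\<Sum>u\<in>E. coef_symbol (if u = v then 1 else 0) * d_symbol u) = (d_symbol v :: ('d, 'n) symbol)"
      using E(1) True by (subst sum.remove[of E v]) auto
    then show ?thesis unfolding in_span_mod_system_def using system_relations_0[OF I']
      by (intro exI[of _ "1 :: ('d, 'n) sxpoly"] exI[of _ "\<lambda>u. if u = v then 1 else 0 :: ('d, 'n) sxpoly"]) simp
  next
    case False
    \<comment> \<open>One more independent monomial would give \<open>card E + 1\<close> \<le>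
      degree of \<open>I\<^sub>A\<close> = degree of its initial ideal \<le>
      \<open>card E\<close>.\<close>
    have "\<not> independent_mod_system A ?I (insert v E)"
    proof
      assume "independent_mod_system A ?I (insert v E)"
      then have "real (card (insert v E)) \<le> of_rat (ideal_degree CARD('d) ?I)"
        using E(1) by (intro independent_le_ideal_degree[OF I]) auto
      then show False using deg E(1) False by simp
    qed
    then show ?thesis using maximal_independent_spans[OF E(1) indep _ I'] by blast
  qed
  then have "quot_basis d_scale UNIV (system_ideal A ?I) (d_monom ` E)"
    by (rule quot_basis_of_independent_spanning[OF I' E(1) indep])
  then show ?thesis by (simp add: hypergeom_ideal_generates E(2))
qed

end
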